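(* Let $(A\to M,\rho,[\cdot,\cdot])$ be a Lie algebroid and $\sigma\colon A\to T^*M$ an IM-2-form. Define $\iota=(\mathrm{id}_{TM},\sigma^t)\colon TM\to TM\oplus A^*$. Then $(A,TM,\iota)$ is a Dirac bialgebroid with ambient Courant algebroid $C$ the standard Courant–Dorfman structure on $TM\oplus T^*M$.
   Context: An IM-2-form is a vector bundle morphism $\sigma\colon A\to T^*M$ over $\mathrm{id}_M$ with $\langle\rho(a_1),\sigma(a_2)\rangle=-\langle\rho(a_2),\sigma(a_1)\rangle$ and $\sigma[a_1,a_2]=\mathcal L_{\rho(a_1)}\sigma(a_2)-i_{\rho(a_2)}d\sigma(a_1)$ for all $a_1,a_2\in\Gamma(A)$. The standard Courant algebroid $TM\oplus T^*M$ has anchor $\mathrm{pr}_{TM}$, pairing $\langle(X_1,\theta_1),(X_2,\theta_2)\rangle=\theta_1(X_2)+\theta_2(X_1)$ and bracket $[\![(X_1,\theta_1),(X_2,\theta_2)]\!]=([X_1,X_2],\mathcal L_{X_1}\theta_2-i_{X_2}d\theta_1)$. $TM$ has its standard Lie algebroid structure and is identified with $TM\oplus0\subseteq TM\oplus T^*M$. A Dirac structure in a Courant algebroid $C$ is a subbundle $U=U^\perp$ with $\Gamma(U)$ closed under the bracket; it is a Lie algebroid. $A\oplus T^*M$ is a degenerate Courant algebroid (Courant algebroid axioms except nondegeneracy) with anchor $\rho\circ\mathrm{pr}_A$, pairing $\langle(a_1,\theta_1),(a_2,\theta_2)\rangle_d=\theta_2(\rho(a_1))+\theta_1(\rho(a_2))$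 and bracket $[(a_1,\theta_1),(a_2,\theta_2)]_d=([a_1,a_2],\mathcal L_{\rho(a_1)}\theta_2-i_{\rho(a_2)}d\theta_1)$. The pairing of $TM\oplus A^*$ with $A\oplus T^*M$ is $\langle(X,\alpha),(a,\theta)\rangle=\alpha(a)+\theta(X)$. Dirac bialgebroid over $A$: a triple $(A,U,\iota)$ with $(U,\rho_U,[\cdot,\cdot]_U)$ a Lie algebroid over $M$ and $\iota\colon U\to TM\oplus A^*$ an injective vector bundle morphism with $\rho_U=\mathrm{pr}_{TM}\circ\iota$, such that there exist a Courant algebroid $C$ over $M$ (the ambient Courant algebroid) in which $U$ is a Dirac structure (inducing its Lie algebroid structure) and a vector bundle morphism $\Phi\colon A\oplus T^*M\to C$ over $\mathrm{id}_M$ preserving anchors, pairings and brackets, with $\Phi(A\oplus T^*M)+U=C$ and $\langle u,\Phi(\tau)\rangle_C=\langle\iota(u),\tau\rangle$ for all $(u,\tau)\in U\times_M(A\oplus T^*M)$. *)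

theory Defs
  imports "HOL-Analysis.Analysis" "HOL-Library.Function_Algebras"
begin

section \<open>Preliminaries\<close>

instantiation "fun" :: (type, real_vector) real_vector
begin

definition scaleR_fun :: "real \<Rightarrow> ('a \<Rightarrow> 'b) \<Rightarrow> 'a \<Rightarrow> 'b"
  where "scaleR_fun r f = (\<lambda>x. r *\<^sub>R f x)"

instance
  by standard (auto simp: scaleR_fun_def plus_fun_def fun_eq_iff algebra_simps)

end

text \<open>Only used for open \<open>S\<close> in a finite-dimensional space, where having continuous iterated
  directional derivatives of all orders is the same as being smooth.\<close>

primrec Ck_on :: "nat \<Rightarrow> 'e::real_normed_vector set \<Rightarrow> ('e \<Rightarrow> 'f::real_normed_vector) \<Rightarrow> bool"
  where
    "Ck_on 0 S f \<longleftrightarrow> continuous_on S f"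
  | "Ck_on (Suc k) S f \<longleftrightarrow> (\<forall>x\<in>S. f differentiable (at x)) \<and>
       (\<forall>v. Ck_on k S (\<lambda>x. frechet_derivative f (at x) v))"

definition smooth_on :: "'e::real_normed_vector set \<Rightarrow> ('e \<Rightarrow> 'f::real_normed_vector) \<Rightarrow> bool"
  where "smooth_on S f \<longleftrightarrow> (\<forall>k. Ck_on k S f)"

definition linear_on_subspace :: "'v::real_vector set \<Rightarrow> ('v \<Rightarrow> 'w::real_vector) \<Rightarrow> bool"
  where "linear_on_subspace S f \<longleftrightarrow>
    (\<forall>v\<in>S. \<forall>w\<in>S. f (v + w) = f v + f w) \<and> (\<forall>r. \<forall>v\<in>S. f (r *\<^sub>R v) = r *\<^sub>R f v)"


section \<open>Manifolds\<close>

text \<open>The underlying set of the manifold is the type \<open>'m\<close>; Hausdorffness and second countability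
  are its type classes. The model space \<open>'e\<close> is a finite-dimensional inner product space;
  class \<open>euclidean_space\<close> is not used because it excludes dimension 0.\<close>

type_synonym ('m, 'e) chart = "'m set \<times> ('m \<Rightarrow> 'e)"

definition chart_inv :: "('m, 'e) chart \<Rightarrow> 'e \<Rightarrow> 'm"
  where "chart_inv c = inv_into (fst c) (snd c)"

definition smooth_manifold ::
    "('m::{t2_space, second_countable_topology}, 'e::real_inner) chart set \<Rightarrow> bool"
  where "smooth_manifold M \<longleftrightarrow>
    (\<exists>B::'e set. finite B \<and> span B = UNIV) \<and>
    (\<Union>c\<in>M. fst c) = UNIV \<and>
    (\<forall>c\<in>M. open (fst c) \<and> open (snd c ` fst c) \<and>
      homeomorphism (fst c) (snd c ` fst c) (snd c) (chart_inv c)) \<and>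
    (\<forall>c\<in>M. \<forall>c'\<in>M. smooth_on (snd c ` (fst c \<inter> fst c')) (snd c' \<circ> chart_inv c))"

definition smooth_fun_on ::
    "('m, 'e::real_inner) chart set \<Rightarrow> 'm set \<Rightarrow> ('m \<Rightarrow> real) \<Rightarrow> bool"
  where "smooth_fun_on M U f \<longleftrightarrow>
    (\<forall>c\<in>M. smooth_on (snd c ` (U \<inter> fst c)) (f \<circ> chart_inv c))"

definition chart_at :: "('m, 'e) chart set \<Rightarrow> 'm \<Rightarrow> ('m, 'e) chart"
  where "chart_at M x = (SOME c. c \<in> M \<and> x \<in> fst c)"


section \<open>Tangent vectors\<close>

text \<open>A tangent vector at \<open>x\<close> assigns to each chart around \<open>x\<close> its coordinate vector there,
  compatibly with the Jacobians of the transition maps. It takes the value 0 on everything that is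
  not a chart around \<open>x\<close>.\<close>

type_synonym ('m, 'e) tvec = "('m, 'e) chart \<Rightarrow> 'e"

definition tangent_space ::
    "('m, 'e::real_inner) chart set \<Rightarrow> 'm \<Rightarrow> ('m, 'e) tvec set"
  where "tangent_space M x = {v.
    (\<forall>c\<in>M. \<forall>c'\<in>M. x \<in> fst c \<and> x \<in> fst c' \<longrightarrow>
      v c' = frechet_derivative (snd c' \<circ> chart_inv c) (at (snd c x)) (v c)) \<and>
    (\<forall>c. \<not> (c \<in> M \<and> x \<in> fst c) \<longrightarrow> v c = 0)}"

definition coord_tvec ::
    "('m, 'e::real_inner) chart set \<Rightarrow> ('m, 'e) chart \<Rightarrow> 'm \<Rightarrow> 'e \<Rightarrow> ('m, 'e) tvec"
  where "coord_tvec M c x w = (\<lambda>c'. if c' \<in> M \<and> x \<in> fst c'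
    then frechet_derivative (snd c' \<circ> chart_inv c) (at (snd c x)) w else 0)"

text \<open>The derivative of a function at \<open>x\<close> in the direction of \<open>v\<close>.\<close>

definition tvec_apply ::
    "('m, 'e::real_inner) chart set \<Rightarrow> 'm \<Rightarrow> ('m, 'e) tvec \<Rightarrow> ('m \<Rightarrow> real) \<Rightarrow> real"
  where "tvec_apply M x v f = (let c = chart_at M x in
    frechet_derivative (f \<circ> chart_inv c) (at (snd c x)) (v c))"


section \<open>Vector bundles\<close>

text \<open>The fibres are linear subspaces of a real vector space \<open>'v\<close>, which carries no topology.
  The smooth structure is given by a family of local frames \<open>(U, k, e)\<close>, where
  \<open>e 0 x, \<dots>, e (k - 1) x\<close> is a basis of the fibre over \<open>x \<in> U\<close>; this is the same as a family of
  local trivialisations. The rank may be 0.\<close>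

type_synonym ('m, 'v) frame = "'m set \<times> nat \<times> (nat \<Rightarrow> 'm \<Rightarrow> 'v)"

record ('m, 'v) vbundle =
  fibre :: "'m \<Rightarrow> 'v set"
  frames :: "('m, 'v) frame set"

definition basis_of :: "'v::real_vector set \<Rightarrow> nat \<Rightarrow> (nat \<Rightarrow> 'v) \<Rightarrow> bool"
  where "basis_of S k b \<longleftrightarrow>
    inj_on b {..<k} \<and> independent (b ` {..<k}) \<and> span (b ` {..<k}) = S"

definition smooth_section_on ::
    "('m::topological_space, 'e::real_inner) chart set \<Rightarrow> ('m, 'v::real_vector) vbundle \<Rightarrow>
      'm set \<Rightarrow> ('m \<Rightarrow> 'v) \<Rightarrow> bool"
  where "smooth_section_on M E U s \<longleftrightarrow>
    (\<forall>x\<in>U. s x \<in> fibre E x) \<and>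
    (\<forall>(V, k, e)\<in>frames E. \<exists>g. (\<forall>i<k. smooth_fun_on M (U \<inter> V) (g i)) \<and>
      (\<forall>x\<in>U \<inter> V. s x = (\<Sum>i<k. g i x *\<^sub>R e i x)))"

abbreviation sections ::
    "('m::topological_space, 'e::real_inner) chart set \<Rightarrow> ('m, 'v::real_vector) vbundle \<Rightarrow>
      ('m \<Rightarrow> 'v) set"
  where "sections M E \<equiv> {s. smooth_section_on M E UNIV s}"

definition vector_bundle ::
    "('m::topological_space, 'e::real_inner) chart set \<Rightarrow> ('m, 'v::real_vector) vbundle \<Rightarrow> bool"
  where "vector_bundle M E \<longleftrightarrow>
    (\<forall>x. subspace (fibre E x)) \<and>
    (\<Union>F\<in>frames E. fst F) = UNIV \<and>
    (\<forall>(U, k, e)\<in>frames E. open U \<and> (\<forall>x\<in>U. basis_of (fibre E x) k (\<lambda>i. e i x)) \<and>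
      (\<forall>i<k. smooth_section_on M E U (e i)))"

definition vb_morphism ::
    "('m::topological_space, 'e::real_inner) chart set \<Rightarrow> ('m, 'v::real_vector) vbundle \<Rightarrow>
      ('m, 'w::real_vector) vbundle \<Rightarrow> ('m \<Rightarrow> 'v \<Rightarrow> 'w) \<Rightarrow> bool"
  where "vb_morphism M E F \<phi> \<longleftrightarrow>
    (\<forall>x. \<phi> x ` fibre E x \<subseteq> fibre F x \<and> linear_on_subspace (fibre E x) (\<phi> x)) \<and>
    (\<forall>U s. open U \<and> smooth_section_on M E U s \<longrightarrow> smooth_section_on M F U (\<lambda>x. \<phi> x (s x)))"

text \<open>A family of subspaces of the fibres of \<open>E\<close> is a smooth subbundle.\<close>

definition subbundle ::
    "('m::topological_space, 'e::real_inner) chart set \<Rightarrow> ('m, 'v::real_vector) vbundle \<Rightarrow>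
      ('m \<Rightarrow> 'v set) \<Rightarrow> bool"
  where "subbundle M E L \<longleftrightarrow>
    (\<forall>x. subspace (L x) \<and> L x \<subseteq> fibre E x) \<and>
    (\<forall>x. \<exists>U k e. open U \<and> x \<in> U \<and> (\<forall>i<k. smooth_section_on M E U (e i)) \<and>
      (\<forall>y\<in>U. basis_of (L y) k (\<lambda>i. e i y)))"

definition tangent_bundle ::
    "('m, 'e::real_inner) chart set \<Rightarrow> ('m, ('m, 'e) tvec) vbundle"
  where "tangent_bundle M = \<lparr>
    fibre = tangent_space M,
    frames = {(fst c, k, \<lambda>i x. coord_tvec M c x (b i)) | c k b. c \<in> M \<and> basis_of UNIV k b}\<rparr>"

text \<open>Functionals on a fibre are extended by 0 to \<open>'v\<close>.\<close>

definition dual_bundle ::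
    "('m, 'v::real_vector) vbundle \<Rightarrow> ('m, 'v \<Rightarrow> real) vbundle"
  where "dual_bundle E = (let
      D = (\<lambda>x. {\<alpha>. linear_on_subspace (fibre E x) \<alpha> \<and> (\<forall>v. v \<notin> fibre E x \<longrightarrow> \<alpha> v = 0)})
    in \<lparr>
      fibre = D,
      frames = {(U, k, \<epsilon>) | U k \<epsilon>. \<exists>e. (U, k, e) \<in> frames E \<and>
        (\<forall>x\<in>U. \<forall>i<k. \<epsilon> i x \<in> D x \<and> (\<forall>j<k. \<epsilon> i x (e j x) = (if i = j then 1 else 0)))}\<rparr>)"

abbreviation cotangent_bundle ::
    "('m, 'e::real_inner) chart set \<Rightarrow> ('m, ('m, 'e) tvec \<Rightarrow> real) vbundle"
  where "cotangent_bundle M \<equiv> dual_bundle (tangent_bundle M)"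

definition direct_sum ::
    "('m, 'v::real_vector) vbundle \<Rightarrow> ('m, 'w::real_vector) vbundle \<Rightarrow> ('m, 'v \<times> 'w) vbundle"
    (infixr \<open>\<oplus>\<^sub>b\<close> 65)
  where "E \<oplus>\<^sub>b F = \<lparr>
    fibre = (\<lambda>x. fibre E x \<times> fibre F x),
    frames = {(U \<inter> V, k + l, \<lambda>i x. if i < k then (e i x, 0) else (0, f (i - k) x)) | U V k l e f.
      (U, k, e) \<in> frames E \<and> (V, l, f) \<in> frames F}\<rparr>"


section \<open>Cartan calculus\<close>

text \<open>In each chart the components of \<open>[X, Y]\<close> are
  \<open>X\<^sup>j \<partial>\<^sub>j Y\<^sup>i - Y\<^sup>j \<partial>\<^sub>j X\<^sup>i\<close>.\<close>

definition vf_bracket ::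
    "('m, 'e::real_inner) chart set \<Rightarrow> ('m \<Rightarrow> ('m, 'e) tvec) \<Rightarrow> ('m \<Rightarrow> ('m, 'e) tvec) \<Rightarrow>
      'm \<Rightarrow> ('m, 'e) tvec"
  where "vf_bracket M X Y = (\<lambda>x c. if c \<in> M \<and> x \<in> fst c then
      frechet_derivative (\<lambda>u. Y (chart_inv c u) c) (at (snd c x)) (X x c) -
      frechet_derivative (\<lambda>u. X (chart_inv c u) c) (at (snd c x)) (Y x c)
    else 0)"

text \<open>\<open>form_rep M c \<theta> u\<close> is the functional with coefficients \<open>\<theta>\<^sub>i(u)\<close> representing \<open>\<theta>\<close> in \<open>c\<close>.\<close>

definition form_rep ::
    "('m, 'e::real_inner) chart set \<Rightarrow> ('m, 'e) chart \<Rightarrow> ('m \<Rightarrow> ('m, 'e) tvec \<Rightarrow> real) \<Rightarrow>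
      'e \<Rightarrow> 'e \<Rightarrow> real"
  where "form_rep M c \<theta> u w = \<theta> (chart_inv c u) (coord_tvec M c (chart_inv c u) w)"

text \<open>\<open>d\<theta> = \<partial>\<^sub>i \<theta>\<^sub>j dx\<^sup>i \<and> dx\<^sup>j\<close>, with the convention
  \<open>d\<theta>(X, Y) = X \<theta>(Y) - Y \<theta>(X) - \<theta>([X, Y])\<close>.\<close>

definition ext_deriv ::
    "('m, 'e::real_inner) chart set \<Rightarrow> ('m \<Rightarrow> ('m, 'e) tvec \<Rightarrow> real) \<Rightarrow>
      'm \<Rightarrow> ('m, 'e) tvec \<Rightarrow> ('m, 'e) tvec \<Rightarrow> real"
  where "ext_deriv M \<theta> = (\<lambda>x v w. let c = chart_at M x in
    frechet_derivative (\<lambda>u. form_rep M c \<theta> u (w c)) (at (snd c x)) (v c) -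
    frechet_derivative (\<lambda>u. form_rep M c \<theta> u (v c)) (at (snd c x)) (w c))"

definition contract ::
    "('m, 'e::real_inner) chart set \<Rightarrow> ('m \<Rightarrow> ('m, 'e) tvec) \<Rightarrow>
      ('m \<Rightarrow> ('m, 'e) tvec \<Rightarrow> ('m, 'e) tvec \<Rightarrow> real) \<Rightarrow> 'm \<Rightarrow> ('m, 'e) tvec \<Rightarrow> real"
  where "contract M X \<eta> = (\<lambda>x v. if v \<in> tangent_space M x then \<eta> x (X x) v else 0)"

text \<open>\<open>(L\<^sub>X \<theta>)\<^sub>j = X\<^sup>i \<partial>\<^sub>i \<theta>\<^sub>j + \<theta>\<^sub>i \<partial>\<^sub>j X\<^sup>i\<close>.\<close>

definition lie_deriv ::
    "('m, 'e::real_inner) chart set \<Rightarrow> ('m \<Rightarrow> ('m, 'e) tvec) \<Rightarrow>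
      ('m \<Rightarrow> ('m, 'e) tvec \<Rightarrow> real) \<Rightarrow> 'm \<Rightarrow> ('m, 'e) tvec \<Rightarrow> real"
  where "lie_deriv M X \<theta> = (\<lambda>x v. if v \<in> tangent_space M x then (let c = chart_at M x in
      frechet_derivative (\<lambda>u. form_rep M c \<theta> u (v c)) (at (snd c x)) (X x c) +
      form_rep M c \<theta> (snd c x)
        (frechet_derivative (\<lambda>u. X (chart_inv c u) c) (at (snd c x)) (v c)))
    else 0)"


section \<open>Lie algebroids\<close>

record ('m, 'e, 'v) algebroid =
  bun :: "('m, 'v) vbundle"
  anchor :: "'m \<Rightarrow> 'v \<Rightarrow> ('m, 'e) tvec"
  bracket :: "('m \<Rightarrow> 'v) \<Rightarrow> ('m \<Rightarrow> 'v) \<Rightarrow> 'm \<Rightarrow> 'v"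

text \<open>The conditions shared by Lie and Courant algebroids.\<close>

definition anchored_bracket ::
    "('m::topological_space, 'e::real_inner) chart set \<Rightarrow>
      ('m, 'e, 'v::real_vector, 'z) algebroid_scheme \<Rightarrow> bool"
  where "anchored_bracket M A \<longleftrightarrow>
    vector_bundle M (bun A) \<and>
    vb_morphism M (bun A) (tangent_bundle M) (anchor A) \<and>
    (\<forall>a\<in>sections M (bun A). \<forall>b\<in>sections M (bun A).
      bracket A a b \<in> sections M (bun A) \<and>
      (\<lambda>x. anchor A x (bracket A a b x)) =
        vf_bracket M (\<lambda>x. anchor A x (a x)) (\<lambda>x. anchor A x (b x)) \<and>
      (\<forall>r. bracket A (r *\<^sub>R a) b = r *\<^sub>R bracket A a b \<and>
        bracket A a (r *\<^sub>R b) = r *\<^sub>R bracket A a b) \<and>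
      (\<forall>f. smooth_fun_on M UNIV f \<longrightarrow>
        bracket A a (\<lambda>x. f x *\<^sub>R b x) =
          (\<lambda>x. f x *\<^sub>R bracket A a b x + tvec_apply M x (anchor A x (a x)) f *\<^sub>R b x)) \<and>
      (\<forall>c\<in>sections M (bun A).
        bracket A (a + b) c = bracket A a c + bracket A b c \<and>
        bracket A a (b + c) = bracket A a b + bracket A a c))"

definition lie_algebroid ::
    "('m::topological_space, 'e::real_inner) chart set \<Rightarrow> ('m, 'e, 'v::real_vector) algebroid \<Rightarrow> bool"
  where "lie_algebroid M A \<longleftrightarrow>
    anchored_bracket M A \<and>
    (\<forall>a\<in>sections M (bun A). \<forall>b\<in>sections M (bun A).
      bracket A a b = - bracket A b a \<and>
      (\<forall>c\<in>sections M (bun A).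
        bracket A a (bracket A b c) + bracket A b (bracket A c a) + bracket A c (bracket A a b) = 0))"

definition tangent_algebroid ::
    "('m, 'e::real_inner) chart set \<Rightarrow> ('m, 'e, ('m, 'e) tvec) algebroid"
  where "tangent_algebroid M = \<lparr>
    bun = tangent_bundle M, anchor = (\<lambda>x v. v), bracket = vf_bracket M\<rparr>"

definition IM_2_form ::
    "('m::topological_space, 'e::real_inner) chart set \<Rightarrow> ('m, 'e, 'v::real_vector) algebroid \<Rightarrow>
      ('m \<Rightarrow> 'v \<Rightarrow> ('m, 'e) tvec \<Rightarrow> real) \<Rightarrow> bool"
  where "IM_2_form M A \<sigma> \<longleftrightarrow>
    vb_morphism M (bun A) (cotangent_bundle M) \<sigma> \<and>
    (\<forall>x. \<forall>a\<in>fibre (bun A) x. \<forall>b\<in>fibre (bun A) x.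
      \<sigma> x b (anchor A x a) = - \<sigma> x a (anchor A x b)) \<and>
    (\<forall>a\<in>sections M (bun A). \<forall>b\<in>sections M (bun A).
      (\<lambda>x. \<sigma> x (bracket A a b x)) =
        lie_deriv M (\<lambda>x. anchor A x (a x)) (\<lambda>x. \<sigma> x (b x)) -
        contract M (\<lambda>x. anchor A x (b x)) (ext_deriv M (\<lambda>x. \<sigma> x (a x))))"


section \<open>Courant algebroids\<close>

record ('m, 'e, 'v) courant = "('m, 'e, 'v) algebroid" +
  pairing :: "'m \<Rightarrow> 'v \<Rightarrow> 'v \<Rightarrow> real"

text \<open>The last axiom is \<open>\<lbrakk>a, b\<rbrakk> + \<lbrakk>b, a\<rbrakk> = \<D>\<langle>a, b\<rangle>\<close>, where \<open>\<D> f\<close> is defined by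
  \<open>\<langle>\<D> f, v\<rangle> = \<rho>(v) f\<close>.\<close>

definition courant_algebroid ::
    "('m::topological_space, 'e::real_inner) chart set \<Rightarrow> ('m, 'e, 'v::real_vector) courant \<Rightarrow> bool"
  where "courant_algebroid M C \<longleftrightarrow>
    anchored_bracket M C \<and>
    (\<forall>x. \<forall>v\<in>fibre (bun C) x.
      linear_on_subspace (fibre (bun C) x) (pairing C x v) \<and>
      (\<forall>w\<in>fibre (bun C) x. pairing C x v w = pairing C x w v) \<and>
      ((\<forall>w\<in>fibre (bun C) x. pairing C x v w = 0) \<longrightarrow> v = 0)) \<and>
    (\<forall>U a b. open U \<and> smooth_section_on M (bun C) U a \<and> smooth_section_on M (bun C) U b \<longrightarrow>
      smooth_fun_on M U (\<lambda>x. pairing C x (a x) (b x))) \<and>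
    (\<forall>a\<in>sections M (bun C). \<forall>b\<in>sections M (bun C). \<forall>c\<in>sections M (bun C).
      bracket C a (bracket C b c) = bracket C (bracket C a b) c + bracket C b (bracket C a c) \<and>
      (\<forall>x. tvec_apply M x (anchor C x (a x)) (\<lambda>y. pairing C y (b y) (c y)) =
        pairing C x (bracket C a b x) (c x) + pairing C x (b x) (bracket C a c x))) \<and>
    (\<forall>a\<in>sections M (bun C). \<forall>b\<in>sections M (bun C). \<forall>x. \<forall>v\<in>fibre (bun C) x.
      pairing C x (bracket C a b x + bracket C b a x) v =
        tvec_apply M x (anchor C x v) (\<lambda>y. pairing C y (a y) (b y)))"

definition dirac_structure ::
    "('m::topological_space, 'e::real_inner) chart set \<Rightarrow> ('m, 'e, 'v::real_vector) courant \<Rightarrow>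
      ('m \<Rightarrow> 'v set) \<Rightarrow> bool"
  where "dirac_structure M C L \<longleftrightarrow>
    subbundle M (bun C) L \<and>
    (\<forall>x. L x = {v \<in> fibre (bun C) x. \<forall>w\<in>L x. pairing C x v w = 0}) \<and>
    (\<forall>a\<in>sections M (bun C). \<forall>b\<in>sections M (bun C).
      (\<forall>x. a x \<in> L x) \<and> (\<forall>x. b x \<in> L x) \<longrightarrow> (\<forall>x. bracket C a b x \<in> L x))"

text \<open>The degenerate Courant algebroid \<open>A \<oplus> T\<^sup>*M\<close>.\<close>

definition degenerate_courant ::
    "('m, 'e::real_inner) chart set \<Rightarrow> ('m, 'e, 'v::real_vector) algebroid \<Rightarrow>
      ('m, 'e, 'v \<times> (('m, 'e) tvec \<Rightarrow> real)) courant"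
  where "degenerate_courant M A = \<lparr>
    bun = bun A \<oplus>\<^sub>b cotangent_bundle M,
    anchor = (\<lambda>x p. anchor A x (fst p)),
    bracket = (\<lambda>p q x.
      (bracket A (\<lambda>y. fst (p y)) (\<lambda>y. fst (q y)) x,
       lie_deriv M (\<lambda>y. anchor A y (fst (p y))) (\<lambda>y. snd (q y)) x -
       contract M (\<lambda>y. anchor A y (fst (q y))) (ext_deriv M (\<lambda>y. snd (p y))) x)),
    pairing = (\<lambda>x p q. snd q (anchor A x (fst p)) + snd p (anchor A x (fst q)))\<rparr>"

definition standard_courant ::
    "('m, 'e::real_inner) chart set \<Rightarrow>
      ('m, 'e, ('m, 'e) tvec \<times> (('m, 'e) tvec \<Rightarrow> real)) courant"
  where "standard_courant M = \<lparr>
    bun = tangent_bundle M \<oplus>\<^sub>b cotangent_bundle M,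
    anchor = (\<lambda>x. fst),
    bracket = (\<lambda>p q x.
      (vf_bracket M (\<lambda>y. fst (p y)) (\<lambda>y. fst (q y)) x,
       lie_deriv M (\<lambda>y. fst (p y)) (\<lambda>y. snd (q y)) x -
       contract M (\<lambda>y. fst (q y)) (ext_deriv M (\<lambda>y. snd (p y))) x)),
    pairing = (\<lambda>x p q. snd p (fst q) + snd q (fst p))\<rparr>"


section \<open>Dirac bialgebroids\<close>

text \<open>\<open>(A, U, \<iota>)\<close> is a Dirac bialgebroid with ambient Courant algebroid \<open>C\<close>, in which \<open>U\<close> is
  regarded as a subbundle by means of \<open>j\<close>. The ambient data are parameters, since one cannot
  quantify existentially over the type of the fibres of \<open>C\<close>.\<close>

definition dirac_bialgebroid_with_ambient ::
    "('m::topological_space, 'e::real_inner) chart set \<Rightarrow>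
      ('m, 'e, 'c::real_vector) courant \<Rightarrow> ('m \<Rightarrow> 'u \<Rightarrow> 'c) \<Rightarrow>
      ('m, 'e, 'v::real_vector) algebroid \<Rightarrow> ('m, 'e, 'u::real_vector) algebroid \<Rightarrow>
      ('m \<Rightarrow> 'u \<Rightarrow> ('m, 'e) tvec \<times> ('v \<Rightarrow> real)) \<Rightarrow> bool"
  where "dirac_bialgebroid_with_ambient M C j A U \<iota> \<longleftrightarrow>
    lie_algebroid M A \<and> lie_algebroid M U \<and>
    vb_morphism M (bun U) (tangent_bundle M \<oplus>\<^sub>b dual_bundle (bun A)) \<iota> \<and>
    (\<forall>x. inj_on (\<iota> x) (fibre (bun U) x)) \<and>
    (\<forall>x. \<forall>u\<in>fibre (bun U) x. anchor U x u = fst (\<iota> x u)) \<and>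
    courant_algebroid M C \<and>
    vb_morphism M (bun U) (bun C) j \<and> (\<forall>x. inj_on (j x) (fibre (bun U) x)) \<and>
    dirac_structure M C (\<lambda>x. j x ` fibre (bun U) x) \<and>
    (\<forall>x. \<forall>u\<in>fibre (bun U) x. anchor U x u = anchor C x (j x u)) \<and>
    (\<forall>u\<in>sections M (bun U). \<forall>v\<in>sections M (bun U).
      (\<lambda>x. j x (bracket U u v x)) = bracket C (\<lambda>x. j x (u x)) (\<lambda>x. j x (v x))) \<and>
    (\<exists>\<Phi>. let D = degenerate_courant M A in
      vb_morphism M (bun D) (bun C) \<Phi> \<and>
      (\<forall>x. \<forall>\<tau>\<in>fibre (bun D) x. anchor C x (\<Phi> x \<tau>) = anchor D x \<tau>) \<and>
      (\<forall>x. \<forall>\<tau>\<in>fibre (bun D) x. \<forall>\<tau>'\<in>fibre (bun D) x.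
        pairing C x (\<Phi> x \<tau>) (\<Phi> x \<tau>') = pairing D x \<tau> \<tau>') \<and>
      (\<forall>\<tau>\<in>sections M (bun D). \<forall>\<tau>'\<in>sections M (bun D).
        (\<lambda>x. \<Phi> x (bracket D \<tau> \<tau>' x)) = bracket C (\<lambda>x. \<Phi> x (\<tau> x)) (\<lambda>x. \<Phi> x (\<tau>' x))) \<and>
      (\<forall>x. {\<Phi> x \<tau> + j x u | \<tau> u. \<tau> \<in> fibre (bun D) x \<and> u \<in> fibre (bun U) x} = fibre (bun C) x) \<and>
      (\<forall>x. \<forall>u\<in>fibre (bun U) x. \<forall>\<tau>\<in>fibre (bun D) x.
        pairing C x (j x u) (\<Phi> x \<tau>) = snd (\<iota> x u) (fst \<tau>) + snd \<tau> (fst (\<iota> x u))))"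

definition transpose_form ::
    "('m, 'e::real_inner, 'v::real_vector) algebroid \<Rightarrow>
      ('m \<Rightarrow> 'v \<Rightarrow> ('m, 'e) tvec \<Rightarrow> real) \<Rightarrow> 'm \<Rightarrow> ('m, 'e) tvec \<Rightarrow> 'v \<Rightarrow> real"
  where "transpose_form A \<sigma> x v = (\<lambda>a. if a \<in> fibre (bun A) x then \<sigma> x a v else 0)"

end

theory Submission
  imports Defs
begin

text \<open>
  The morphism \<open>\<Phi>\<close> from \<open>A \<oplus> T\<^sup>*M\<close> to \<open>TM \<oplus> T\<^sup>*M\<close> is \<open>(a, \<theta>) \<mapsto> (\<rho> a, \<sigma> a + \<theta>)\<close>. The two clauses
  in the definition of an IM-2-form are what makes it a morphism: skew-symmetry cancels the terms
  in which \<open>\<sigma>\<close> meets \<open>\<rho>\<close> in the pairing, and the bracket condition says that \<open>a \<mapsto> (\<rho> a, \<sigma> a)\<close>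
  preserves brackets, to which the terms in \<open>\<theta>\<close> are added by bilinearity (\<open>im_map_pairing\<close>,
  \<open>im_map_bracket\<close>). The image contains \<open>0 \<oplus> T\<^sup>*M\<close>, a complement of \<open>TM\<close>, and pairing it with \<open>TM\<close>
  gives \<open>\<sigma>(a)(X) + \<theta>(X)\<close>, which is the pairing with \<open>(X, \<sigma>\<^sup>t X)\<close>.

  What remains is independent of \<open>A\<close>: the tangent bundle is a Lie algebroid, \<open>TM \<oplus> T\<^sup>*M\<close> is a
  Courant algebroid, and \<open>TM\<close> is a Dirac structure in it (\<open>lie_algebroid_tangent\<close>,
  \<open>courant_algebroid_standard\<close>, \<open>dirac_structure_tangent\<close>). The identities behind these statements are
  proved for fields and forms on an open set of the model space. There everything is expressed by
  directional derivatives: the bracket is the commutator of derivations (\<open>along_loc_bracket\<close>), and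
  \<open>(L\<^sub>X \<theta>)(Y) = X \<theta>(Y) - \<theta>[X, Y]\<close> and \<open>d\<theta>(X, Y) = X \<theta>(Y) - Y \<theta>(X) - \<theta>[X, Y]\<close>, so that each identity
  becomes a cancellation of terms; \<open>loc_dorfman_jacobi\<close> is the longest instance.

  The passage to the manifold rests on two facts. The local operations are natural under changes of
  charts, so that the results do not depend on the chart in which they are computed
  (\<open>loc_bracket_related\<close>, \<open>loc_lie_related\<close>, \<open>loc_ext_related\<close>). And a section of the tangent or
  cotangent bundle, whose smoothness is defined by coefficients in local frames, is smooth if and
  only if its components in every chart are.
\<close>

section \<open>Smooth maps on open sets\<close>

abbreviation fderiv ::
    "('a::real_normed_vector \<Rightarrow> 'b::real_normed_vector) \<Rightarrow> 'a \<Rightarrow> 'a \<Rightarrow> 'b"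
  where "fderiv f x \<equiv> frechet_derivative f (at x)"

lemma has_derivative_cong_open:
  assumes "open S" "x \<in> S" "\<And>y. y \<in> S \<Longrightarrow> f y = g y"
  shows "(f has_derivative F) (at x) \<longleftrightarrow> (g has_derivative F) (at x)"
  using assms has_derivative_transform_within_open[of f F x UNIV S g]
    has_derivative_transform_within_open[of g F x UNIV S f] by auto

lemma frechet_derivative_cong_open:
  assumes "open S" "x \<in> S" "\<And>y. y \<in> S \<Longrightarrow> f y = g y"
  shows "fderiv f x = fderiv g x"
  unfolding frechet_derivative_def using has_derivative_cong_open[OF assms] by simp

lemma frechet_derivative_eqI:
  "(f has_derivative F) (at x) \<Longrightarrow> fderiv f x = F"
  using frechet_derivative_at by metis

lemma Ck_on_cong:
  assumes "open S" "\<And>y. y \<in> S \<Longrightarrow> f y = g y"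
  shows "Ck_on k S f \<longleftrightarrow> Ck_on k S g"
  using assms(2)
proof (induction k arbitrary: f g)
  case 0
  then show ?case by (auto intro: continuous_on_cong)
next
  case (Suc k)
  have "f differentiable (at x) \<longleftrightarrow> g differentiable (at x)" if "x \<in> S" for x
    unfolding differentiable_def using has_derivative_cong_open[OF assms(1) that] Suc.prems by blast
  moreover have "Ck_on k S (\<lambda>x. fderiv f x v)
      \<longleftrightarrow> Ck_on k S (\<lambda>x. fderiv g x v)" for v
    by (rule Suc.IH) (use frechet_derivative_cong_open[OF assms(1)] Suc.prems in metis)
  ultimately show ?case by simp
qed

lemma Ck_on_subset: "Ck_on k S f \<Longrightarrow> T \<subseteq> S \<Longrightarrow> Ck_on k T f"
  by (induction k arbitrary: f) (auto intro: continuous_on_subset)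

lemma Ck_on_UN:
  "(\<And>i. i \<in> I \<Longrightarrow> open (T i)) \<Longrightarrow> (\<And>i. i \<in> I \<Longrightarrow> Ck_on k (T i) f) \<Longrightarrow> Ck_on k (\<Union>i\<in>I. T i) f"
proof (induction k arbitrary: f)
  case 0
  then show ?case by (auto intro!: continuous_on_open_UN)
next
  case (Suc k)
  then show ?case by auto
qed

lemma Ck_on_Suc_imp: "Ck_on (Suc k) S f \<Longrightarrow> Ck_on k S f"
proof (induction k arbitrary: f)
  case 0
  then show ?case
    by (auto intro!: continuous_at_imp_continuous_on differentiable_imp_continuous_within)
next
  case (Suc k)
  then show ?case by (metis Ck_on.simps(2))
qed

lemma frechet_derivative_plus:
  assumes "f differentiable (at x)" "g differentiable (at x)"
  shows "fderiv (\<lambda>x. f x + g x) x v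
    = fderiv f x v + fderiv g x v"
  using has_derivative_add[OF assms[unfolded frechet_derivative_works]]
  by (simp add: frechet_derivative_eqI)

lemma frechet_derivative_minus:
  assumes "f differentiable (at x)" "g differentiable (at x)"
  shows "fderiv (\<lambda>x. f x - g x) x v
    = fderiv f x v - fderiv g x v"
  using has_derivative_diff[OF assms[unfolded frechet_derivative_works]]
  by (simp add: frechet_derivative_eqI)

lemma frechet_derivative_bounded_linear:
  assumes "bounded_linear h" "f differentiable (at x)"
  shows "fderiv (\<lambda>x. h (f x)) x v = h (fderiv f x v)"
  using bounded_linear.has_derivative[OF assms(1) assms(2)[unfolded frechet_derivative_works]]
  by (simp add: frechet_derivative_eqI)

lemma frechet_derivative_bilinear:
  assumes "bounded_bilinear B" "f differentiable (at x)" "g differentiable (at x)"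
  shows "fderiv (\<lambda>x. B (f x) (g x)) x v
    = B (f x) (fderiv g x v) + B (fderiv f x v) (g x)"
  using bounded_bilinear.FDERIV[OF assms(1) assms(2,3)[unfolded frechet_derivative_works]]
  by (simp add: frechet_derivative_eqI)

lemma differentiable_bounded_linear:
  "bounded_linear h \<Longrightarrow> f differentiable (at x) \<Longrightarrow> (\<lambda>x. h (f x)) differentiable (at x)"
  unfolding differentiable_def using bounded_linear.has_derivative by blast

lemma differentiable_bilinear:
  "bounded_bilinear B \<Longrightarrow> f differentiable (at x) \<Longrightarrow> g differentiable (at x) \<Longrightarrow>
    (\<lambda>x. B (f x) (g x)) differentiable (at x)"
  unfolding differentiable_def using bounded_bilinear.FDERIV by blast

lemma Ck_on_const: "Ck_on k S (\<lambda>_. c)"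
  by (induction k arbitrary: c) auto

lemma Ck_on_add:
  assumes "open S"
  shows "Ck_on k S f \<Longrightarrow> Ck_on k S g \<Longrightarrow> Ck_on k S (\<lambda>x. f x + g x)"
proof (induction k arbitrary: f g)
  case 0
  then show ?case by (auto intro: continuous_intros)
next
  case (Suc k)
  have "Ck_on k S (\<lambda>x. fderiv (\<lambda>x. f x + g x) x v)" for v
    using Suc by (subst Ck_on_cong[OF assms frechet_derivative_plus]) auto
  with Suc.prems show ?case by auto
qed

lemma Ck_on_sum:
  "open S \<Longrightarrow> (\<And>i. i \<in> I \<Longrightarrow> Ck_on k S (f i)) \<Longrightarrow> Ck_on k S (\<lambda>x. \<Sum>i\<in>I. f i x)"
  by (induction I rule: infinite_finite_induct) (auto intro: Ck_on_const Ck_on_add)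

lemma Ck_on_bounded_linear:
  assumes "open S" "bounded_linear h"
  shows "Ck_on k S f \<Longrightarrow> Ck_on k S (\<lambda>x. h (f x))"
proof (induction k arbitrary: f)
  case 0
  then show ?case by (auto intro: bounded_linear.continuous_on[OF assms(2)])
next
  case (Suc k)
  have "Ck_on k S (\<lambda>x. fderiv (\<lambda>x. h (f x)) x v)" for v
    using Suc by (subst Ck_on_cong[OF assms(1) frechet_derivative_bounded_linear[OF assms(2)]]) auto
  with Suc.prems show ?case by (auto intro: differentiable_bounded_linear[OF assms(2)])
qed

lemma Ck_on_bilinear:
  assumes "open S" "bounded_bilinear B"
  shows "Ck_on k S f \<Longrightarrow> Ck_on k S g \<Longrightarrow> Ck_on k S (\<lambda>x. B (f x) (g x))"
proof (induction k arbitrary: f g)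
  case 0
  then show ?case by (auto intro: bounded_bilinear.continuous_on[OF assms(2)])
next
  case (Suc k)
  have "Ck_on k S (\<lambda>x. fderiv (\<lambda>x. B (f x) (g x)) x v)" for v
    using Suc Ck_on_Suc_imp[of k S f] Ck_on_Suc_imp[of k S g]
    by (subst Ck_on_cong[OF assms(1) frechet_derivative_bilinear[OF assms(2)]])
      (auto intro!: Ck_on_add assms)
  with Suc.prems show ?case by (auto intro: differentiable_bilinear[OF assms(2)])
qed

lemma smooth_on_cong:
  "open S \<Longrightarrow> (\<And>y. y \<in> S \<Longrightarrow> f y = g y) \<Longrightarrow> smooth_on S f \<longleftrightarrow> smooth_on S g"
  unfolding smooth_on_def using Ck_on_cong by blast

lemma smooth_on_subset: "smooth_on S f \<Longrightarrow> T \<subseteq> S \<Longrightarrow> smooth_on T f"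
  unfolding smooth_on_def using Ck_on_subset by blast

lemma smooth_on_UN:
  "(\<And>i. i \<in> I \<Longrightarrow> open (T i)) \<Longrightarrow> (\<And>i. i \<in> I \<Longrightarrow> smooth_on (T i) f) \<Longrightarrow> smooth_on (\<Union>i\<in>I. T i) f"
  unfolding smooth_on_def using Ck_on_UN by blast

lemma smooth_on_const: "smooth_on S (\<lambda>_. c)"
  by (simp add: smooth_on_def Ck_on_const)

lemma smooth_on_add:
  "open S \<Longrightarrow> smooth_on S f \<Longrightarrow> smooth_on S g \<Longrightarrow> smooth_on S (\<lambda>x. f x + g x)"
  by (simp add: smooth_on_def Ck_on_add)

lemma smooth_on_sum:
  "open S \<Longrightarrow> (\<And>i. i \<in> I \<Longrightarrow> smooth_on S (f i)) \<Longrightarrow> smooth_on S (\<lambda>x. \<Sum>i\<in>I. f i x)"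
  by (simp add: smooth_on_def Ck_on_sum)

lemma smooth_on_bounded_linear:
  "open S \<Longrightarrow> bounded_linear h \<Longrightarrow> smooth_on S f \<Longrightarrow> smooth_on S (\<lambda>x. h (f x))"
  by (simp add: smooth_on_def Ck_on_bounded_linear)

lemma smooth_on_bilinear:
  "open S \<Longrightarrow> bounded_bilinear B \<Longrightarrow> smooth_on S f \<Longrightarrow> smooth_on S g \<Longrightarrow>
    smooth_on S (\<lambda>x. B (f x) (g x))"
  by (simp add: smooth_on_def Ck_on_bilinear)

lemma smooth_on_scaleR:
  "open S \<Longrightarrow> smooth_on S f \<Longrightarrow> smooth_on S g \<Longrightarrow> smooth_on S (\<lambda>x. f x *\<^sub>R g x)"
  by (rule smooth_on_bilinear[OF _ bounded_bilinear_scaleR])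

lemma smooth_on_mult:
  fixes f g :: "_ \<Rightarrow> real"
  shows "open S \<Longrightarrow> smooth_on S f \<Longrightarrow> smooth_on S g \<Longrightarrow> smooth_on S (\<lambda>x. f x * g x)"
  by (rule smooth_on_bilinear[OF _ bounded_bilinear_mult])

lemma smooth_on_inner_left:
  "open S \<Longrightarrow> smooth_on S f \<Longrightarrow> smooth_on S (\<lambda>x. f x \<bullet> b)"
  by (rule smooth_on_bounded_linear[OF _ bounded_linear_inner_left])

lemma smooth_on_minus:
  assumes "open S" "smooth_on S f" "smooth_on S g"
  shows "smooth_on S (\<lambda>x. f x - g x)"
  using smooth_on_add[OF assms(1,2) smooth_on_bounded_linear[OF assms(1) bounded_linear_minus[OF bounded_linear_ident] assms(3)]]
  by simp

lemma smooth_on_differentiable: "smooth_on S f \<Longrightarrow> x \<in> S \<Longrightarrow> f differentiable (at x)"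
  unfolding smooth_on_def by (metis Ck_on.simps(2))

lemma smooth_on_continuous: "smooth_on S f \<Longrightarrow> continuous_on S f"
  unfolding smooth_on_def by (metis Ck_on.simps(1))

lemma smooth_on_frechet_derivative:
  "smooth_on S f \<Longrightarrow> smooth_on S (\<lambda>x. fderiv f x v)"
  unfolding smooth_on_def by (metis Ck_on.simps(2))

lemma smooth_on_has_derivative:
  "smooth_on S f \<Longrightarrow> x \<in> S \<Longrightarrow> (f has_derivative fderiv f x) (at x)"
  using frechet_derivative_works smooth_on_differentiable by blast


section \<open>Symmetry of second derivatives\<close>

text \<open>The second difference of \<open>f\<close> over a small parallelogram equals, by the mean value theorem
  applied in each of the two directions, a mixed second derivative at a nearby point.\<close>

lemma second_difference_mean_value:
  fixes f :: "'a::real_normed_vector \<Rightarrow> real"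
  assumes S: "ball x e \<subseteq> S" and f: "smooth_on S f"
    and h: "0 < h" "h * (norm v + norm w) < e"
  shows "\<exists>p. dist x p \<le> h * (norm v + norm w) \<and>
    f (x + h *\<^sub>R v + h *\<^sub>R w) - f (x + h *\<^sub>R v) - f (x + h *\<^sub>R w) + f x
      = h * (h * fderiv (\<lambda>y. fderiv f y v) p w)"
proof -
  have near: "dist x (x + s *\<^sub>R v + t *\<^sub>R w) \<le> h * (norm v + norm w)"
    if "0 \<le> s" "s \<le> h" "0 \<le> t" "t \<le> h" for s t
  proof -
    have "dist x (x + s *\<^sub>R v + t *\<^sub>R w) = norm (s *\<^sub>R v + t *\<^sub>R w)"
      unfolding dist_norm by (metis add.assoc add_diff_cancel_left' norm_minus_commute)
    also have "\<dots> \<le> s * norm v + t * norm w"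
      using norm_triangle_ineq[of "s *\<^sub>R v" "t *\<^sub>R w"] that by simp
    also have "\<dots> \<le> h * norm v + h * norm w"
      using that by (intro add_mono mult_right_mono) auto
    finally show ?thesis by (simp add: algebra_simps)
  qed
  have inS: "x + s *\<^sub>R v + t *\<^sub>R w \<in> S" if "0 \<le> s" "s \<le> h" "0 \<le> t" "t \<le> h" for s t
    using near[OF that] h(2) S by (auto simp: subset_iff)
  have D: "((\<lambda>s. g (z + s *\<^sub>R u)) has_real_derivative fderiv g (z + s *\<^sub>R u) u) (at s)"
    if "smooth_on S g" "z + s *\<^sub>R u \<in> S" for g :: "'a \<Rightarrow> real" and z u s
  proof -
    have "((\<lambda>s. g (z + s *\<^sub>R u)) has_derivative
        (\<lambda>r. fderiv g (z + s *\<^sub>R u) (r *\<^sub>R u))) (at s)"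
      by (rule has_derivative_compose[of _ _ s UNIV g])
        (use smooth_on_has_derivative[OF that] in \<open>auto intro!: derivative_eq_intros\<close>)
    moreover have "fderiv g (z + s *\<^sub>R u) (r *\<^sub>R u)
        = fderiv g (z + s *\<^sub>R u) u * r" for r
      using linear_frechet_derivative[OF smooth_on_differentiable[OF that]]
      by (simp add: linear_scale)
    ultimately show ?thesis by (simp add: has_field_derivative_def)
  qed
  define \<phi> where "\<phi> s = f ((x + h *\<^sub>R w) + s *\<^sub>R v) - f (x + s *\<^sub>R v)" for s
  define Df where "Df y = fderiv f y v" for y
  have sDf: "smooth_on S Df"
    unfolding Df_def by (rule smooth_on_frechet_derivative[OF f])
  have "\<exists>\<xi>. 0 < \<xi> \<and> \<xi> < h \<and> \<phi> h - \<phi> 0 = (h - 0) * (Df ((x + h *\<^sub>R w) + \<xi> *\<^sub>R v) - Df (x + \<xi> *\<^sub>R v))"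
  proof (rule MVT2[OF h(1)])
    fix s assume "0 \<le> s" "s \<le> h"
    then have "(x + h *\<^sub>R w) + s *\<^sub>R v \<in> S" "x + s *\<^sub>R v \<in> S"
      using inS[of s h] inS[of s 0] h by (auto simp: algebra_simps)
    then show "(\<phi> has_real_derivative Df ((x + h *\<^sub>R w) + s *\<^sub>R v) - Df (x + s *\<^sub>R v)) (at s)"
      unfolding \<phi>_def Df_def by (intro DERIV_diff D[OF f])
  qed
  then obtain \<xi> where \<xi>: "0 < \<xi>" "\<xi> < h"
    "\<phi> h - \<phi> 0 = h * (Df ((x + \<xi> *\<^sub>R v) + h *\<^sub>R w) - Df (x + \<xi> *\<^sub>R v))"
    by (auto simp: algebra_simps)
  have "\<exists>\<eta>. 0 < \<eta> \<and> \<eta> < h \<and> Df ((x + \<xi> *\<^sub>R v) + h *\<^sub>R w) - Df ((x + \<xi> *\<^sub>R v) + 0 *\<^sub>R w)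
      = (h - 0) * fderiv Df ((x + \<xi> *\<^sub>R v) + \<eta> *\<^sub>R w) w"
    by (rule MVT2[OF h(1)], rule D[OF sDf]) (use inS \<xi> in auto)
  then obtain \<eta> where \<eta>: "0 < \<eta>" "\<eta> < h" "Df ((x + \<xi> *\<^sub>R v) + h *\<^sub>R w) - Df (x + \<xi> *\<^sub>R v)
      = h * fderiv Df ((x + \<xi> *\<^sub>R v) + \<eta> *\<^sub>R w) w"
    by auto
  have "f (x + h *\<^sub>R v + h *\<^sub>R w) - f (x + h *\<^sub>R v) - f (x + h *\<^sub>R w) + f x = \<phi> h - \<phi> 0"
    by (simp add: \<phi>_def algebra_simps)
  also have "\<dots> = h * (h * fderiv Df (x + \<xi> *\<^sub>R v + \<eta> *\<^sub>R w) w)"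
    using \<xi>(3) \<eta>(3) by simp
  finally show ?thesis
    using near[of \<xi> \<eta>] \<xi>(1,2) \<eta>(1,2) unfolding Df_def
    by (intro exI[of _ "x + \<xi> *\<^sub>R v + \<eta> *\<^sub>R w"]) auto
qed

lemma second_derivative_symmetric_real:
  fixes f :: "'a::real_normed_vector \<Rightarrow> real"
  assumes S: "open S" "x \<in> S" and f: "smooth_on S f"
  shows "fderiv (\<lambda>y. fderiv f y v) x w
    = fderiv (\<lambda>y. fderiv f y w) x v"
proof -
  define P where "P v w y = fderiv (\<lambda>y. fderiv f y v) y w" for v w y
  have cont: "isCont (P v w) x" for v w
    using smooth_on_continuous[OF smooth_on_frechet_derivative[OF smooth_on_frechet_derivative[OF f]]] S
    unfolding P_def using continuous_on_eq_continuous_at by blast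
  obtain e where e: "e > 0" "ball x e \<subseteq> S"
    using S open_contains_ball by blast
  define N where "N = norm v + norm w + 1"
  define h where "h n = e / N / (real n + 2)" for n
  have N: "N > 0" "norm v + norm w < N" unfolding N_def using norm_ge_zero[of v] norm_ge_zero[of w] by linarith+
  have h: "h n > 0" "h n * (norm v + norm w) < e" for n
  proof -
    show pos: "h n > 0" using e N by (auto simp: h_def)
    have "h n * (norm v + norm w) < h n * N" using pos N by simp
    also have "\<dots> = e / (real n + 2)" using N by (simp add: h_def)
    also have "\<dots> \<le> e / 1" using e by (intro divide_left_mono) auto
    finally show "h n * (norm v + norm w) < e" by simp
  qed
  have "\<exists>p q. dist x p \<le> h n * (norm v + norm w) \<and> dist x q \<le> h n * (norm v + norm w)
      \<and> P v w p = P w v q" for n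
  proof -
    have "\<exists>p. dist x p \<le> h n * (norm v + norm w) \<and>
      f (x + h n *\<^sub>R v + h n *\<^sub>R w) - f (x + h n *\<^sub>R v) - f (x + h n *\<^sub>R w) + f x = h n * (h n * P v w p)"
      using second_difference_mean_value[OF e(2) f h] unfolding P_def .
    then obtain p where p: "dist x p \<le> h n * (norm v + norm w)"
      "f (x + h n *\<^sub>R v + h n *\<^sub>R w) - f (x + h n *\<^sub>R v) - f (x + h n *\<^sub>R w) + f x = h n * (h n * P v w p)"
      by blast
    have "h n * (norm w + norm v) < e" using h(2) by (simp add: add.commute)
    then have "\<exists>q. dist x q \<le> h n * (norm w + norm v) \<and>
      f (x + h n *\<^sub>R w + h n *\<^sub>R v) - f (x + h n *\<^sub>R w) - f (x + h n *\<^sub>R v) + f x = h n * (h n * P w v q)"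
      unfolding P_def by (rule second_difference_mean_value[OF e(2) f h(1)])
    then obtain q where q: "dist x q \<le> h n * (norm w + norm v)"
      "f (x + h n *\<^sub>R w + h n *\<^sub>R v) - f (x + h n *\<^sub>R w) - f (x + h n *\<^sub>R v) + f x = h n * (h n * P w v q)"
      by blast
    have swap: "x + h n *\<^sub>R v + h n *\<^sub>R w = x + h n *\<^sub>R w + h n *\<^sub>R v" by (simp add: algebra_simps)
    have "h n * (h n * P v w p) = h n * (h n * P w v q)"
      unfolding p(2)[symmetric] q(2)[symmetric] swap by simp
    moreover have "h n \<noteq> 0" using h(1)[of n] by simp
    ultimately have "P v w p = P w v q" by simp
    with p(1) q(1) show ?thesis by (metis add.commute)
  qed
  then obtain p q where pq: "\<And>n. dist x (p n) \<le> h n * (norm v + norm w)"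
      "\<And>n. dist x (q n) \<le> h n * (norm v + norm w)" "\<And>n. P v w (p n) = P w v (q n)"
    by metis
  have "(\<lambda>n. e / N * (norm v + norm w) * inverse (real (n + 2))) \<longlonglongrightarrow> e / N * (norm v + norm w) * 0"
    by (intro tendsto_mult tendsto_const LIMSEQ_ignore_initial_segment[OF lim_inverse_n])
  moreover have "h n * (norm v + norm w) = e / N * (norm v + norm w) * inverse (real (n + 2))" for n
    by (simp add: h_def divide_inverse mult_ac)
  ultimately have h0: "(\<lambda>n. h n * (norm v + norm w)) \<longlonglongrightarrow> 0"
    by (simp only: mult_zero_right)
  have lim: "r \<longlonglongrightarrow> x" if "\<And>n. dist x (r n) \<le> h n * (norm v + norm w)" for r
    by (subst tendsto_dist_iff, rule tendsto_sandwich[OF _ _ tendsto_const h0]) (use that in \<open>auto simp: dist_commute\<close>)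
  have "(\<lambda>n. P v w (p n)) \<longlonglongrightarrow> P v w x" "(\<lambda>n. P v w (p n)) \<longlonglongrightarrow> P w v x"
    using isCont_tendsto_compose[OF cont[of v w] lim[OF pq(1)]]
      isCont_tendsto_compose[OF cont[of w v] lim[OF pq(2)]]
    by (simp_all only: pq(3)[symmetric])
  then have "P v w x = P w v x" by (rule LIMSEQ_unique)
  then show ?thesis by (simp add: P_def)
qed

lemma second_derivative_symmetric:
  fixes f :: "'a::real_normed_vector \<Rightarrow> 'b::real_inner"
  assumes S: "open S" "x \<in> S" and f: "smooth_on S f"
  shows "fderiv (\<lambda>y. fderiv f y v) x w
    = fderiv (\<lambda>y. fderiv f y w) x v"
proof -
  have component: "fderiv (\<lambda>y. fderiv (\<lambda>y. f y \<bullet> b) y v) x w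
      = fderiv (\<lambda>y. fderiv f y v) x w \<bullet> b" for b v w
  proof -
    have "fderiv (\<lambda>y. fderiv (\<lambda>y. f y \<bullet> b) y v) x
        = fderiv (\<lambda>y. fderiv f y v \<bullet> b) x"
      by (rule frechet_derivative_cong_open[OF S])
        (rule frechet_derivative_bounded_linear[OF bounded_linear_inner_left smooth_on_differentiable[OF f]])
    then show ?thesis
      using frechet_derivative_bounded_linear[OF bounded_linear_inner_left
        smooth_on_differentiable[OF smooth_on_frechet_derivative[OF f] S(2)]] by metis
  qed
  have "fderiv (\<lambda>y. fderiv f y v) x w \<bullet> b
      = fderiv (\<lambda>y. fderiv f y w) x v \<bullet> b" for b
    using second_derivative_symmetric_real[OF S smooth_on_inner_left[OF S(1) f, of b]]
    by (simp only: component[symmetric])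
  then show ?thesis by (metis vector_eq_rdot)
qed


section \<open>Vector fields and one-forms on open sets of the model space\<close>

text \<open>The model space has finite dimension, possibly zero. All that is used of this is a finite
  set \<open>B\<close> in which vectors are expanded by means of inner products.\<close>

locale finite_expansion =
  fixes B :: "'e::real_inner set"
  assumes finite_B: "finite B"
    and expand: "\<And>x. (\<Sum>b\<in>B. (x \<bullet> b) *\<^sub>R b) = x"

lemma finite_expansion_exists:
  fixes B\<^sub>0 :: "'e::real_inner set"
  assumes "finite B\<^sub>0" "span B\<^sub>0 = UNIV"
  shows "\<exists>B :: 'e set. finite_expansion B"
proof -
  obtain C :: "'e set" where C: "finite C" "span C = UNIV" "pairwise orthogonal C"
    using basis_orthogonal[OF assms(1)] assms(2) by metis
  define B where "B = sgn ` (C - {0})"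
  have fin: "finite B" using C(1) by (simp add: B_def)
  have ortho: "b \<bullet> c = (if b = c then 1 else 0)" if bc: "b \<in> B" "c \<in> B" for b c
  proof -
    obtain b' c' where b: "b' \<in> C" "b' \<noteq> 0" "b = sgn b'" and c: "c' \<in> C" "c' \<noteq> 0" "c = sgn c'"
      using bc unfolding B_def by blast
    show ?thesis
    proof (cases "b = c")
      case True
      have "norm b = 1" using b(2,3) by (simp add: norm_sgn)
      then show ?thesis using True by (metis norm_eq_1)
    next
      case False
      then have "b' \<noteq> c'" using b c by auto
      then have "b' \<bullet> c' = 0" using C(3) b c by (auto simp: pairwise_def orthogonal_def)
      then show ?thesis using False b c by (simp add: sgn_div_norm)
    qed
  qed
  have "C \<subseteq> span B"
  proof
    fix c assume c: "c \<in> C"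
    have "c = norm c *\<^sub>R sgn c" by (cases "c = 0") (simp_all add: sgn_div_norm)
    moreover have "sgn c \<in> span B"
      using c by (cases "c = 0") (auto simp: B_def span_zero intro: span_base)
    ultimately show "c \<in> span B" by (metis span_scale)
  qed
  then have spanB: "span B = UNIV"
    using C(2) span_mono[of C "span B"] by (auto simp: span_span)
  have "(\<Sum>b\<in>B. (x \<bullet> b) *\<^sub>R b) = x" for x
  proof -
    define y where "y = x - (\<Sum>b\<in>B. (x \<bullet> b) *\<^sub>R b)"
    have "orthogonal y c" if c: "c \<in> B" for c
    proof -
      have "(\<Sum>b\<in>B. (x \<bullet> b) *\<^sub>R b) \<bullet> c = (\<Sum>b\<in>B. if b = c then x \<bullet> b else 0)"
        unfolding inner_sum_left by (rule sum.cong) (use ortho c in auto)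
      also have "\<dots> = x \<bullet> c" using c fin by simp
      finally show ?thesis by (simp add: y_def orthogonal_def inner_diff_left)
    qed
    then have "orthogonal y y" using orthogonal_to_span[of y B y] spanB by auto
    then show ?thesis by (simp add: orthogonal_def y_def)
  qed
  with fin show ?thesis using finite_expansion.intro by blast
qed

text \<open>The derivative of \<open>f\<close> along the vector field \<open>X\<close>, and the local formulas for the Lie bracket,
  the Lie derivative and the exterior derivative.\<close>

definition along :: "('e::real_normed_vector \<Rightarrow> 'e) \<Rightarrow> ('e \<Rightarrow> 'f::real_normed_vector) \<Rightarrow> 'e \<Rightarrow> 'f"
  where "along X f u = fderiv f u (X u)"

definition loc_bracket :: "('e::real_normed_vector \<Rightarrow> 'e) \<Rightarrow> ('e \<Rightarrow> 'e) \<Rightarrow> 'e \<Rightarrow> 'e"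
  where "loc_bracket X Y u = along X Y u - along Y X u"

definition loc_lie :: "('e::real_normed_vector \<Rightarrow> 'e) \<Rightarrow> ('e \<Rightarrow> 'e \<Rightarrow> real) \<Rightarrow> 'e \<Rightarrow> 'e \<Rightarrow> real"
  where "loc_lie X \<theta> u w =
    fderiv (\<lambda>u. \<theta> u w) u (X u) + \<theta> u (fderiv X u w)"

definition loc_ext :: "('e::real_normed_vector \<Rightarrow> 'e \<Rightarrow> real) \<Rightarrow> 'e \<Rightarrow> 'e \<Rightarrow> 'e \<Rightarrow> real"
  where "loc_ext \<theta> u v w =
    fderiv (\<lambda>u. \<theta> u w) u v - fderiv (\<lambda>u. \<theta> u v) u w"

text \<open>Forms may take values in any normed space, so that the derivative of a smooth map
  is a form as well.\<close>

definition smooth_form ::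
    "'e::real_normed_vector set \<Rightarrow> ('e \<Rightarrow> 'e \<Rightarrow> 'f::real_normed_vector) \<Rightarrow> bool"
  where "smooth_form S \<theta> \<longleftrightarrow> (\<forall>u\<in>S. linear (\<theta> u)) \<and> (\<forall>w. smooth_on S (\<lambda>u. \<theta> u w))"

lemma smooth_formD:
  assumes "smooth_form S \<theta>"
  shows "u \<in> S \<Longrightarrow> linear (\<theta> u)" "smooth_on S (\<lambda>u. \<theta> u w)"
  using assms by (auto simp: smooth_form_def)

lemma smooth_form_derivative:
  "smooth_on S f \<Longrightarrow> smooth_form S (\<lambda>u. fderiv f u)"
  unfolding smooth_form_def
  using smooth_on_frechet_derivative linear_frechet_derivative smooth_on_differentiable by blast

lemma along_cong:
  "open S \<Longrightarrow> u \<in> S \<Longrightarrow> (\<And>y. y \<in> S \<Longrightarrow> f y = g y) \<Longrightarrow> X u = Y u \<Longrightarrow> along X f u = along Y g u"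
  unfolding along_def using frechet_derivative_cong_open[of S u f g] by simp

lemma along_add: "smooth_on S f \<Longrightarrow> smooth_on S g \<Longrightarrow> u \<in> S \<Longrightarrow>
    along X (\<lambda>u. f u + g u) u = along X f u + along X g u"
  unfolding along_def using frechet_derivative_plus smooth_on_differentiable by blast

lemma along_diff: "smooth_on S f \<Longrightarrow> smooth_on S g \<Longrightarrow> u \<in> S \<Longrightarrow>
    along X (\<lambda>u. f u - g u) u = along X f u - along X g u"
  unfolding along_def using frechet_derivative_minus smooth_on_differentiable by blast

lemma along_scaleR: "smooth_on S r \<Longrightarrow> smooth_on S f \<Longrightarrow> u \<in> S \<Longrightarrow>
    along X (\<lambda>u. r u *\<^sub>R f u) u = r u *\<^sub>R along X f u + along X r u *\<^sub>R f u"
  unfolding along_def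
  by (rule frechet_derivative_bilinear[OF bounded_bilinear_scaleR smooth_on_differentiable smooth_on_differentiable])

lemma along_field_linear:
  assumes "smooth_on S f" "u \<in> S"
  shows "along (\<lambda>u. X u + Y u) f u = along X f u + along Y f u"
    and "along (\<lambda>u. X u - Y u) f u = along X f u - along Y f u"
    and "along (\<lambda>u. r u *\<^sub>R X u) f u = r u *\<^sub>R along X f u"
  using linear_frechet_derivative[OF smooth_on_differentiable[OF assms]]
  by (simp_all add: along_def linear_add linear_diff linear_scale)

context finite_expansion
begin

lemma linear_expand: "linear f \<Longrightarrow> f x = (\<Sum>b\<in>B. (x \<bullet> b) *\<^sub>R f b)"
  using linear_sum[of f "\<lambda>b. (x \<bullet> b) *\<^sub>R b" B] by (simp add: expand linear_scale)

lemma linear_imp_bounded: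
  fixes f :: "'e \<Rightarrow> 'f::real_normed_vector"
  assumes "linear f"
  shows "bounded_linear f"
proof -
  have "bounded_linear (\<lambda>x. \<Sum>b\<in>B. (x \<bullet> b) *\<^sub>R f b)"
    by (intro bounded_linear_sum bounded_linear_scaleR_const bounded_linear_inner_left)
  then show ?thesis using linear_expand[OF assms] by (metis (no_types, lifting) ext)
qed

text \<open>In the derivative \<open>Dg(f x)(Df x v)\<close> of a composite the direction in which \<open>g\<close> is differentiated
  varies with \<open>x\<close>. Expanding it in \<open>B\<close> leaves derivatives of \<open>g\<close> in fixed directions, to which the
  induction hypothesis applies.\<close>

lemma Ck_on_compose:
  fixes f :: "'a::real_normed_vector \<Rightarrow> 'e" and g :: "'e \<Rightarrow> 'f::real_normed_vector"
  assumes S: "open S" and ST: "f ` S \<subseteq> T"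
  shows "Ck_on k S f \<Longrightarrow> Ck_on k T g \<Longrightarrow> Ck_on k S (\<lambda>x. g (f x))"
proof (induction k arbitrary: g)
  case 0
  then show ?case using ST by (auto intro: continuous_on_compose2)
next
  case (Suc k)
  have chain: "((\<lambda>x. g (f x)) has_derivative
      (\<lambda>v. fderiv g (f x) (fderiv f x v))) (at x)" if "x \<in> S" for x
    by (rule has_derivative_compose[where s = UNIV])
      (use Suc.prems that ST in \<open>auto simp: frechet_derivative_works[symmetric]\<close>)
  have "Ck_on k S (\<lambda>x. fderiv (\<lambda>x. g (f x)) x v)" for v
  proof -
    have "Ck_on k S (\<lambda>x. \<Sum>b\<in>B. (fderiv f x v \<bullet> b) *\<^sub>R fderiv g (f x) b)"
      using Suc.prems Ck_on_Suc_imp[of k S f] Suc.IH[of "\<lambda>y. fderiv g y _"]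
      by (intro Ck_on_sum S Ck_on_bilinear[OF S bounded_bilinear_scaleR]
        Ck_on_bounded_linear[OF S bounded_linear_inner_left]) auto
    moreover have "fderiv (\<lambda>x. g (f x)) x v
        = (\<Sum>b\<in>B. (fderiv f x v \<bullet> b) *\<^sub>R fderiv g (f x) b)"
      if "x \<in> S" for x
      using frechet_derivative_eqI[OF chain[OF that]] Suc.prems(2) ST that
      by (simp add: linear_expand[OF linear_frechet_derivative] image_subset_iff)
    ultimately show ?thesis using Ck_on_cong[OF S] by (metis (no_types, lifting))
  qed
  then show ?case using chain by (auto simp: differentiable_def)
qed

lemma smooth_on_compose:
  fixes f :: "'a::real_normed_vector \<Rightarrow> 'e" and g :: "'e \<Rightarrow> 'f::real_normed_vector"
  shows "open S \<Longrightarrow> smooth_on S f \<Longrightarrow> smooth_on T g \<Longrightarrow> f ` S \<subseteq> T \<Longrightarrow> smooth_on S (\<lambda>x. g (f x))"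
  unfolding smooth_on_def using Ck_on_compose by blast

lemma smooth_on_linear_compose:
  fixes f :: "'a::real_normed_vector \<Rightarrow> 'e" and h :: "'e \<Rightarrow> 'f::real_normed_vector"
  shows "open S \<Longrightarrow> linear h \<Longrightarrow> smooth_on S f \<Longrightarrow> smooth_on S (\<lambda>x. h (f x))"
  using smooth_on_bounded_linear linear_imp_bounded by blast

lemma smooth_on_form_apply:
  assumes "open S" "smooth_form S \<theta>" "smooth_on S Y"
  shows "smooth_on S (\<lambda>u. \<theta> u (Y u :: 'e))"
proof -
  have "smooth_on S (\<lambda>u. \<Sum>b\<in>B. (Y u \<bullet> b) *\<^sub>R \<theta> u b)"
    by (intro smooth_on_sum smooth_on_scaleR smooth_on_inner_left assms smooth_formD)
  then show ?thesis
    by (subst smooth_on_cong[OF assms(1), of _ "\<lambda>u. \<Sum>b\<in>B. (Y u \<bullet> b) *\<^sub>R \<theta> u b"])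
      (simp_all add: linear_expand[OF smooth_formD(1)[OF assms(2)]])
qed

text \<open>Expanding \<open>Y\<close> in \<open>B\<close> reduces this to the product rule for finitely many scalar multiples.\<close>

lemma derivative_form_apply:
  assumes S: "open S" "u \<in> S" and \<theta>: "smooth_form S \<theta>" and Y: "smooth_on S (Y :: 'e \<Rightarrow> 'e)"
  shows "fderiv (\<lambda>u. \<theta> u (Y u)) u v
    = fderiv (\<lambda>y. \<theta> y (Y u)) u v + \<theta> u (fderiv Y u v)"
proof -
  note d\<theta> = smooth_on_has_derivative[OF smooth_formD(2)[OF \<theta>] S(2)]
  have ex: "\<theta> y w = (\<Sum>b\<in>B. (w \<bullet> b) *\<^sub>R \<theta> y b)" if "y \<in> S" for y w
    by (rule linear_expand[OF smooth_formD(1)[OF \<theta> that]])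
  have "((\<lambda>u. \<Sum>b\<in>B. (Y u \<bullet> b) *\<^sub>R \<theta> u b) has_derivative
      (\<lambda>v. \<Sum>b\<in>B. (Y u \<bullet> b) *\<^sub>R fderiv (\<lambda>u. \<theta> u b) u v
        + (fderiv Y u v \<bullet> b) *\<^sub>R \<theta> u b)) (at u)"
    by (intro has_derivative_sum bounded_bilinear.FDERIV[OF bounded_bilinear_scaleR]
      bounded_linear.has_derivative[OF bounded_linear_inner_left] d\<theta>
      smooth_on_has_derivative[OF Y S(2)])
  moreover have "((\<lambda>y. \<Sum>b\<in>B. (Y u \<bullet> b) *\<^sub>R \<theta> y b) has_derivative
      (\<lambda>v. \<Sum>b\<in>B. (Y u \<bullet> b) *\<^sub>R fderiv (\<lambda>u. \<theta> u b) u v)) (at u)"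
    by (intro has_derivative_sum bounded_linear.has_derivative[OF bounded_linear_scaleR_right] d\<theta>)
  moreover have "fderiv (\<lambda>u. \<theta> u (Y u)) u
      = fderiv (\<lambda>u. \<Sum>b\<in>B. (Y u \<bullet> b) *\<^sub>R \<theta> u b) u"
    by (rule frechet_derivative_cong_open[OF S]) (rule ex)
  moreover have "fderiv (\<lambda>y. \<theta> y (Y u)) u
      = fderiv (\<lambda>y. \<Sum>b\<in>B. (Y u \<bullet> b) *\<^sub>R \<theta> y b) u"
    by (rule frechet_derivative_cong_open[OF S]) (rule ex)
  ultimately show ?thesis
    using ex[OF S(2), of "fderiv Y u v"]
    by (simp add: frechet_derivative_eqI sum.distrib)
qed

lemma smooth_on_along:
  assumes "open S" "smooth_on S (X :: 'e \<Rightarrow> 'e)" "smooth_on S f"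
  shows "smooth_on S (along X f)"
  using smooth_on_form_apply[OF assms(1) smooth_form_derivative[OF assms(3)] assms(2)]
  by (simp add: along_def[abs_def])

lemma smooth_on_loc_bracket:
  "open S \<Longrightarrow> smooth_on S (X :: 'e \<Rightarrow> 'e) \<Longrightarrow> smooth_on S Y \<Longrightarrow> smooth_on S (loc_bracket X Y)"
  unfolding loc_bracket_def[abs_def] by (intro smooth_on_minus smooth_on_along)

lemma along_form_apply:
  assumes "open S" "u \<in> S" "smooth_form S \<theta>" "smooth_on S (Y :: 'e \<Rightarrow> 'e)"
  shows "along X (\<lambda>u. \<theta> u (Y u)) u = along X (\<lambda>y. \<theta> y (Y u)) u + \<theta> u (along X Y u)"
  unfolding along_def by (rule derivative_form_apply[OF assms])

text \<open>The bracket of vector fields is the commutator of the derivations, by the symmetry of second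
  derivatives. Together with \<open>loc_lie_apply\<close> and \<open>loc_ext_apply\<close>, which replace forms by functions,
  this turns identities of the Cartan calculus into formal manipulations of derivations.\<close>

lemma along_loc_bracket:
  fixes f :: "'e \<Rightarrow> 'f::real_inner"
  assumes S: "open S" "u \<in> S" and X: "smooth_on S X" and Y: "smooth_on S Y" and f: "smooth_on S f"
  shows "along (loc_bracket X Y) f u = along X (along Y f) u - along Y (along X f) u"
proof -
  have "along X (along Y f) u = fderiv (\<lambda>y. fderiv f y (Y u)) u (X u)
      + fderiv f u (along X Y u)" if "smooth_on S Y" for X Y
    using derivative_form_apply[OF S smooth_form_derivative[OF f] that, of "X u"]
    by (simp add: along_def[abs_def])
  from this[OF X, of Y] this[OF Y, of X] show ?thesis
    using second_derivative_symmetric[OF S f, of "X u" "Y u"]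
      linear_frechet_derivative[OF smooth_on_differentiable[OF f S(2)]]
    by (simp add: along_def[of "loc_bracket X Y"] loc_bracket_def linear_diff)
qed

lemma loc_bracket_jacobi:
  assumes S: "open S" "u \<in> S" and X: "smooth_on S (X :: 'e \<Rightarrow> 'e)" and Y: "smooth_on S Y"
    and Z: "smooth_on S Z"
  shows "loc_bracket X (loc_bracket Y Z) u = loc_bracket (loc_bracket X Y) Z u + loc_bracket Y (loc_bracket X Z) u"
proof -
  note s = smooth_on_along[OF S(1)]
  have "loc_bracket X (loc_bracket Y Z) u
      = along X (along Y Z) u - along X (along Z Y) u - (along Y (along Z X) u - along Z (along Y X) u)"
    if "smooth_on S X" "smooth_on S Y" "smooth_on S Z" for X Y Z
    using that along_diff[OF s s S(2), of Y Z Z Y X] along_loc_bracket[OF S that(2,3,1)]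
    by (simp add: loc_bracket_def[abs_def])
  note expand = this[OF X Y Z] this[OF Y X Z] this[OF Z X Y]
  have "loc_bracket (loc_bracket X Y) Z u = - loc_bracket Z (loc_bracket X Y) u" by (simp add: loc_bracket_def)
  then show ?thesis unfolding expand by simp
qed

lemma loc_lie_apply:
  assumes S: "open S" "u \<in> S" and X: "smooth_on S (X :: 'e \<Rightarrow> 'e)" and \<theta>: "smooth_form S \<theta>"
    and Y: "smooth_on S Y"
  shows "loc_lie X \<theta> u (Y u) = along X (\<lambda>u. \<theta> u (Y u)) u - \<theta> u (loc_bracket X Y u)"
  unfolding along_form_apply[OF S \<theta> Y]
  using smooth_formD(1)[OF \<theta> S(2)] by (simp add: loc_lie_def loc_bracket_def along_def linear_diff)

lemma loc_ext_apply:
  assumes S: "open S" "u \<in> S" and X: "smooth_on S (X :: 'e \<Rightarrow> 'e)" and \<theta>: "smooth_form S \<theta>"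
    and Y: "smooth_on S Y"
  shows "loc_ext \<theta> u (X u) (Y u)
    = along X (\<lambda>u. \<theta> u (Y u)) u - along Y (\<lambda>u. \<theta> u (X u)) u - \<theta> u (loc_bracket X Y u)"
  unfolding along_form_apply[OF S \<theta> Y] along_form_apply[OF S \<theta> X]
  using smooth_formD(1)[OF \<theta> S(2)] by (simp add: loc_ext_def loc_bracket_def along_def linear_diff)

lemma linear_derivative_form:
  assumes S: "open S" "u \<in> S" and \<theta>: "smooth_form S (\<theta> :: 'e \<Rightarrow> 'e \<Rightarrow> 'f::real_normed_vector)"
  shows "linear (\<lambda>w. fderiv (\<lambda>y. \<theta> y w) u z)"
proof (rule linearI)
  note lin = smooth_formD(1)[OF \<theta>]
  note diff = smooth_on_differentiable[OF smooth_formD(2)[OF \<theta>] S(2)]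
  fix v w r
  have "fderiv (\<lambda>y. \<theta> y (v + w)) u
      = fderiv (\<lambda>y. \<theta> y v + \<theta> y w) u"
    by (rule frechet_derivative_cong_open[OF S]) (rule linear_add[OF lin])
  then show "fderiv (\<lambda>y. \<theta> y (v + w)) u z
      = fderiv (\<lambda>y. \<theta> y v) u z + fderiv (\<lambda>y. \<theta> y w) u z"
    using frechet_derivative_plus[OF diff diff] by simp
  have "fderiv (\<lambda>y. \<theta> y (r *\<^sub>R w)) u
      = fderiv (\<lambda>y. r *\<^sub>R \<theta> y w) u"
    by (rule frechet_derivative_cong_open[OF S]) (rule linear_scale[OF lin])
  then show "fderiv (\<lambda>y. \<theta> y (r *\<^sub>R w)) u z
      = r *\<^sub>R fderiv (\<lambda>y. \<theta> y w) u z"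
    using frechet_derivative_bounded_linear[OF bounded_linear_scaleR_right diff] by simp
qed

lemma smooth_form_loc_lie:
  assumes S: "open S" and X: "smooth_on S (X :: 'e \<Rightarrow> 'e)" and \<theta>: "smooth_form S \<theta>"
  shows "smooth_form S (loc_lie X \<theta>)"
  unfolding smooth_form_def
proof (intro conjI ballI allI)
  fix u assume u: "u \<in> S"
  have "linear (\<lambda>w. \<theta> u (fderiv X u w))"
    using linear_compose[OF linear_frechet_derivative[OF smooth_on_differentiable[OF X u]] smooth_formD(1)[OF \<theta> u]]
    by (simp add: o_def)
  from linear_compose_add[OF linear_derivative_form[OF S u \<theta>] this]
  show "linear (loc_lie X \<theta> u)" by (simp add: loc_lie_def[abs_def])
next
  fix w
  show "smooth_on S (\<lambda>u. loc_lie X \<theta> u w)"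
    unfolding loc_lie_def
    by (intro smooth_on_add S smooth_on_form_apply[OF S \<theta>] smooth_on_frechet_derivative X
      smooth_on_form_apply[OF S smooth_form_derivative] smooth_formD(2)[OF \<theta>])
qed

lemma smooth_form_loc_ext:
  assumes S: "open S" and X: "smooth_on S (X :: 'e \<Rightarrow> 'e)" and \<theta>: "smooth_form S \<theta>"
  shows "smooth_form S (\<lambda>u. loc_ext \<theta> u (X u))"
  unfolding smooth_form_def
proof (intro conjI ballI allI)
  fix u assume u: "u \<in> S"
  have "linear (\<lambda>w. fderiv (\<lambda>y. \<theta> y (X u)) u w)"
    using linear_frechet_derivative[OF smooth_on_differentiable[OF smooth_formD(2)[OF \<theta>] u]] .
  from linear_compose_sub[OF linear_derivative_form[OF S u \<theta>] this]
  show "linear (loc_ext \<theta> u (X u))" by (simp add: loc_ext_def[abs_def])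
next
  fix w
  have "smooth_on S (\<lambda>u. fderiv (\<lambda>u. \<theta> u (X u)) u w
      - \<theta> u (fderiv X u w))"
    by (intro smooth_on_minus S smooth_on_frechet_derivative smooth_on_form_apply[OF S \<theta>] X)
  moreover have "fderiv (\<lambda>y. \<theta> y (X u)) u w
      = fderiv (\<lambda>u. \<theta> u (X u)) u w - \<theta> u (fderiv X u w)" if "u \<in> S" for u
    using derivative_form_apply[OF S that \<theta> X] by simp
  ultimately have "smooth_on S (\<lambda>u. fderiv (\<lambda>y. \<theta> y (X u)) u w)"
    using smooth_on_cong[OF S] by (metis (no_types, lifting))
  then show "smooth_on S (\<lambda>u. loc_ext \<theta> u (X u) w)"
    unfolding loc_ext_def
    by (intro smooth_on_minus S smooth_on_form_apply[OF S smooth_form_derivative] X smooth_formD(2)[OF \<theta>])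
qed

text \<open>The form component of the Courant-Dorfman bracket of \<open>(X, \<theta>)\<close> and \<open>(Y, \<eta>)\<close>.\<close>

definition loc_dorfman :: "('e \<Rightarrow> 'e) \<Rightarrow> ('e \<Rightarrow> 'e \<Rightarrow> real) \<Rightarrow> ('e \<Rightarrow> 'e) \<Rightarrow> ('e \<Rightarrow> 'e \<Rightarrow> real) \<Rightarrow> 'e \<Rightarrow> 'e \<Rightarrow> real"
  where "loc_dorfman X \<theta> Y \<eta> u w = loc_lie X \<eta> u w - loc_ext \<theta> u (Y u) w"

lemma smooth_form_loc_dorfman:
  assumes "open S" "smooth_on S X" "smooth_form S \<theta>" "smooth_on S Y" "smooth_form S \<eta>"
  shows "smooth_form S (loc_dorfman X \<theta> Y \<eta>)"
  using smooth_form_loc_lie[OF assms(1,2,5)] smooth_form_loc_ext[OF assms(1,4,3)]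
  by (auto simp: smooth_form_def loc_dorfman_def[abs_def] intro: linear_compose_sub smooth_on_minus[OF assms(1)])

lemma loc_dorfman_apply:
  assumes S: "open S" "u \<in> S" and X: "smooth_on S X" and \<theta>: "smooth_form S \<theta>"
    and Y: "smooth_on S Y" and \<eta>: "smooth_form S \<eta>" and W: "smooth_on S W"
  shows "loc_dorfman X \<theta> Y \<eta> u (W u) = along X (\<lambda>u. \<eta> u (W u)) u - along Y (\<lambda>u. \<theta> u (W u)) u
    + along W (\<lambda>u. \<theta> u (Y u)) u + \<theta> u (loc_bracket Y W u) - \<eta> u (loc_bracket X W u)"
  unfolding loc_dorfman_def loc_lie_apply[OF S X \<eta> W] loc_ext_apply[OF S Y \<theta> W] by simp

lemma along_loc_dorfman:
  assumes S: "open S" "u \<in> S" and X: "smooth_on S X" and \<theta>: "smooth_form S \<theta>"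
    and Y: "smooth_on S Y" and \<eta>: "smooth_form S \<eta>" and W: "smooth_on S W"
  shows "along V (\<lambda>u. loc_dorfman X \<theta> Y \<eta> u (W u)) u
    = along V (along X (\<lambda>u. \<eta> u (W u))) u - along V (along Y (\<lambda>u. \<theta> u (W u))) u
    + along V (along W (\<lambda>u. \<theta> u (Y u))) u + along V (\<lambda>u. \<theta> u (loc_bracket Y W u)) u
    - along V (\<lambda>u. \<eta> u (loc_bracket X W u)) u"
proof -
  note s = smooth_on_along[OF S(1)] smooth_on_form_apply[OF S(1)] smooth_on_loc_bracket[OF S(1)]
    smooth_on_add[OF S(1)] smooth_on_minus[OF S(1)] X \<theta> Y \<eta> W
  have "along V (\<lambda>u. loc_dorfman X \<theta> Y \<eta> u (W u)) u
      = along V (\<lambda>u. along X (\<lambda>u. \<eta> u (W u)) u - along Y (\<lambda>u. \<theta> u (W u)) u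
    + along W (\<lambda>u. \<theta> u (Y u)) u + \<theta> u (loc_bracket Y W u) - \<eta> u (loc_bracket X W u)) u"
    by (rule along_cong[OF S loc_dorfman_apply[OF S(1) _ X \<theta> Y \<eta> W] refl])
  also have "\<dots> = along V (along X (\<lambda>u. \<eta> u (W u))) u - along V (along Y (\<lambda>u. \<theta> u (W u))) u
    + along V (along W (\<lambda>u. \<theta> u (Y u))) u + along V (\<lambda>u. \<theta> u (loc_bracket Y W u)) u
    - along V (\<lambda>u. \<eta> u (loc_bracket X W u)) u"
    by (simp add: along_add[of S] along_diff[of S] s S)
  finally show ?thesis .
qed

lemma loc_bracket_cong:
  assumes "open S" "u \<in> S" "\<And>y. y \<in> S \<Longrightarrow> X y = X' y" "\<And>y. y \<in> S \<Longrightarrow> Y y = Y' y"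
  shows "loc_bracket X Y u = loc_bracket X' Y' u"
  unfolding loc_bracket_def by (intro arg_cong2[where f = minus] along_cong[OF assms(1,2)] assms)

lemma loc_dorfman_cong:
  assumes S: "open S" "u \<in> S" and "\<And>y. y \<in> S \<Longrightarrow> X y = X' y" "\<And>y w. y \<in> S \<Longrightarrow> \<theta> y w = \<theta>' y w"
    "\<And>y. y \<in> S \<Longrightarrow> Y y = Y' y" "\<And>y w. y \<in> S \<Longrightarrow> \<eta> y w = \<eta>' y w"
  shows "loc_dorfman X \<theta> Y \<eta> u w = loc_dorfman X' \<theta>' Y' \<eta>' u w"
proof -
  have "fderiv X u = fderiv X' u"
    "fderiv (\<lambda>y. \<theta> y w) u = fderiv (\<lambda>y. \<theta>' y w) u"
    "fderiv (\<lambda>y. \<eta> y w) u = fderiv (\<lambda>y. \<eta>' y w) u" for w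
    by (intro frechet_derivative_cong_open[OF S] assms; assumption)+
  then show ?thesis using assms by (simp add: loc_dorfman_def loc_lie_def loc_ext_def)
qed

text \<open>The form component of the Jacobi identity. After evaluation on a field \<open>W\<close>, both sides are
  combinations of iterated directional derivatives and of forms on iterated brackets.\<close>

lemma loc_dorfman_jacobi:
  assumes S: "open S" "u \<in> S" and X: "smooth_on S X" and \<theta>: "smooth_form S \<theta>"
    and Y: "smooth_on S Y" and \<eta>: "smooth_form S \<eta>" and Z: "smooth_on S Z" and \<zeta>: "smooth_form S \<zeta>"
  shows "loc_dorfman X \<theta> (loc_bracket Y Z) (loc_dorfman Y \<eta> Z \<zeta>) u w
    = loc_dorfman (loc_bracket X Y) (loc_dorfman X \<theta> Y \<eta>) Z \<zeta> u w + loc_dorfman Y \<eta> (loc_bracket X Z) (loc_dorfman X \<theta> Z \<zeta>) u w"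
proof -
  define W :: "'e \<Rightarrow> 'e" where "W = (\<lambda>_. w)"
  have W: "smooth_on S W" by (simp add: W_def smooth_on_const)
  note lin = linear_add[OF smooth_formD(1)[OF \<theta> S(2)]] linear_add[OF smooth_formD(1)[OF \<eta> S(2)]]
    linear_add[OF smooth_formD(1)[OF \<zeta> S(2)]]
  note s = smooth_on_along[OF S(1)] smooth_on_form_apply[OF S(1)] smooth_on_loc_bracket[OF S(1)]
    smooth_form_loc_dorfman[OF S(1)] X \<theta> Y \<eta> Z \<zeta> W
  note jac = loc_bracket_jacobi[OF S X Y W] loc_bracket_jacobi[OF S X Z W] loc_bracket_jacobi[OF S Y Z W]
  have "loc_dorfman X \<theta> (loc_bracket Y Z) (loc_dorfman Y \<eta> Z \<zeta>) u (W u)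
    = loc_dorfman (loc_bracket X Y) (loc_dorfman X \<theta> Y \<eta>) Z \<zeta> u (W u) + loc_dorfman Y \<eta> (loc_bracket X Z) (loc_dorfman X \<theta> Z \<zeta>) u (W u)"
    by (simp add: loc_dorfman_apply[OF S] along_loc_dorfman[OF S] along_loc_bracket[OF S] s jac lin)
  then show ?thesis by (simp add: W_def)
qed

text \<open>A map \<open>\<phi>\<close> between open sets, in the applications a change of charts, is compatible with the
  three operations as soon as the fields and forms on both sides correspond under its derivative.\<close>

lemma along_related:
  fixes f :: "'e \<Rightarrow> 'f::real_normed_vector"
  assumes S: "open S" "u \<in> S" and \<phi>: "smooth_on S (\<phi> :: 'e \<Rightarrow> 'e)" "\<phi> ` S \<subseteq> T" and f: "smooth_on T f"
    and X: "X' (\<phi> u) = fderiv \<phi> u (X u)"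
  shows "along X' f (\<phi> u) = along X (\<lambda>u. f (\<phi> u)) u"
proof -
  have "((\<lambda>u. f (\<phi> u)) has_derivative
      (\<lambda>v. fderiv f (\<phi> u) (fderiv \<phi> u v))) (at u)"
    by (rule has_derivative_compose[where s = UNIV])
      (use smooth_on_has_derivative[OF \<phi>(1) S(2)] smooth_on_has_derivative[OF f] \<phi>(2) S(2) in auto)
  then show ?thesis by (simp add: along_def X frechet_derivative_eqI)
qed

lemma loc_bracket_related:
  assumes S: "open S" "u \<in> S" and \<phi>: "smooth_on S (\<phi> :: 'e \<Rightarrow> 'e)" "\<phi> ` S \<subseteq> T"
    and X: "smooth_on S X" "smooth_on T X'" "\<And>u. u \<in> S \<Longrightarrow> X' (\<phi> u) = fderiv \<phi> u (X u)"
    and Y: "smooth_on S Y" "smooth_on T Y'" "\<And>u. u \<in> S \<Longrightarrow> Y' (\<phi> u) = fderiv \<phi> u (Y u)"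
  shows "loc_bracket X' Y' (\<phi> u) = fderiv \<phi> u (loc_bracket X Y u)"
proof -
  have "along X' Y' (\<phi> u) = along X (along Y \<phi>) u"
    using along_related[OF S \<phi> Y(2), of X' X, OF X(3)[OF S(2)]] along_cong[OF S, of "\<lambda>u. Y' (\<phi> u)" "along Y \<phi>" X X] Y(3)
    by (simp add: along_def[of Y])
  moreover have "along Y' X' (\<phi> u) = along Y (along X \<phi>) u"
    using along_related[OF S \<phi> X(2), of Y' Y, OF Y(3)[OF S(2)]] along_cong[OF S, of "\<lambda>u. X' (\<phi> u)" "along X \<phi>" Y Y] X(3)
    by (simp add: along_def[of X])
  ultimately show ?thesis
    using along_loc_bracket[OF S X(1) Y(1) \<phi>(1)] by (simp add: loc_bracket_def along_def[of "loc_bracket X Y"])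
qed

lemma derivative_form_related:
  assumes S: "open S" "u \<in> S" and \<phi>: "smooth_on S (\<phi> :: 'e \<Rightarrow> 'e)" "\<phi> ` S \<subseteq> T" and \<theta>': "smooth_form T \<theta>'"
    and \<theta>: "\<And>u w. u \<in> S \<Longrightarrow> \<theta> u w = \<theta>' (\<phi> u) (fderiv \<phi> u w)"
  shows "fderiv (\<lambda>u. \<theta> u w) u v
    = fderiv (\<lambda>y. \<theta>' y (fderiv \<phi> u w)) (\<phi> u) (fderiv \<phi> u v)
      + \<theta>' (\<phi> u) (fderiv (\<lambda>u. fderiv \<phi> u w) u v)"
proof -
  have comp: "smooth_form S (\<lambda>u. \<theta>' (\<phi> u))"
    using smooth_on_compose[OF S(1) \<phi>(1) smooth_formD(2)[OF \<theta>'] \<phi>(2)] smooth_formD(1)[OF \<theta>'] \<phi>(2)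
    by (auto simp: smooth_form_def)
  have "fderiv (\<lambda>u. \<theta> u w) u v
      = fderiv (\<lambda>u. \<theta>' (\<phi> u) (fderiv \<phi> u w)) u v"
    using frechet_derivative_cong_open[OF S \<theta>] by simp
  also have "\<dots> = fderiv (\<lambda>y. \<theta>' (\<phi> y) (fderiv \<phi> u w)) u v
      + \<theta>' (\<phi> u) (fderiv (\<lambda>u. fderiv \<phi> u w) u v)"
    by (rule derivative_form_apply[OF S comp smooth_on_frechet_derivative[OF \<phi>(1)]])
  also have "fderiv (\<lambda>y. \<theta>' (\<phi> y) (fderiv \<phi> u w)) u v
      = fderiv (\<lambda>y. \<theta>' y (fderiv \<phi> u w)) (\<phi> u) (fderiv \<phi> u v)"
    using along_related[OF S \<phi> smooth_formD(2)[OF \<theta>'], of "\<lambda>_. fderiv \<phi> u v" "\<lambda>_. v"]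
    by (simp add: along_def)
  finally show ?thesis .
qed

lemma loc_ext_related:
  assumes S: "open S" "u \<in> S" and \<phi>: "smooth_on S (\<phi> :: 'e \<Rightarrow> 'e)" "\<phi> ` S \<subseteq> T" and \<theta>': "smooth_form T \<theta>'"
    and \<theta>: "\<And>u w. u \<in> S \<Longrightarrow> \<theta> u w = \<theta>' (\<phi> u) (fderiv \<phi> u w)"
  shows "loc_ext \<theta> u v w = loc_ext \<theta>' (\<phi> u) (fderiv \<phi> u v) (fderiv \<phi> u w)"
proof -
  have rel: "fderiv (\<lambda>u. \<theta> u w) u v
    = fderiv (\<lambda>y. \<theta>' y (fderiv \<phi> u w)) (\<phi> u) (fderiv \<phi> u v)
      + \<theta>' (\<phi> u) (fderiv (\<lambda>u. fderiv \<phi> u w) u v)" for v w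
    by (rule derivative_form_related[OF S \<phi> \<theta>' \<theta>])
  show ?thesis
    using second_derivative_symmetric[OF S \<phi>(1), of v w] by (simp add: loc_ext_def rel)
qed

lemma loc_lie_related:
  assumes S: "open S" "u \<in> S" and \<phi>: "smooth_on S (\<phi> :: 'e \<Rightarrow> 'e)" "\<phi> ` S \<subseteq> T" and \<theta>': "smooth_form T \<theta>'"
    and \<theta>: "\<And>u w. u \<in> S \<Longrightarrow> \<theta> u w = \<theta>' (\<phi> u) (fderiv \<phi> u w)"
    and X: "smooth_on S X" "smooth_on T X'" "\<And>u. u \<in> S \<Longrightarrow> X' (\<phi> u) = fderiv \<phi> u (X u)"
  shows "loc_lie X \<theta> u w = loc_lie X' \<theta>' (\<phi> u) (fderiv \<phi> u w)"
proof -
  note D = smooth_form_derivative[OF \<phi>(1)]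
  have "fderiv X' (\<phi> u) (fderiv \<phi> u w)
      = fderiv (\<lambda>u. fderiv \<phi> u (X u)) u w"
    using along_related[OF S \<phi> X(2), of "\<lambda>_. fderiv \<phi> u w" "\<lambda>_. w"]
      frechet_derivative_cong_open[OF S X(3)] by (simp add: along_def)
  also have "\<dots> = fderiv (\<lambda>y. fderiv \<phi> y w) u (X u)
      + fderiv \<phi> u (fderiv X u w)"
    using derivative_form_apply[OF S D X(1)] second_derivative_symmetric[OF S \<phi>(1), of "X u" w] by simp
  finally have X'w: "fderiv X' (\<phi> u) (fderiv \<phi> u w) = \<dots>" .
  have rel: "fderiv (\<lambda>u. \<theta> u w) u v
    = fderiv (\<lambda>y. \<theta>' y (fderiv \<phi> u w)) (\<phi> u) (fderiv \<phi> u v)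
      + \<theta>' (\<phi> u) (fderiv (\<lambda>u. fderiv \<phi> u w) u v)" for v w
    by (rule derivative_form_related[OF S \<phi> \<theta>' \<theta>])
  have "linear (\<theta>' (\<phi> u))" using smooth_formD(1)[OF \<theta>'] \<phi>(2) S(2) by blast
  then show ?thesis
    by (simp add: loc_lie_def rel \<theta>[OF S(2)] X'w X(3)[OF S(2)] linear_add)
qed

lemma loc_bracket_add_right:
  assumes S: "open S" "u \<in> S" and X: "smooth_on S (X :: 'e \<Rightarrow> 'e)" and Y: "smooth_on S Y" "smooth_on S Y'"
  shows "loc_bracket X (\<lambda>u. Y u + Y' u) u = loc_bracket X Y u + loc_bracket X Y' u"
  using along_add[OF Y S(2), of X] along_field_linear(1)[OF X S(2), of Y Y'] by (simp add: loc_bracket_def)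

lemma loc_bracket_scaleR_right:
  assumes S: "open S" "u \<in> S" and X: "smooth_on S (X :: 'e \<Rightarrow> 'e)" and Y: "smooth_on S Y" and f: "smooth_on S f"
  shows "loc_bracket X (\<lambda>u. f u *\<^sub>R Y u) u = f u *\<^sub>R loc_bracket X Y u + along X f u *\<^sub>R Y u"
  using along_scaleR[OF f Y S(2), of X] along_field_linear(3)[OF X S(2), of f Y]
  by (simp add: loc_bracket_def scaleR_diff_right)

lemma loc_ext_linear_left:
  assumes S: "open S" "u \<in> S" and \<theta>: "smooth_form S (\<theta> :: 'e \<Rightarrow> 'e \<Rightarrow> real)"
  shows "linear (\<lambda>v. loc_ext \<theta> u v w)"
  using linear_compose_sub[OF linear_frechet_derivative[OF smooth_on_differentiable[OF smooth_formD(2)[OF \<theta>] S(2)]]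
      linear_derivative_form[OF S \<theta>]]
  by (simp add: loc_ext_def)

lemma loc_dorfman_add_left:
  assumes S: "open S" "u \<in> S" and X: "smooth_on S X" "smooth_on S X'"
    and \<theta>: "smooth_form S \<theta>" "smooth_form S \<theta>'" and \<eta>: "smooth_form S \<eta>"
  shows "loc_dorfman (\<lambda>u. X u + X' u) (\<lambda>u w. \<theta> u w + \<theta>' u w) Y \<eta> u w
    = loc_dorfman X \<theta> Y \<eta> u w + loc_dorfman X' \<theta>' Y \<eta> u w"
proof -
  note d = smooth_on_differentiable[OF _ S(2)]
  show ?thesis
    using linear_add[OF linear_frechet_derivative[OF d[OF smooth_formD(2)[OF \<eta>]]], of w "X u" "X' u"]
      linear_add[OF smooth_formD(1)[OF \<eta> S(2)]]
    by (simp add: loc_dorfman_def loc_lie_def loc_ext_def frechet_derivative_plus d X smooth_formD(2)[OF \<theta>(1)] smooth_formD(2)[OF \<theta>(2)])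
qed

lemma loc_dorfman_scale_left:
  assumes S: "open S" "u \<in> S" and X: "smooth_on S X"
    and \<theta>: "smooth_form S \<theta>" and \<eta>: "smooth_form S \<eta>"
  shows "loc_dorfman (\<lambda>u. r *\<^sub>R X u) (\<lambda>u w. r * \<theta> u w) Y \<eta> u w = r * loc_dorfman X \<theta> Y \<eta> u w"
proof -
  note d = smooth_on_differentiable[OF _ S(2)]
  show ?thesis
    using linear_scale[OF linear_frechet_derivative[OF d[OF smooth_formD(2)[OF \<eta>]]], of w r "X u"]
      linear_scale[OF smooth_formD(1)[OF \<eta> S(2)]]
      frechet_derivative_bounded_linear[OF bounded_linear_scaleR_right[of r] d[OF X]]
      frechet_derivative_bounded_linear[OF bounded_linear_mult_right[of r] d[OF smooth_formD(2)[OF \<theta>]]]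
    by (simp add: loc_dorfman_def loc_lie_def loc_ext_def algebra_simps)
qed

lemma loc_dorfman_add_right:
  assumes S: "open S" "u \<in> S" and \<theta>: "smooth_form S \<theta>"
    and \<eta>: "smooth_form S \<eta>" "smooth_form S \<eta>'"
  shows "loc_dorfman X \<theta> (\<lambda>u. Y u + Y' u) (\<lambda>u w. \<eta> u w + \<eta>' u w) u w
    = loc_dorfman X \<theta> Y \<eta> u w + loc_dorfman X \<theta> Y' \<eta>' u w"
proof -
  note d = smooth_on_differentiable[OF _ S(2)]
  show ?thesis
    using linear_add[OF loc_ext_linear_left[OF S \<theta>, of w], of "Y u" "Y' u"]
    by (simp add: loc_dorfman_def loc_lie_def frechet_derivative_plus d smooth_formD(2)[OF \<eta>(1)] smooth_formD(2)[OF \<eta>(2)])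
qed

lemma loc_dorfman_scale_right:
  assumes S: "open S" "u \<in> S" and \<theta>: "smooth_form S \<theta>"
    and \<eta>: "smooth_form S \<eta>" and f: "smooth_on S f"
  shows "loc_dorfman X \<theta> (\<lambda>u. f u *\<^sub>R Y u) (\<lambda>u w. f u * \<eta> u w) u w
    = f u * loc_dorfman X \<theta> Y \<eta> u w + along X f u * \<eta> u w"
  using linear_scale[OF loc_ext_linear_left[OF S \<theta>, of w], of "f u" "Y u"]
    frechet_derivative_bilinear[OF bounded_bilinear_mult smooth_on_differentiable[OF f S(2)]
      smooth_on_differentiable[OF smooth_formD(2)[OF \<eta>, of w] S(2)]]
  by (simp add: loc_dorfman_def loc_lie_def along_def algebra_simps)

lemma loc_dorfman_add_forms:
  assumes "u \<in> S" "smooth_form S (\<theta> :: 'e \<Rightarrow> 'e \<Rightarrow> real)" "smooth_form S \<theta>'" "smooth_form S \<eta>" "smooth_form S \<eta>'"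
  shows "loc_dorfman X (\<lambda>u w. \<theta> u w + \<theta>' u w) Y (\<lambda>u w. \<eta> u w + \<eta>' u w) u w
    = loc_dorfman X \<theta> Y \<eta> u w + loc_dorfman X \<theta>' Y \<eta>' u w"
  using smooth_on_differentiable[OF smooth_formD(2)[OF assms(2)] assms(1)]
    smooth_on_differentiable[OF smooth_formD(2)[OF assms(3)] assms(1)]
    smooth_on_differentiable[OF smooth_formD(2)[OF assms(4)] assms(1)]
    smooth_on_differentiable[OF smooth_formD(2)[OF assms(5)] assms(1)]
  by (simp add: loc_dorfman_def loc_lie_def loc_ext_def frechet_derivative_plus)

text \<open>The exterior derivatives of \<open>\<theta>\<close> in the two Dorfman brackets cancel because they are evaluated on
  \<open>(Y, Z)\<close> and on \<open>(Z, Y)\<close>.\<close>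

lemma loc_dorfman_invariant:
  assumes S: "open S" "u \<in> S" and X: "smooth_on S X" and \<theta>: "smooth_form S \<theta>"
    and Y: "smooth_on S Y" and \<eta>: "smooth_form S \<eta>" and Z: "smooth_on S Z" and \<zeta>: "smooth_form S \<zeta>"
  shows "along X (\<lambda>u. \<eta> u (Z u) + \<zeta> u (Y u)) u
    = loc_dorfman X \<theta> Y \<eta> u (Z u) + \<zeta> u (loc_bracket X Y u) + (\<eta> u (loc_bracket X Z u) + loc_dorfman X \<theta> Z \<zeta> u (Y u))"
proof -
  note s = smooth_on_form_apply[OF S(1)]
  have "loc_bracket Z Y u = - loc_bracket Y Z u" by (simp add: loc_bracket_def)
  then have "\<theta> u (loc_bracket Z Y u) = - \<theta> u (loc_bracket Y Z u)"
    using linear_neg[OF smooth_formD(1)[OF \<theta> S(2)]] by simp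
  then show ?thesis
    unfolding loc_dorfman_apply[OF S X \<theta> Y \<eta> Z] loc_dorfman_apply[OF S X \<theta> Z \<zeta> Y] along_add[OF s[OF \<eta> Z] s[OF \<zeta> Y] S(2)]
    by simp
qed

text \<open>This is the formula \<open>L\<^sub>X \<eta> - i\<^sub>X d\<eta> = d(\<eta>(X))\<close>, for \<open>(X, \<eta>)\<close> and for \<open>(Y, \<theta>)\<close>.\<close>

lemma loc_dorfman_symmetric_part:
  assumes S: "open S" "u \<in> S" and X: "smooth_on S X" and \<theta>: "smooth_form S \<theta>"
    and Y: "smooth_on S Y" and \<eta>: "smooth_form S \<eta>"
  shows "loc_dorfman X \<theta> Y \<eta> u w + loc_dorfman Y \<eta> X \<theta> u w
    = fderiv (\<lambda>u. \<theta> u (Y u) + \<eta> u (X u)) u w"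
proof -
  note d = smooth_on_differentiable[OF _ S(2)]
  note s = smooth_on_form_apply[OF S(1)]
  show ?thesis
    unfolding frechet_derivative_plus[OF d[OF s[OF \<theta> Y]] d[OF s[OF \<eta> X]]]
      derivative_form_apply[OF S \<theta> Y] derivative_form_apply[OF S \<eta> X]
    by (simp add: loc_dorfman_def loc_lie_def loc_ext_def)
qed

end


section \<open>Bases and dual bases\<close>

definition bcoord :: "nat \<Rightarrow> (nat \<Rightarrow> 'v::real_vector) \<Rightarrow> nat \<Rightarrow> 'v \<Rightarrow> real"
  where "bcoord k b i v = representation (b ` {..<k}) v (b i)"

lemma basis_of_in: "basis_of S k b \<Longrightarrow> i < k \<Longrightarrow> b i \<in> S"
  unfolding basis_of_def by (metis imageI lessThan_iff span_base)

lemma basis_of_subspace: "basis_of S k b \<Longrightarrow> subspace S"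
  unfolding basis_of_def by (metis subspace_span)

lemma bcoord_sum:
  assumes "basis_of S k b" "v \<in> S"
  shows "(\<Sum>i<k. bcoord k b i v *\<^sub>R b i) = v"
proof -
  have "(\<Sum>i<k. bcoord k b i v *\<^sub>R b i)
      = (\<Sum>c\<in>b ` {..<k}. representation (b ` {..<k}) v c *\<^sub>R c)"
    using assms by (subst sum.reindex) (auto simp: basis_of_def bcoord_def)
  also have "\<dots> = v"
    using assms by (intro real_vector.sum_representation_eq) (auto simp: basis_of_def)
  finally show ?thesis .
qed

lemma bcoord_add:
  "basis_of S k b \<Longrightarrow> v \<in> S \<Longrightarrow> w \<in> S \<Longrightarrow> bcoord k b i (v + w) = bcoord k b i v + bcoord k b i w"
  by (auto simp: basis_of_def bcoord_def real_vector.representation_add)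

lemma bcoord_scaleR:
  "basis_of S k b \<Longrightarrow> v \<in> S \<Longrightarrow> bcoord k b i (r *\<^sub>R v) = r * bcoord k b i v"
  by (auto simp: basis_of_def bcoord_def real_vector.representation_scale)

lemma bcoord_basis:
  assumes "basis_of S k b" "i < k" "j < k"
  shows "bcoord k b i (b j) = (if i = j then 1 else 0)"
  using assms by (auto simp: basis_of_def bcoord_def real_vector.representation_basis inj_on_def)

lemma bcoord_combination:
  assumes b: "basis_of S k b" and i: "i < k"
  shows "bcoord k b i (\<Sum>j<k. g j *\<^sub>R b j) = g i"
proof -
  have "bcoord k b i (\<Sum>j\<in>J. g j *\<^sub>R b j) = (\<Sum>j\<in>J. if i = j then g j else 0)"
    if "finite J" "J \<subseteq> {..<k}" for J
    using that
  proof (induction J)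
    case empty
    then show ?case by (simp add: bcoord_def real_vector.representation_zero)
  next
    case (insert j J)
    have "(\<Sum>j\<in>J. g j *\<^sub>R b j) \<in> S" "g j *\<^sub>R b j \<in> S"
      using insert.prems basis_of_in[OF b]
      by (auto intro!: subspace_sum subspace_scale basis_of_subspace[OF b])
    then show ?case
      using insert bcoord_basis[OF b i, of j] basis_of_in[OF b, of j]
      by (auto simp: bcoord_add[OF b] bcoord_scaleR[OF b])
  qed
  then show ?thesis using i by simp
qed

lemma basis_ofI:
  assumes S: "subspace S" "\<And>i. i < k \<Longrightarrow> b i \<in> S"
    and spans: "\<And>v. v \<in> S \<Longrightarrow> \<exists>g. v = (\<Sum>i<k. g i *\<^sub>R b i)"
    and indep: "\<And>g i. (\<Sum>i<k. g i *\<^sub>R b i) = 0 \<Longrightarrow> i < k \<Longrightarrow> g i = 0"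
  shows "basis_of S k b"
  unfolding basis_of_def
proof (intro conjI)
  show inj: "inj_on b {..<k}"
  proof (rule inj_onI, rule ccontr)
    fix i j assume ij: "i \<in> {..<k}" "j \<in> {..<k}" "b i = b j" "i \<noteq> j"
    define g :: "nat \<Rightarrow> real" where "g l = (if l = i then 1 else if l = j then -1 else 0)" for l
    have "(\<Sum>l<k. g l *\<^sub>R b l) = (\<Sum>l\<in>{i, j}. g l *\<^sub>R b l)"
      using ij by (intro sum.mono_neutral_right) (auto simp: g_def)
    also have "\<dots> = 0" using ij by (simp add: g_def)
    finally show False using indep[of g i] ij by (simp add: g_def)
  qed
  show "independent (b ` {..<k})"
  proof
    assume "dependent (b ` {..<k})"
    then obtain h v where h: "v \<in> b ` {..<k}" "h v \<noteq> 0" "(\<Sum>v\<in>b ` {..<k}. h v *\<^sub>R v) = 0"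
      using real_vector.dependent_finite[of "b ` {..<k}"] by auto
    have "(\<Sum>i<k. h (b i) *\<^sub>R b i) = 0" using h(3) by (simp add: sum.reindex[OF inj])
    with h(1,2) show False using indep[of "\<lambda>i. h (b i)"] by auto
  qed
  show "span (b ` {..<k}) = S"
  proof
    show "span (b ` {..<k}) \<subseteq> S" using S by (intro span_minimal) auto
    show "S \<subseteq> span (b ` {..<k})"
      using spans by (fastforce intro: span_sum span_scale span_base)
  qed
qed

lemma basis_of_UNIV_exists:
  fixes B :: "'v::real_vector set"
  assumes "finite B" "span B = UNIV"
  shows "\<exists>k b. basis_of (UNIV :: 'v set) k b"
proof -
  obtain C where C: "C \<subseteq> B" "independent C" "span C = span B"
    using maximal_independent_subset[of B] span_mono span_minimal subspace_span
    by (metis subset_antisym span_span)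
  then obtain h where "bij_betw h {0..<card C} C"
    using ex_bij_betw_nat_finite finite_subset assms(1) by blast
  then have "basis_of (UNIV :: 'v set) (card C) h"
    using C assms(2) by (auto simp: basis_of_def bij_betw_def atLeast0LessThan)
  then show ?thesis by blast
qed

lemma sum_pair_family:
  fixes b :: "nat \<Rightarrow> 'v::real_vector" and c :: "nat \<Rightarrow> 'w::real_vector"
  shows "(\<Sum>i<k + l. g i *\<^sub>R (if i < k then (b i, 0) else (0, c (i - k))))
    = ((\<Sum>i<k. g i *\<^sub>R b i), (\<Sum>i<l. g (k + i) *\<^sub>R c i))"
    (is "(\<Sum>i<k + l. g i *\<^sub>R ?d i) = _")
proof -
  have "(\<Sum>i<k + l. g i *\<^sub>R ?d i) = (\<Sum>i<k. g i *\<^sub>R ?d i) + (\<Sum>i<l. g (k + i) *\<^sub>R ?d (k + i))"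
    using sum.atLeastLessThan_concat[of 0 k "k + l" "\<lambda>i. g i *\<^sub>R ?d i"]
      sum.shift_bounds_nat_ivl[of "\<lambda>i. g i *\<^sub>R ?d i" 0 k l]
    by (simp add: atLeast0LessThan add.commute)
  then show ?thesis by (simp add: prod_eq_iff fst_sum snd_sum)
qed

lemma basis_of_Times:
  assumes b: "basis_of S k b" and c: "basis_of T l c"
  shows "basis_of (S \<times> T) (k + l) (\<lambda>i. if i < k then (b i, 0) else (0, c (i - k)))"
    (is "basis_of _ _ ?d")
proof (rule basis_ofI)
  note sub = basis_of_subspace[OF b] basis_of_subspace[OF c]
  show "subspace (S \<times> T)" using sub by (rule subspace_Times)
  show "?d i \<in> S \<times> T" if "i < k + l" for i
    using that basis_of_in[OF b] basis_of_in[OF c] sub by (auto simp: subspace_0)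
  show "\<exists>g. v = (\<Sum>i<k + l. g i *\<^sub>R ?d i)" if "v \<in> S \<times> T" for v
  proof (intro exI)
    show "v = (\<Sum>i<k + l. (if i < k then bcoord k b i (fst v) else bcoord l c (i - k) (snd v)) *\<^sub>R ?d i)"
      unfolding sum_pair_family[of "\<lambda>i. if i < k then bcoord k b i (fst v) else bcoord l c (i - k) (snd v)" k b c l]
      using that bcoord_sum[OF b, of "fst v"] bcoord_sum[OF c, of "snd v"]
      by (auto simp: prod_eq_iff)
  qed
  show "g i = 0" if "(\<Sum>i<k + l. g i *\<^sub>R ?d i) = 0" "i < k + l" for g i
  proof -
    have z: "(\<Sum>i<k. g i *\<^sub>R b i) = 0" "(\<Sum>i<l. g (k + i) *\<^sub>R c i) = 0"
      using that(1) unfolding sum_pair_family[of g k b c l] by (auto simp: prod_eq_iff)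
    show ?thesis
    proof (cases "i < k")
      case True
      then show ?thesis using bcoord_combination[OF b True, of g] z(1)
        by (simp add: bcoord_def real_vector.representation_zero)
    next
      case False
      then show ?thesis using bcoord_combination[OF c, of "i - k" "\<lambda>i. g (k + i)"] z(2) that(2)
        by (simp add: bcoord_def real_vector.representation_zero)
    qed
  qed
qed

lemma scaleR_fun_apply: "(r *\<^sub>R f) x = r *\<^sub>R f x"
  by (simp add: scaleR_fun_def)

lemma basis_of_fst_image:
  assumes b: "basis_of S k b"
  shows "basis_of ((\<lambda>v. (v, 0 :: 'w::real_vector)) ` S) k (\<lambda>i. (b i, 0))"
proof (rule basis_ofI)
  have sum: "(\<Sum>i<k. g i *\<^sub>R (b i, 0 :: 'w)) = (\<Sum>i<k. g i *\<^sub>R b i, 0)" for g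
    by (simp add: prod_eq_iff fst_sum snd_sum)
  show "subspace ((\<lambda>v. (v, 0 :: 'w)) ` S)"
    by (rule linear_subspace_image[OF _ basis_of_subspace[OF b]]) (rule linearI; simp)
  show "(b i, 0) \<in> (\<lambda>v. (v, 0 :: 'w)) ` S" if "i < k" for i
    using basis_of_in[OF b that] by blast
  show "\<exists>g. p = (\<Sum>i<k. g i *\<^sub>R (b i, 0 :: 'w))" if "p \<in> (\<lambda>v. (v, 0)) ` S" for p
  proof -
    obtain v where v: "v \<in> S" "p = (v, 0)" using \<open>p \<in> _\<close> by blast
    show ?thesis
      unfolding sum using bcoord_sum[OF b v(1)] v(2) by (intro exI[of _ "\<lambda>i. bcoord k b i v"]) simp
  qed
  show "g i = 0" if "(\<Sum>i<k. g i *\<^sub>R (b i, 0 :: 'w)) = 0" and i: "i < k" for g i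
  proof -
    have "(\<Sum>i<k. g i *\<^sub>R b i) = 0" using that(1) unfolding sum by (simp add: prod_eq_iff)
    then show ?thesis
      using bcoord_combination[OF b i, of g] by (simp add: bcoord_def real_vector.representation_zero)
  qed
qed

lemma sum_fun_apply: "(\<Sum>i\<in>I. f i) x = (\<Sum>i\<in>I. f i x)"
  by (induction I rule: infinite_finite_induct) (auto simp: zero_fun_def plus_fun_def)

lemma linear_on_subspace_sum:
  assumes S: "subspace S" and f: "linear_on_subspace S f" and b: "\<And>i. i < k \<Longrightarrow> b i \<in> S"
  shows "f (\<Sum>i<(k::nat). g i *\<^sub>R b i) = (\<Sum>i<k. g i *\<^sub>R f (b i))"
proof -
  have "f (\<Sum>i<j. g i *\<^sub>R b i) = (\<Sum>i<j. g i *\<^sub>R f (b i))" if "j \<le> k" for j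
    using that
  proof (induction j)
    case 0
    have "f (0 *\<^sub>R 0) = 0 *\<^sub>R f 0"
      using f subspace_0[OF S] unfolding linear_on_subspace_def by blast
    then show ?case by simp
  next
    case (Suc j)
    have "(\<Sum>i<j. g i *\<^sub>R b i) \<in> S" "g j *\<^sub>R b j \<in> S" "b j \<in> S"
      using Suc.prems b by (auto intro!: subspace_sum[OF S] subspace_scale[OF S])
    then show ?case using Suc f by (simp add: linear_on_subspace_def)
  qed
  then show ?thesis by simp
qed

lemma linear_on_subspace_zero: "subspace S \<Longrightarrow> linear_on_subspace S f \<Longrightarrow> f 0 = 0"
  using linear_on_subspace_sum[of S f 0] by simp

lemma fibre_dual: "fibre (dual_bundle E) x
    = {\<alpha>. linear_on_subspace (fibre E x) \<alpha> \<and> (\<forall>v. v \<notin> fibre E x \<longrightarrow> \<alpha> v = 0)}"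
  by (simp add: dual_bundle_def Let_def)

lemma frames_dual: "(U, k, \<epsilon>) \<in> frames (dual_bundle E) \<longleftrightarrow> (\<exists>e. (U, k, e) \<in> frames E \<and>
    (\<forall>x\<in>U. \<forall>i<k. \<epsilon> i x \<in> fibre (dual_bundle E) x \<and> (\<forall>j<k. \<epsilon> i x (e j x) = (if i = j then 1 else 0))))"
  by (simp add: dual_bundle_def Let_def)

lemma subspace_dual: "subspace (fibre (dual_bundle E) x)"
  unfolding fibre_dual
  by (rule subspaceI)
    (auto simp: linear_on_subspace_def zero_fun_def plus_fun_def scaleR_fun_def algebra_simps)

lemma dual_expand:
  assumes b: "basis_of (fibre E x) k b" and \<epsilon>: "\<And>i. i < k \<Longrightarrow> \<epsilon> i \<in> fibre (dual_bundle E) x"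
    "\<And>i j. i < k \<Longrightarrow> j < k \<Longrightarrow> \<epsilon> i (b j) = (if i = j then 1 else 0)"
    and \<alpha>: "\<alpha> \<in> fibre (dual_bundle E) x"
  shows "\<alpha> = (\<Sum>i<k. \<alpha> (b i) *\<^sub>R \<epsilon> i)"
proof
  fix v
  show "\<alpha> v = (\<Sum>i<k. \<alpha> (b i) *\<^sub>R \<epsilon> i) v"
  proof (cases "v \<in> fibre E x")
    case True
    define c where "c i = bcoord k b i v" for i
    have v: "v = (\<Sum>i<k. c i *\<^sub>R b i)" using bcoord_sum[OF b True] by (simp add: c_def)
    have lin: "\<beta> v = (\<Sum>i<k. c i *\<^sub>R \<beta> (b i))" if "\<beta> \<in> fibre (dual_bundle E) x" for \<beta>
      unfolding v using that basis_of_in[OF b]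
      by (intro linear_on_subspace_sum[OF basis_of_subspace[OF b]]) (auto simp: fibre_dual)
    have "\<epsilon> i v = c i" if "i < k" for i
      using lin[OF \<epsilon>(1)[OF that]] \<epsilon>(2)[OF that] that by (simp add: if_distrib cong: if_cong)
    then show ?thesis using lin[OF \<alpha>] by (simp add: sum_fun_apply scaleR_fun_def mult.commute)
  next
    case False
    then show ?thesis using \<alpha> \<epsilon>(1) by (simp add: fibre_dual sum_fun_apply scaleR_fun_def)
  qed
qed

definition dual_basis :: "'v::real_vector set \<Rightarrow> nat \<Rightarrow> (nat \<Rightarrow> 'v) \<Rightarrow> nat \<Rightarrow> 'v \<Rightarrow> real"
  where "dual_basis S k b i v = (if v \<in> S then bcoord k b i v else 0)"

lemma dual_basis:
  assumes b: "basis_of (fibre E x) k b"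
  shows "dual_basis (fibre E x) k b i \<in> fibre (dual_bundle E) x"
    and "i < k \<Longrightarrow> j < k \<Longrightarrow> dual_basis (fibre E x) k b i (b j) = (if i = j then 1 else 0)"
  using bcoord_add[OF b] bcoord_scaleR[OF b] bcoord_basis[OF b] basis_of_in[OF b] basis_of_subspace[OF b]
  by (auto simp: fibre_dual linear_on_subspace_def dual_basis_def subspace_add subspace_scale)

lemma basis_of_dual:
  assumes b: "basis_of (fibre E x) k b" and \<epsilon>: "\<And>i. i < k \<Longrightarrow> \<epsilon> i \<in> fibre (dual_bundle E) x"
    "\<And>i j. i < k \<Longrightarrow> j < k \<Longrightarrow> \<epsilon> i (b j) = (if i = j then 1 else 0)"
  shows "basis_of (fibre (dual_bundle E) x) k \<epsilon>"
proof (rule basis_ofI[OF subspace_dual \<epsilon>(1)])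
  show "\<exists>g. \<alpha> = (\<Sum>i<k. g i *\<^sub>R \<epsilon> i)" if "\<alpha> \<in> fibre (dual_bundle E) x" for \<alpha>
    by (intro exI, rule dual_expand[OF b]) (use \<epsilon> that in auto)
  show "g j = 0" if z: "(\<Sum>i<k. g i *\<^sub>R \<epsilon> i) = 0" and j: "j < k" for g j
  proof -
    have "(\<Sum>i<k. g i *\<^sub>R \<epsilon> i) (b j) = (\<Sum>i<k. if i = j then g i else 0)"
      unfolding sum_fun_apply scaleR_fun_def by (rule sum.cong) (use \<epsilon>(2) j in auto)
    then show ?thesis using z j by (simp add: zero_fun_def)
  qed
qed


section \<open>Charts and smooth functions\<close>

locale manifold = finite_expansion B for B :: "'e::real_inner set" +
  fixes M :: "('m::{t2_space, second_countable_topology}, 'e) chart set"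
  assumes mfd: "smooth_manifold M"
begin

abbreviation T :: "'m \<Rightarrow> ('m, 'e) tvec set" where "T \<equiv> tangent_space M"

abbreviation coord :: "('m, 'e) chart \<Rightarrow> 'm \<Rightarrow> 'e \<Rightarrow> ('m, 'e) tvec" where "coord \<equiv> coord_tvec M"

abbreviation TM :: "('m, ('m, 'e) tvec) vbundle" where "TM \<equiv> tangent_bundle M"

abbreviation TsM :: "('m, ('m, 'e) tvec \<Rightarrow> real) vbundle" where "TsM \<equiv> cotangent_bundle M"

lemma chart_cover: "\<exists>c\<in>M. x \<in> fst c"
  using mfd by (fastforce simp: smooth_manifold_def)

lemma chart_at: "chart_at M x \<in> M" "x \<in> fst (chart_at M x)"
proof -
  have "chart_at M x \<in> M \<and> x \<in> fst (chart_at M x)"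
    unfolding chart_at_def by (rule someI_ex) (use chart_cover in blast)
  then show "chart_at M x \<in> M" "x \<in> fst (chart_at M x)" by blast+
qed

lemma open_chart: "c \<in> M \<Longrightarrow> open (fst c)"
  and homeo_chart: "c \<in> M \<Longrightarrow> homeomorphism (fst c) (snd c ` fst c) (snd c) (chart_inv c)"
  and open_chart_image: "c \<in> M \<Longrightarrow> open (snd c ` fst c)"
  using mfd by (auto simp: smooth_manifold_def)

lemma chart_inv_chart [simp]: "c \<in> M \<Longrightarrow> x \<in> fst c \<Longrightarrow> chart_inv c (snd c x) = x"
  using homeo_chart by (auto simp: homeomorphism_def)

lemma open_image:
  assumes "c \<in> M" "open U"
  shows "open (snd c ` (U \<inter> fst c))"
proof -
  have "open (snd c ` fst c \<inter> chart_inv c -` U)"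
    using homeo_chart[OF assms(1)] open_chart_image[OF assms(1)] assms(2)
    by (intro continuous_open_preimage) (auto simp: homeomorphism_def)
  moreover have "snd c ` (U \<inter> fst c) = snd c ` fst c \<inter> chart_inv c -` U"
    using assms(1) by (auto simp: image_iff)
  ultimately show ?thesis by simp
qed

definition transition :: "('m, 'e) chart \<Rightarrow> ('m, 'e) chart \<Rightarrow> 'e \<Rightarrow> 'e"
  where "transition c c' = snd c' \<circ> chart_inv c"

definition jac :: "('m, 'e) chart \<Rightarrow> ('m, 'e) chart \<Rightarrow> 'm \<Rightarrow> 'e \<Rightarrow> 'e"
  where "jac c c' x = fderiv (transition c c') (snd c x)"

lemma smooth_transition:
  assumes "c \<in> M" "c' \<in> M"
  shows "smooth_on (snd c ` (fst c \<inter> fst c')) (transition c c')"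
  using mfd assms by (auto simp: smooth_manifold_def transition_def)

lemma open_overlap: "c \<in> M \<Longrightarrow> c' \<in> M \<Longrightarrow> open (snd c ` (fst c \<inter> fst c'))"
  using open_image[of c "fst c'"] open_chart by (simp add: Int_commute)

lemma transition_chart: "c \<in> M \<Longrightarrow> x \<in> fst c \<Longrightarrow> transition c c' (snd c x) = snd c' x"
  by (simp add: transition_def)

lemma transition_image: "c \<in> M \<Longrightarrow> transition c c' ` snd c ` (fst c \<inter> fst c') \<subseteq> snd c' ` (fst c' \<inter> fst c)"
  by (auto simp: transition_chart)

lemma jac_self:
  assumes "c \<in> M" "x \<in> fst c"
  shows "jac c c x = (\<lambda>w. w)"
proof -
  have "jac c c x = fderiv (\<lambda>u. u) (snd c x)"
    unfolding jac_def
  proof (rule frechet_derivative_cong_open[OF open_chart_image[OF assms(1)]])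
    show "snd c x \<in> snd c ` fst c" using assms by blast
    show "transition c c u = u" if "u \<in> snd c ` fst c" for u
      using that transition_chart[OF assms(1), where c' = c] by blast
  qed
  then show ?thesis by simp
qed

lemma transition_differentiable:
  assumes "c \<in> M" "c' \<in> M" "x \<in> fst c" "x \<in> fst c'"
  shows "transition c c' differentiable (at (snd c x))"
  using smooth_on_differentiable[OF smooth_transition] assms by blast

lemma linear_jac:
  "c \<in> M \<Longrightarrow> c' \<in> M \<Longrightarrow> x \<in> fst c \<Longrightarrow> x \<in> fst c' \<Longrightarrow> linear (jac c c' x)"
  unfolding jac_def by (intro linear_frechet_derivative transition_differentiable)

lemma jac_cocycle:
  assumes c: "c \<in> M" "c' \<in> M" "c'' \<in> M" and x: "x \<in> fst c" "x \<in> fst c'" "x \<in> fst c''"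
  shows "jac c' c'' x (jac c c' x w) = jac c c'' x w"
proof -
  have "jac c c'' x = fderiv (transition c' c'' \<circ> transition c c') (snd c x)"
    unfolding jac_def
    by (rule frechet_derivative_cong_open[OF open_overlap[OF c(1,2)]])
      (use c x transition_chart in \<open>auto simp: transition_def\<close>)
  also have "\<dots> = jac c' c'' x \<circ> jac c c' x"
    unfolding jac_def
    by (subst frechet_derivative_compose)
      (use transition_differentiable c x transition_chart in auto)
  finally show ?thesis by simp
qed

text \<open>On the overlap the second coordinate expression is the first one composed with a smooth transition
  map. A function on part of one chart domain is thus tested in that chart alone.\<close>

lemma smooth_change_chart:
  fixes g :: "'m \<Rightarrow> 'f::real_normed_vector"
  assumes c: "c \<in> M" "c' \<in> M" and U: "open U" "U \<subseteq> fst c"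
    and g: "smooth_on (snd c ` U) (g \<circ> chart_inv c)"
  shows "smooth_on (snd c' ` (U \<inter> fst c')) (g \<circ> chart_inv c')"
proof -
  have S: "open (snd c' ` (U \<inter> fst c'))" by (rule open_image[OF c(2) U(1)])
  have "smooth_on (snd c' ` (U \<inter> fst c')) (\<lambda>u. (g \<circ> chart_inv c) (transition c' c u))"
  proof (rule smooth_on_compose[OF S _ g])
    show "smooth_on (snd c' ` (U \<inter> fst c')) (transition c' c)"
      by (rule smooth_on_subset[OF smooth_transition[OF c(2,1)]]) (use U in auto)
    show "transition c' c ` snd c' ` (U \<inter> fst c') \<subseteq> snd c ` U"
      using c by (auto simp: transition_chart)
  qed
  then show ?thesis
    by (subst smooth_on_cong[OF S]) (use c U in \<open>auto simp: transition_def subset_iff\<close>)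
qed

lemma smooth_fun_on_chartI:
  assumes "c \<in> M" "open U" "U \<subseteq> fst c" "smooth_on (snd c ` U) (g \<circ> chart_inv c)"
  shows "smooth_fun_on M U g"
  unfolding smooth_fun_on_def using smooth_change_chart[OF assms(1) _ assms(2-4)] by blast

lemma smooth_fun_on_cong:
  assumes "open U" "\<And>x. x \<in> U \<Longrightarrow> f x = g x"
  shows "smooth_fun_on M U f \<longleftrightarrow> smooth_fun_on M U g"
  unfolding smooth_fun_on_def
proof (intro ball_cong refl smooth_on_cong open_image assms(1))
  fix c y assume c: "c \<in> M" and "y \<in> snd c ` (U \<inter> fst c)"
  then obtain x where "x \<in> U" "x \<in> fst c" "y = snd c x" by blast
  then show "(f \<circ> chart_inv c) y = (g \<circ> chart_inv c) y" using c assms(2) by simp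
qed

lemma smooth_fun_on_subset: "smooth_fun_on M U f \<Longrightarrow> V \<subseteq> U \<Longrightarrow> smooth_fun_on M V f"
  unfolding smooth_fun_on_def by (meson Int_mono image_mono order_refl smooth_on_subset)

lemma smooth_fun_on_UN:
  assumes "\<And>i. i \<in> I \<Longrightarrow> open (U i)" "\<And>i. i \<in> I \<Longrightarrow> smooth_fun_on M (U i) f"
  shows "smooth_fun_on M (\<Union>i\<in>I. U i) f"
  unfolding smooth_fun_on_def
proof
  fix c assume c: "c \<in> M"
  have "smooth_on (\<Union>i\<in>I. snd c ` (U i \<inter> fst c)) (f \<circ> chart_inv c)"
    by (rule smooth_on_UN) (use c assms open_image in \<open>auto simp: smooth_fun_on_def\<close>)
  moreover have "snd c ` (\<Union> (U ` I) \<inter> fst c) = (\<Union>i\<in>I. snd c ` (U i \<inter> fst c))" by blast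
  ultimately show "smooth_on (snd c ` (\<Union> (U ` I) \<inter> fst c)) (f \<circ> chart_inv c)" by simp
qed

lemma smooth_fun_on_const: "smooth_fun_on M U (\<lambda>_. r)"
  by (simp add: smooth_fun_on_def o_def smooth_on_const)

lemma smooth_fun_on_add:
  "open U \<Longrightarrow> smooth_fun_on M U f \<Longrightarrow> smooth_fun_on M U g \<Longrightarrow> smooth_fun_on M U (\<lambda>x. f x + g x)"
  by (auto simp: smooth_fun_on_def o_def intro: smooth_on_add open_image)

lemma smooth_fun_on_mult:
  "open U \<Longrightarrow> smooth_fun_on M U f \<Longrightarrow> smooth_fun_on M U g \<Longrightarrow> smooth_fun_on M U (\<lambda>x. f x * g x)"
  by (auto simp: smooth_fun_on_def o_def intro: smooth_on_mult open_image)

lemma smooth_fun_on_sum: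
  "open U \<Longrightarrow> (\<And>i. i \<in> I \<Longrightarrow> smooth_fun_on M U (f i)) \<Longrightarrow> smooth_fun_on M U (\<lambda>x. \<Sum>i\<in>I. f i x)"
  by (auto simp: smooth_fun_on_def o_def intro!: smooth_on_sum open_image)


section \<open>Sections of vector bundles, dual bundles and direct sums\<close>

lemma vector_bundle_frame:
  assumes "vector_bundle M E" "(V, k, e) \<in> frames E"
  shows "open V" "x \<in> V \<Longrightarrow> basis_of (fibre E x) k (\<lambda>i. e i x)"
    "i < k \<Longrightarrow> smooth_section_on M E V (e i)"
  using assms by (auto simp: vector_bundle_def)

lemma vector_bundle_cover:
  assumes "vector_bundle M E"
  shows "\<exists>V k e. (V, k, e) \<in> frames E \<and> x \<in> V"
proof -
  have "(\<Union>F\<in>frames E. fst F) = UNIV" using assms by (simp add: vector_bundle_def)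
  then obtain F where "F \<in> frames E" "x \<in> fst F" by blast
  then show ?thesis by (cases F) auto
qed

lemma smooth_section_onE:
  assumes "smooth_section_on M E U s" "(V, k, e) \<in> frames E"
  obtains g where "\<And>i. i < k \<Longrightarrow> smooth_fun_on M (U \<inter> V) (g i)"
    "\<And>x. x \<in> U \<inter> V \<Longrightarrow> s x = (\<Sum>i<k. g i x *\<^sub>R e i x)"
proof -
  have "\<exists>g. (\<forall>i<k. smooth_fun_on M (U \<inter> V) (g i)) \<and> (\<forall>x\<in>U \<inter> V. s x = (\<Sum>i<k. g i x *\<^sub>R e i x))"
    using assms(1)[unfolded smooth_section_on_def, THEN conjunct2, THEN bspec, OF assms(2)] by simp
  then show thesis using that by blast
qed

text \<open>The coefficients of a section in a frame are unique. Smoothness, defined by the existence of smooth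
  coefficients, is therefore a property of particular functions, and hence local.\<close>

lemma smooth_section_on_iff_bcoord:
  assumes E: "vector_bundle M E" and U: "open U"
  shows "smooth_section_on M E U s \<longleftrightarrow> (\<forall>x\<in>U. s x \<in> fibre E x) \<and>
    (\<forall>V k e i. (V, k, e) \<in> frames E \<longrightarrow> i < k \<longrightarrow>
      smooth_fun_on M (U \<inter> V) (\<lambda>x. bcoord k (\<lambda>i. e i x) i (s x)))"
    (is "_ \<longleftrightarrow> ?R")
proof
  assume s: "smooth_section_on M E U s"
  show ?R
  proof (intro conjI allI impI)
    show "\<forall>x\<in>U. s x \<in> fibre E x" using s by (simp add: smooth_section_on_def)
    fix V k e i assume F: "(V, k, e) \<in> frames E" and i: "i < (k::nat)"
    obtain g where g: "\<And>i. i < k \<Longrightarrow> smooth_fun_on M (U \<inter> V) (g i)"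
      "\<And>x. x \<in> U \<inter> V \<Longrightarrow> s x = (\<Sum>i<k. g i x *\<^sub>R e i x)"
      using smooth_section_onE[OF s F] by blast
    have "bcoord k (\<lambda>i. e i x) i (s x) = g i x" if "x \<in> U \<inter> V" for x
      using that g(2)[OF that] bcoord_combination[OF vector_bundle_frame(2)[OF E F] i, of x "\<lambda>i. g i x"]
      by simp
    then show "smooth_fun_on M (U \<inter> V) (\<lambda>x. bcoord k (\<lambda>i. e i x) i (s x))"
      using g(1)[OF i] vector_bundle_frame(1)[OF E F] U smooth_fun_on_cong by (metis (no_types, lifting) open_Int)
  qed
next
  assume R: ?R
  show "smooth_section_on M E U s"
    unfolding smooth_section_on_def
  proof (intro conjI ballI, goal_cases)
    case (1 x)
    then show ?case using R by blast
  next
    case (2 F)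
    obtain V k e where F: "F = (V, k, e)" by (cases F)
    show ?case unfolding F
    proof (simp, intro exI conjI ballI allI impI)
      show "smooth_fun_on M (U \<inter> V) (\<lambda>x. bcoord k (\<lambda>i. e i x) i (s x))" if "i < k" for i
        using R 2 F that by blast
      show "s x = (\<Sum>i<k. bcoord k (\<lambda>i. e i x) i (s x) *\<^sub>R e i x)" if "x \<in> U \<inter> V" for x
        using that R 2 bcoord_sum[OF vector_bundle_frame(2)[OF E], of V k e x "s x"] F by auto
    qed
  qed
qed

lemma smooth_section_on_subset:
  assumes "smooth_section_on M E U s" "W \<subseteq> U"
  shows "smooth_section_on M E W s"
  unfolding smooth_section_on_def
proof (intro conjI ballI, goal_cases)
  case (1 x)
  then show ?case using assms by (auto simp: smooth_section_on_def)
next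
  case (2 F)
  obtain V k e where F: "F = (V, k, e)" by (cases F)
  obtain g where g: "\<And>i. i < k \<Longrightarrow> smooth_fun_on M (U \<inter> V) (g i)"
    "\<And>x. x \<in> U \<inter> V \<Longrightarrow> s x = (\<Sum>i<k. g i x *\<^sub>R e i x)"
    using smooth_section_onE[OF assms(1) 2[unfolded F]] by blast
  have "smooth_fun_on M (W \<inter> V) (g i)" if "i < k" for i
    by (rule smooth_fun_on_subset[OF g(1)[OF that]]) (use assms(2) in blast)
  then show ?case unfolding F using g(2) assms(2) by (auto intro!: exI[of _ g])
qed

lemma smooth_section_on_UN:
  assumes E: "vector_bundle M E" and U: "\<And>i. i \<in> I \<Longrightarrow> open (U i)"
    and s: "\<And>i. i \<in> I \<Longrightarrow> smooth_section_on M E (U i) s"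
  shows "smooth_section_on M E (\<Union>i\<in>I. U i) s"
proof -
  have op: "open (\<Union> (U ` I))" using U by blast
  show ?thesis
    unfolding smooth_section_on_iff_bcoord[OF E op]
  proof (intro conjI allI impI)
  show "\<forall>x\<in>\<Union> (U ` I). s x \<in> fibre E x" using s by (auto simp: smooth_section_on_def)
  fix V k e i assume F: "(V, k, e) \<in> frames E" and i: "i < (k::nat)"
  have "smooth_fun_on M (\<Union>j\<in>I. U j \<inter> V) (\<lambda>x. bcoord k (\<lambda>i. e i x) i (s x))"
    using s smooth_section_on_iff_bcoord[OF E U] F i vector_bundle_frame(1)[OF E F] U
    by (intro smooth_fun_on_UN) blast+
  then show "smooth_fun_on M (\<Union> (U ` I) \<inter> V) (\<lambda>x. bcoord k (\<lambda>i. e i x) i (s x))"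
    by (simp add: Int_UN_distrib2 Int_commute)
qed
qed

lemma smooth_section_on_fibre: "smooth_section_on M E U s \<Longrightarrow> x \<in> U \<Longrightarrow> s x \<in> fibre E x"
  by (simp add: smooth_section_on_def)

lemma fibre_subspace: "vector_bundle M E \<Longrightarrow> subspace (fibre E x)"
  by (simp add: vector_bundle_def)

lemma smooth_section_on_add:
  assumes E: "vector_bundle M E" and U: "open U"
    and s: "smooth_section_on M E U s" and t: "smooth_section_on M E U t"
  shows "smooth_section_on M E U (\<lambda>x. s x + t x)"
  unfolding smooth_section_on_iff_bcoord[OF E U]
proof (intro conjI allI impI ballI)
  fix x assume "x \<in> U"
  then show "s x + t x \<in> fibre E x"
    using s t subspace_add[OF fibre_subspace[OF E]] smooth_section_on_fibre by blast
next
  fix V k e i assume F: "(V, k, e) \<in> frames E" and i: "i < (k::nat)"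
  have UV: "open (U \<inter> V)" using U vector_bundle_frame(1)[OF E F] by blast
  have "smooth_fun_on M (U \<inter> V) (\<lambda>x. bcoord k (\<lambda>i. e i x) i (s x) + bcoord k (\<lambda>i. e i x) i (t x))"
    using s t F i unfolding smooth_section_on_iff_bcoord[OF E U] by (intro smooth_fun_on_add UV) blast+
  then show "smooth_fun_on M (U \<inter> V) (\<lambda>x. bcoord k (\<lambda>i. e i x) i (s x + t x))"
    by (subst smooth_fun_on_cong[OF UV])
      (use s t bcoord_add[OF vector_bundle_frame(2)[OF E F]] in \<open>auto simp: smooth_section_on_def\<close>)
qed

lemma smooth_section_on_scaleR:
  assumes E: "vector_bundle M E" and U: "open U"
    and f: "smooth_fun_on M U f" and s: "smooth_section_on M E U s"
  shows "smooth_section_on M E U (\<lambda>x. f x *\<^sub>R s x)"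
  unfolding smooth_section_on_iff_bcoord[OF E U]
proof (intro conjI allI impI ballI)
  fix x assume "x \<in> U"
  then show "f x *\<^sub>R s x \<in> fibre E x"
    using s subspace_scale[OF fibre_subspace[OF E]] smooth_section_on_fibre by blast
next
  fix V k e i assume F: "(V, k, e) \<in> frames E" and i: "i < (k::nat)"
  have UV: "open (U \<inter> V)" using U vector_bundle_frame(1)[OF E F] by blast
  have "smooth_fun_on M (U \<inter> V) (\<lambda>x. f x * bcoord k (\<lambda>i. e i x) i (s x))"
    using s F i unfolding smooth_section_on_iff_bcoord[OF E U]
    by (intro smooth_fun_on_mult UV smooth_fun_on_subset[OF f]) blast+
  then show "smooth_fun_on M (U \<inter> V) (\<lambda>x. bcoord k (\<lambda>i. e i x) i (f x *\<^sub>R s x))"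
    by (subst smooth_fun_on_cong[OF UV])
      (use s bcoord_scaleR[OF vector_bundle_frame(2)[OF E F]] in \<open>auto simp: smooth_section_on_def\<close>)
qed

lemma smooth_section_on_zero:
  assumes E: "vector_bundle M E" and U: "open U"
  shows "smooth_section_on M E U (\<lambda>x. 0)"
  unfolding smooth_section_on_iff_bcoord[OF E U]
  using subspace_0[OF fibre_subspace[OF E]]
  by (auto simp: bcoord_def real_vector.representation_zero smooth_fun_on_const)


lemma smooth_fun_on_eq:
  "open U \<Longrightarrow> smooth_fun_on M U g \<Longrightarrow> (\<And>x. x \<in> U \<Longrightarrow> f x = g x) \<Longrightarrow> smooth_fun_on M U f"
  using smooth_fun_on_cong by blast

lemma open_frame: "vector_bundle M E \<Longrightarrow> F \<in> frames E \<Longrightarrow> open (fst F)"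
  using vector_bundle_frame(1)[of E "fst F" "fst (snd F)" "snd (snd F)"] by simp

lemma dual_frame:
  assumes "vector_bundle M E" "(V, k, e) \<in> frames E"
  shows "(V, k, \<lambda>i x. dual_basis (fibre E x) k (\<lambda>i. e i x) i) \<in> frames (dual_bundle E)"
  unfolding frames_dual
  using assms(2) dual_basis[OF vector_bundle_frame(2)[OF assms]] by (auto intro!: exI[of _ e])

text \<open>The coefficients of \<open>\<alpha>\<close> in the dual of a frame are its values on that frame.\<close>

lemma smooth_section_dualI:
  assumes E: "vector_bundle M E" and \<alpha>: "\<And>x. x \<in> U \<Longrightarrow> \<alpha> x \<in> fibre (dual_bundle E) x"
    and smooth: "\<And>V k e i. (V, k, e) \<in> frames E \<Longrightarrow> i < k \<Longrightarrow> smooth_fun_on M (U \<inter> V) (\<lambda>x. \<alpha> x (e i x))"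
  shows "smooth_section_on M (dual_bundle E) U \<alpha>"
  unfolding smooth_section_on_def
proof (intro conjI ballI, goal_cases)
  case (1 x)
  then show ?case by (rule \<alpha>)
next
  case (2 F)
  obtain V k \<epsilon> where F: "F = (V, k, \<epsilon>)" by (cases F)
  with 2 obtain e where e: "(V, k, e) \<in> frames E"
    and \<epsilon>: "\<And>x i. x \<in> V \<Longrightarrow> i < k \<Longrightarrow> \<epsilon> i x \<in> fibre (dual_bundle E) x"
      "\<And>x i j. x \<in> V \<Longrightarrow> i < k \<Longrightarrow> j < k \<Longrightarrow> \<epsilon> i x (e j x) = (if i = j then 1 else 0)"
    unfolding F frames_dual by blast
  have "\<alpha> x = (\<Sum>i<k. \<alpha> x (e i x) *\<^sub>R \<epsilon> i x)" if "x \<in> U \<inter> V" for x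
    using that by (intro dual_expand[OF vector_bundle_frame(2)[OF E e]] \<epsilon> \<alpha>) auto
  then show ?case
    unfolding F using smooth[OF e] by (auto intro!: exI[of _ "\<lambda>i x. \<alpha> x (e i x)"])
qed

lemma smooth_dual_pairing:
  assumes E: "vector_bundle M E" and U: "open U"
    and \<alpha>: "smooth_section_on M (dual_bundle E) U \<alpha>" and s: "smooth_section_on M E U s"
  shows "smooth_fun_on M U (\<lambda>x. \<alpha> x (s x))"
proof -
  have "smooth_fun_on M (U \<inter> fst F) (\<lambda>x. \<alpha> x (s x))" if F: "F \<in> frames E" for F
  proof -
    obtain V k e where Fe: "F = (V, k, e)" by (cases F)
    note e = F[unfolded Fe]
    note b = vector_bundle_frame(2)[OF E e]
    define \<epsilon> where "\<epsilon> i x = dual_basis (fibre E x) k (\<lambda>i. e i x) i" for i x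
    have \<epsilon>: "(V, k, \<epsilon>) \<in> frames (dual_bundle E)"
      using dual_frame[OF E e] by (simp add: \<epsilon>_def[abs_def])
    have UV: "open (U \<inter> V)" using U vector_bundle_frame(1)[OF E e] by blast
    obtain g where g: "\<And>i. i < k \<Longrightarrow> smooth_fun_on M (U \<inter> V) (g i)"
      "\<And>x. x \<in> U \<inter> V \<Longrightarrow> \<alpha> x = (\<Sum>i<k. g i x *\<^sub>R \<epsilon> i x)"
      using smooth_section_onE[OF \<alpha> \<epsilon>] by blast
    have "smooth_fun_on M (U \<inter> V) (\<lambda>x. bcoord k (\<lambda>i. e i x) i (s x))" if "i < k" for i
      using s e that unfolding smooth_section_on_iff_bcoord[OF E U] by blast
    then have "smooth_fun_on M (U \<inter> V) (\<lambda>x. \<Sum>i<k. g i x * bcoord k (\<lambda>i. e i x) i (s x))"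
      using g(1) by (intro smooth_fun_on_sum smooth_fun_on_mult UV) auto
    then have "smooth_fun_on M (U \<inter> V) (\<lambda>x. \<alpha> x (s x))"
    proof (rule smooth_fun_on_eq[OF UV])
      show "\<alpha> x (s x) = (\<Sum>i<k. g i x * bcoord k (\<lambda>i. e i x) i (s x))" if "x \<in> U \<inter> V" for x
        unfolding g(2)[OF that] sum_fun_apply scaleR_fun_def
        using that smooth_section_on_fibre[OF s, of x] by (simp add: \<epsilon>_def dual_basis_def)
    qed
    then show ?thesis by (simp add: Fe)
  qed
  then have "smooth_fun_on M (\<Union>F\<in>frames E. U \<inter> fst F) (\<lambda>x. \<alpha> x (s x))"
    using U open_frame[OF E] by (intro smooth_fun_on_UN) blast+
  moreover have "(\<Union>F\<in>frames E. U \<inter> fst F) = U" using E unfolding vector_bundle_def by blast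
  ultimately show ?thesis by simp
qed

lemma vector_bundle_dual:
  assumes E: "vector_bundle M E"
  shows "vector_bundle M (dual_bundle E)"
  unfolding vector_bundle_def
proof (intro conjI allI ballI subspace_dual, goal_cases)
  case 1
  show ?case
  proof (intro equalityI subsetI UNIV_I)
    fix x
    obtain V k e where "(V, k, e) \<in> frames E" "x \<in> V" using vector_bundle_cover[OF E] by blast
    then show "x \<in> (\<Union>F\<in>frames (dual_bundle E). fst F)" using dual_frame[OF E] by force
  qed
next
  case (2 F)
  obtain V k \<epsilon> where F: "F = (V, k, \<epsilon>)" by (cases F)
  with 2 obtain e where e: "(V, k, e) \<in> frames E"
    and \<epsilon>: "\<And>x i. x \<in> V \<Longrightarrow> i < k \<Longrightarrow> \<epsilon> i x \<in> fibre (dual_bundle E) x"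
      "\<And>x i j. x \<in> V \<Longrightarrow> i < k \<Longrightarrow> j < k \<Longrightarrow> \<epsilon> i x (e j x) = (if i = j then 1 else 0)"
    unfolding F frames_dual by blast
  note b = vector_bundle_frame(2)[OF E e]
  have "smooth_section_on M (dual_bundle E) V (\<epsilon> i)" if i: "i < k" for i
  proof (rule smooth_section_dualI[OF E \<epsilon>(1)[OF _ i]])
    fix W l f j assume f: "(W, l, f) \<in> frames E" and j: "j < (l::nat)"
    have op: "open W" "open (V \<inter> W)" using vector_bundle_frame(1)[OF E] e f by blast+
    have "smooth_fun_on M (W \<inter> V) (\<lambda>x. bcoord k (\<lambda>i. e i x) i (f j x))"
      using vector_bundle_frame(3)[OF E f j] e i
      unfolding smooth_section_on_iff_bcoord[OF E op(1)] by blast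
    moreover have "\<epsilon> i x (f j x) = bcoord k (\<lambda>i. e i x) i (f j x)" if x: "x \<in> V \<inter> W" for x
    proof -
      have \<epsilon>x: "linear_on_subspace (fibre E x) (\<epsilon> i x)"
        using \<epsilon>(1)[of x i] x i by (simp add: fibre_dual)
      have fx: "f j x \<in> fibre E x"
        using vector_bundle_frame(3)[OF E f j] x by (auto simp: smooth_section_on_def)
      have "\<epsilon> i x (f j x) = (\<Sum>m<k. bcoord k (\<lambda>i. e i x) m (f j x) *\<^sub>R \<epsilon> i x (e m x))"
        using linear_on_subspace_sum[OF fibre_subspace[OF E] \<epsilon>x, of k "\<lambda>i. e i x" "\<lambda>m. bcoord k (\<lambda>i. e i x) m (f j x)"]
          bcoord_sum[OF b fx] basis_of_in[OF b] x by simp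
      also have "\<dots> = (\<Sum>m<k. if i = m then bcoord k (\<lambda>i. e i x) m (f j x) else 0)"
        by (rule sum.cong) (use \<epsilon>(2) x i in auto)
      finally show ?thesis using i by simp
    qed
    ultimately show "smooth_fun_on M (V \<inter> W) (\<lambda>x. \<epsilon> i x (f j x))"
      using smooth_fun_on_eq[OF op(2)] by (metis (no_types, lifting) Int_commute)
  qed
  then show ?case
    unfolding F using vector_bundle_frame(1)[OF E e] basis_of_dual[OF b \<epsilon>] by auto
qed

lemma fibre_direct_sum [simp]: "fibre (E \<oplus>\<^sub>b F) x = fibre E x \<times> fibre F x"
  by (simp add: direct_sum_def)

lemma frames_direct_sumI:
  "(V, k, e) \<in> frames E \<Longrightarrow> (W, l, f) \<in> frames F \<Longrightarrow>
    (V \<inter> W, k + l, \<lambda>i x. if i < k then (e i x, 0) else (0, f (i - k) x)) \<in> frames (E \<oplus>\<^sub>b F)"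
  unfolding direct_sum_def vbundle.select_convs mem_Collect_eq
  by (rule exI[of _ V], rule exI[of _ W], rule exI[of _ k], rule exI[of _ l], rule exI[of _ e],
    rule exI[of _ f]) simp

lemma smooth_section_pair:
  assumes s: "smooth_section_on M E U s" and t: "smooth_section_on M F U t"
  shows "smooth_section_on M (E \<oplus>\<^sub>b F) U (\<lambda>x. (s x, t x))"
  unfolding smooth_section_on_def
proof (intro conjI ballI, goal_cases)
  case (1 x)
  then show ?case using s t by (auto simp: smooth_section_on_def)
next
  case (2 H)
  then obtain V k e W l f where H: "H = (V \<inter> W, k + l, \<lambda>i x. if i < k then (e i x, 0) else (0, f (i - k) x))"
    and e: "(V, k, e) \<in> frames E" and f: "(W, l, f) \<in> frames F"
    by (auto simp: direct_sum_def)
  obtain g where g: "\<And>i. i < k \<Longrightarrow> smooth_fun_on M (U \<inter> V) (g i)"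
    "\<And>x. x \<in> U \<inter> V \<Longrightarrow> s x = (\<Sum>i<k. g i x *\<^sub>R e i x)"
    using smooth_section_onE[OF s e] by blast
  obtain h where h: "\<And>i. i < l \<Longrightarrow> smooth_fun_on M (U \<inter> W) (h i)"
    "\<And>x. x \<in> U \<inter> W \<Longrightarrow> t x = (\<Sum>i<l. h i x *\<^sub>R f i x)"
    using smooth_section_onE[OF t f] by blast
  define r where "r i x = (if i < k then g i x else h (i - k) x)" for i x
  have "smooth_fun_on M (U \<inter> (V \<inter> W)) (r i)" if "i < k + l" for i
  proof (cases "i < k")
    case True
    then have "r i = g i" by (simp add: r_def[abs_def])
    moreover have "smooth_fun_on M (U \<inter> (V \<inter> W)) (g i)"
      by (rule smooth_fun_on_subset[OF g(1)[OF True]]) blast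
    ultimately show ?thesis by simp
  next
    case False
    then have "r i = h (i - k)" "i - k < l" using that by (simp_all add: r_def[abs_def])
    moreover from this(2) have "smooth_fun_on M (U \<inter> (V \<inter> W)) (h (i - k))"
      by (intro smooth_fun_on_subset[OF h(1)]) blast+
    ultimately show ?thesis by simp
  qed
  moreover have "(s x, t x) = (\<Sum>i<k + l. r i x *\<^sub>R (if i < k then (e i x, 0) else (0, f (i - k) x)))"
    if "x \<in> U \<inter> (V \<inter> W)" for x
    unfolding sum_pair_family[of "\<lambda>i. r i x" k "\<lambda>i. e i x" "\<lambda>i. f i x" l]
    using that g(2)[of x] h(2)[of x] by (simp add: r_def)
  ultimately show ?case unfolding H by (auto intro!: exI[of _ r])
qed

lemma smooth_section_on_frames:
  assumes E: "vector_bundle M E" and F: "vector_bundle M F" and U: "open U"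
    and s: "\<And>G. G \<in> frames F \<Longrightarrow> smooth_section_on M E (U \<inter> fst G) s"
  shows "smooth_section_on M E U s"
proof -
  have "smooth_section_on M E (\<Union>G\<in>frames F. U \<inter> fst G) s"
    using open_frame[OF F] U s by (intro smooth_section_on_UN[OF E]) blast+
  moreover have "(\<Union>G\<in>frames F. U \<inter> fst G) = U" using F unfolding vector_bundle_def by blast
  ultimately show ?thesis by simp
qed

text \<open>A frame of the direct sum lives only over the intersection of two domains. A component of a
  section is therefore first seen to be smooth over each frame domain of the other summand.\<close>

lemma smooth_section_components:
  assumes E: "vector_bundle M E" and F: "vector_bundle M F" and U: "open U"
    and s: "smooth_section_on M (E \<oplus>\<^sub>b F) U s"
  shows "smooth_section_on M E U (\<lambda>x. fst (s x))" "smooth_section_on M F U (\<lambda>x. snd (s x))"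
proof -
  have comb: "\<exists>h. (\<forall>i<k + l. smooth_fun_on M (U \<inter> (V \<inter> W)) (h i)) \<and>
      (\<forall>x\<in>U \<inter> (V \<inter> W). fst (s x) = (\<Sum>i<k. h i x *\<^sub>R e i x) \<and> snd (s x) = (\<Sum>i<l. h (k + i) x *\<^sub>R f i x))"
    if e: "(V, k, e) \<in> frames E" and f: "(W, l, f) \<in> frames F" for V k e W l f
  proof -
    have "(V \<inter> W, k + l, \<lambda>i x. if i < k then (e i x, 0) else (0, f (i - k) x)) \<in> frames (E \<oplus>\<^sub>b F)"
      using frames_direct_sumI e f by blast
    from smooth_section_onE[OF s this] obtain h where
      h: "\<And>i. i < k + l \<Longrightarrow> smooth_fun_on M (U \<inter> (V \<inter> W)) (h i)"
      "\<And>x. x \<in> U \<inter> (V \<inter> W) \<Longrightarrow> s x = (\<Sum>i<k + l. h i x *\<^sub>R (if i < k then (e i x, 0) else (0, f (i - k) x)))"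
      by blast
    have "fst (s x) = (\<Sum>i<k. h i x *\<^sub>R e i x) \<and> snd (s x) = (\<Sum>i<l. h (k + i) x *\<^sub>R f i x)"
      if "x \<in> U \<inter> (V \<inter> W)" for x
      using h(2)[OF that] sum_pair_family[of "\<lambda>i. h i x" k "\<lambda>i. e i x" "\<lambda>i. f i x" l] by simp
    with h(1) show ?thesis by blast
  qed
  have fib: "fst (s x) \<in> fibre E x" "snd (s x) \<in> fibre F x" if "x \<in> U" for x
    using smooth_section_on_fibre[OF s that] by auto
  have "smooth_section_on M E (U \<inter> fst G) (\<lambda>x. fst (s x))" if G: "G \<in> frames F" for G
    unfolding smooth_section_on_def
  proof (intro conjI ballI, goal_cases)
    case (1 x)
    then show ?case using fib by blast
  next
    case (2 H)
    obtain V k e W l f where eq: "H = (V, k, e)" "G = (W, l, f)" by (cases H, cases G)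
    have int: "U \<inter> fst G \<inter> V = U \<inter> (V \<inter> W)" by (auto simp: eq)
    obtain h where "\<forall>i<k + l. smooth_fun_on M (U \<inter> (V \<inter> W)) (h i)"
      "\<forall>x\<in>U \<inter> (V \<inter> W). fst (s x) = (\<Sum>i<k. h i x *\<^sub>R e i x) \<and> snd (s x) = (\<Sum>i<l. h (k + i) x *\<^sub>R f i x)"
      using comb[of V k e W l f] 2 G eq by blast
    then show ?case unfolding eq(1) using int by (auto intro!: exI[of _ h])
  qed
  then show "smooth_section_on M E U (\<lambda>x. fst (s x))" by (rule smooth_section_on_frames[OF E F U])
  have "smooth_section_on M F (U \<inter> fst G) (\<lambda>x. snd (s x))" if G: "G \<in> frames E" for G
    unfolding smooth_section_on_def
  proof (intro conjI ballI, goal_cases)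
    case (1 x)
    then show ?case using fib by blast
  next
    case (2 H)
    obtain V k e W l f where eq: "G = (V, k, e)" "H = (W, l, f)" by (cases H, cases G)
    have int: "U \<inter> fst G \<inter> W = U \<inter> (V \<inter> W)" by (auto simp: eq)
    obtain h where "\<forall>i<k + l. smooth_fun_on M (U \<inter> (V \<inter> W)) (h i)"
      "\<forall>x\<in>U \<inter> (V \<inter> W). fst (s x) = (\<Sum>i<k. h i x *\<^sub>R e i x) \<and> snd (s x) = (\<Sum>i<l. h (k + i) x *\<^sub>R f i x)"
      using comb[of V k e W l f] 2 G eq by blast
    then show ?case unfolding eq(2) using int by (auto intro!: exI[of _ "\<lambda>i. h (k + i)"])
  qed
  then show "smooth_section_on M F U (\<lambda>x. snd (s x))" by (rule smooth_section_on_frames[OF F E U])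
qed

lemma vector_bundle_direct_sum:
  assumes E: "vector_bundle M E" and F: "vector_bundle M F"
  shows "vector_bundle M (E \<oplus>\<^sub>b F)"
  unfolding vector_bundle_def
proof (intro conjI allI ballI, goal_cases)
  case (1 x)
  show ?case
    unfolding fibre_direct_sum by (rule subspace_Times[OF fibre_subspace[OF E] fibre_subspace[OF F]])
next
  case 2
  show ?case
  proof (intro equalityI subsetI UNIV_I)
    fix x
    obtain V k e where e: "(V, k, e) \<in> frames E" "x \<in> V" using vector_bundle_cover[OF E] by blast
    obtain W l f where f: "(W, l, f) \<in> frames F" "x \<in> W" using vector_bundle_cover[OF F] by blast
    have "(V \<inter> W, k + l, \<lambda>i x. if i < k then (e i x, 0) else (0, f (i - k) x)) \<in> frames (E \<oplus>\<^sub>b F)"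
      using frames_direct_sumI e f by blast
    then show "x \<in> (\<Union>F\<in>frames (E \<oplus>\<^sub>b F). fst F)" by (rule UN_I) (use e(2) f(2) in simp)
  qed
next
  case (3 H)
  then obtain V k e W l f where H: "H = (V \<inter> W, k + l, \<lambda>i x. if i < k then (e i x, 0) else (0, f (i - k) x))"
    and e: "(V, k, e) \<in> frames E" and f: "(W, l, f) \<in> frames F"
    by (auto simp: direct_sum_def)
  have op: "open (V \<inter> W)" by (rule open_Int[OF vector_bundle_frame(1)[OF E e] vector_bundle_frame(1)[OF F f]])
  have b: "basis_of (fibre (E \<oplus>\<^sub>b F) x) (k + l) (\<lambda>i. if i < k then (e i x, 0) else (0, f (i - k) x))"
    if "x \<in> V \<inter> W" for x
    using that basis_of_Times[OF vector_bundle_frame(2)[OF E e] vector_bundle_frame(2)[OF F f], of x x] by simp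
  have sm: "smooth_section_on M (E \<oplus>\<^sub>b F) (V \<inter> W) (\<lambda>x. if i < k then (e i x, 0) else (0, f (i - k) x))"
    if i: "i < k + l" for i
  proof (cases "i < k")
    case True
    then show ?thesis
      using smooth_section_pair[OF smooth_section_on_subset[OF vector_bundle_frame(3)[OF E e True]] smooth_section_on_zero[OF F op]]
      by simp
  next
    case False
    then have "i - k < l" using i by simp
    then show ?thesis
      using False smooth_section_pair[OF smooth_section_on_zero[OF E op] smooth_section_on_subset[OF vector_bundle_frame(3)[OF F f]]]
      by simp
  qed
  show ?case unfolding H using op b sm by simp
qed


section \<open>The tangent bundle\<close>

lemma coord_tvec_chart: "c' \<in> M \<Longrightarrow> x \<in> fst c' \<Longrightarrow> coord c x w c' = jac c c' x w"
  by (simp add: coord_tvec_def jac_def transition_def)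

lemma tangent_space_iff: "v \<in> T x \<longleftrightarrow>
    (\<forall>c\<in>M. \<forall>c'\<in>M. x \<in> fst c \<and> x \<in> fst c' \<longrightarrow> v c' = jac c c' x (v c)) \<and>
    (\<forall>c. \<not> (c \<in> M \<and> x \<in> fst c) \<longrightarrow> v c = 0)"
  unfolding tangent_space_def jac_def transition_def by simp

lemma coord_tvec_outside: "\<not> (c' \<in> M \<and> x \<in> fst c') \<Longrightarrow> coord c x w c' = 0"
  unfolding coord_tvec_def by (simp only: if_False)

lemma linear_coord_tvec:
  assumes "c \<in> M" "x \<in> fst c"
  shows "linear (coord c x)"
proof (rule linearI; rule ext)
  fix v w r c'
  note lin = linear_jac[OF assms(1) _ assms(2), of c']
  show "coord c x (v + w) c' = (coord c x v + coord c x w) c'"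
    by (cases "c' \<in> M \<and> x \<in> fst c'")
      (simp_all add: coord_tvec_chart coord_tvec_outside linear_add[OF lin])
  show "coord c x (r *\<^sub>R v) c' = (r *\<^sub>R coord c x v) c'"
    by (cases "c' \<in> M \<and> x \<in> fst c'")
      (simp_all add: coord_tvec_chart coord_tvec_outside linear_scale[OF lin] scaleR_fun_apply)
qed

lemma coord_tvec_in_tangent:
  assumes c: "c \<in> M" "x \<in> fst c"
  shows "coord c x w \<in> T x"
  unfolding tangent_space_iff
proof (intro conjI ballI allI impI)
  fix c' c'' assume "c' \<in> M" "c'' \<in> M" "x \<in> fst c' \<and> x \<in> fst c''"
  then show "coord c x w c'' = jac c' c'' x (coord c x w c')"
    using jac_cocycle[of c c' c'' x w] c by (simp add: coord_tvec_chart)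
next
  fix c' assume "\<not> (c' \<in> M \<and> x \<in> fst c')"
  then show "coord c x w c' = 0" by (rule coord_tvec_outside)
qed

lemma coord_tvec_self: "c \<in> M \<Longrightarrow> x \<in> fst c \<Longrightarrow> coord c x w c = w"
  by (simp add: coord_tvec_chart jac_self)

lemma coord_tvec_of_tangent:
  assumes "c \<in> M" "x \<in> fst c" "v \<in> T x"
  shows "coord c x (v c) = v"
proof
  fix c'
  show "coord c x (v c) c' = v c'"
  proof (cases "c' \<in> M \<and> x \<in> fst c'")
    case True
    then have "v c' = jac c c' x (v c)" using assms unfolding tangent_space_iff by blast
    then show ?thesis using True by (simp add: coord_tvec_chart)
  next
    case False
    then have "v c' = 0" using assms(3) unfolding tangent_space_iff by blast
    then show ?thesis using coord_tvec_outside[OF False] by simp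
  qed
qed

lemma coord_tvec_jac:
  assumes "c \<in> M" "c' \<in> M" "x \<in> fst c" "x \<in> fst c'"
  shows "coord c' x (jac c c' x w) = coord c x w"
  using coord_tvec_of_tangent[OF assms(2,4) coord_tvec_in_tangent[OF assms(1,3), of w]] assms
  by (simp add: coord_tvec_chart)

lemma tangent_eqI:
  assumes "c \<in> M" "x \<in> fst c" "v \<in> T x" "w \<in> T x" "v c = w c"
  shows "v = w"
  by (rule box_equals[OF _ coord_tvec_of_tangent[OF assms(1-3)] coord_tvec_of_tangent[OF assms(1,2,4)]])
    (simp only: assms(5))

lemma tangent_space_eq_range:
  assumes "c \<in> M" "x \<in> fst c"
  shows "T x = range (coord c x)"
proof
  show "T x \<subseteq> range (coord c x)"
    using coord_tvec_of_tangent[OF assms, symmetric] by blast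
  show "range (coord c x) \<subseteq> T x" using coord_tvec_in_tangent[OF assms] by blast
qed

lemma subspace_tangent: "subspace (T x)"
  unfolding tangent_space_eq_range[OF chart_at]
  by (rule linear_subspace_image[OF linear_coord_tvec[OF chart_at] subspace_UNIV])

lemma fibre_tangent [simp]: "fibre TM = T"
  by (simp add: tangent_bundle_def)

lemma frames_tangentI:
  "c \<in> M \<Longrightarrow> basis_of UNIV k b \<Longrightarrow> (fst c, k, \<lambda>i x. coord c x (b i)) \<in> frames TM"
  unfolding tangent_bundle_def vbundle.select_convs mem_Collect_eq
  by (rule exI[of _ c], rule exI[of _ k], rule exI[of _ b]) simp

lemma frames_tangentE:
  assumes "F \<in> frames TM"
  obtains c k b where "c \<in> M" "basis_of UNIV k b" "F = (fst c, k, \<lambda>i x. coord c x (b i))"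
  using assms unfolding tangent_bundle_def vbundle.select_convs mem_Collect_eq by blast

lemma basis_of_tangent:
  assumes c: "c \<in> M" "x \<in> fst c" and b: "basis_of UNIV k b"
  shows "basis_of (T x) k (\<lambda>i. coord c x (b i))"
proof (rule basis_ofI[OF subspace_tangent coord_tvec_in_tangent[OF c]])
  note comb = linear_sum[OF linear_coord_tvec[OF c]] linear_scale[OF linear_coord_tvec[OF c]]
  have sum: "(\<Sum>i<k. g i *\<^sub>R coord c x (b i)) = coord c x (\<Sum>i<k. g i *\<^sub>R b i)" for g
    by (simp add: comb)
  show "\<exists>g. v = (\<Sum>i<k. g i *\<^sub>R coord c x (b i))" if "v \<in> T x" for v
    unfolding sum using bcoord_sum[OF b, of "v c"] coord_tvec_of_tangent[OF c that]
    by (intro exI[of _ "\<lambda>i. bcoord k b i (v c)"]) simp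
  show "g i = 0" if z: "(\<Sum>i<k. g i *\<^sub>R coord c x (b i)) = 0" and i: "i < k" for g i
  proof -
    have "(\<Sum>i<k. g i *\<^sub>R b i) = 0"
      using z unfolding sum using coord_tvec_self[OF c] by (metis zero_fun_def)
    then show ?thesis
      using bcoord_combination[OF b i, of g] by (simp add: bcoord_def real_vector.representation_zero)
  qed
qed

lemma model_basis: "\<exists>k b. basis_of (UNIV :: 'e set) k b"
proof -
  have "x \<in> span B" for x
    using span_sum[of B "\<lambda>b. (x \<bullet> b) *\<^sub>R b" B] by (simp add: expand span_base span_scale)
  then show ?thesis using basis_of_UNIV_exists[OF finite_B] by blast
qed

definition field_rep :: "('m, 'e) chart \<Rightarrow> ('m \<Rightarrow> ('m, 'e) tvec) \<Rightarrow> 'e \<Rightarrow> 'e"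
  where "field_rep c X u = X (chart_inv c u) c"

lemma field_rep_chart: "c \<in> M \<Longrightarrow> x \<in> fst c \<Longrightarrow> field_rep c X (snd c x) = X x c"
  by (simp add: field_rep_def)

lemma field_rep_add: "field_rep c (\<lambda>y. X y + Y y) = (\<lambda>u. field_rep c X u + field_rep c Y u)"
  by (simp add: field_rep_def plus_fun_def fun_eq_iff)

lemma field_rep_scaleR: "field_rep c (\<lambda>y. f y *\<^sub>R Y y) = (\<lambda>u. (f \<circ> chart_inv c) u *\<^sub>R field_rep c Y u)"
  by (simp add: field_rep_def scaleR_fun_def fun_eq_iff)

text \<open>The components in one chart are a fixed linear image of the coefficients in a coordinate frame,
  and conversely.\<close>

lemma smooth_vector_fieldI:
  assumes U: "open U" and X: "\<And>x. x \<in> U \<Longrightarrow> X x \<in> T x"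
    and smooth: "\<And>c. c \<in> M \<Longrightarrow> smooth_on (snd c ` (U \<inter> fst c)) (field_rep c X)"
  shows "smooth_section_on M TM U X"
  unfolding smooth_section_on_def
proof (intro conjI ballI, goal_cases)
  case (1 x)
  then show ?case using X by simp
next
  case (2 F)
  then obtain c k b where c: "c \<in> M" and b: "basis_of UNIV k b"
    and F: "F = (fst c, k, \<lambda>i x. coord c x (b i))" by (rule frames_tangentE)
  define g where "g i x = bcoord k b i (X x c)" for i x
  have op: "open (U \<inter> fst c)" using U open_chart[OF c] by blast
  have "smooth_fun_on M (U \<inter> fst c) (g i)" for i
  proof (rule smooth_fun_on_chartI[OF c op Int_lower2])
    have "linear (bcoord k b i)"
      by (rule linearI) (simp_all add: bcoord_add[OF b] bcoord_scaleR[OF b])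
    then show "smooth_on (snd c ` (U \<inter> fst c)) (g i \<circ> chart_inv c)"
      using smooth_on_linear_compose[OF open_image[OF c U] _ smooth[OF c], of "bcoord k b i"]
      by (simp add: g_def field_rep_def o_def)
  qed
  moreover have "X x = (\<Sum>i<k. g i x *\<^sub>R coord c x (b i))" if "x \<in> U \<inter> fst c" for x
  proof -
    have x: "x \<in> U" "x \<in> fst c" using that by blast+
    have "X x = coord c x (\<Sum>i<k. g i x *\<^sub>R b i)"
      using coord_tvec_of_tangent[OF c x(2) X[OF x(1)]] bcoord_sum[OF b, of "X x c"] by (simp add: g_def)
    then show ?thesis
      by (simp add: linear_sum[OF linear_coord_tvec[OF c x(2)]] linear_scale[OF linear_coord_tvec[OF c x(2)]])
  qed
  ultimately show ?case unfolding F by (auto intro!: exI[of _ g])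
qed

lemma smooth_vector_fieldD:
  assumes U: "open U" and X: "smooth_section_on M TM U X" and c: "c \<in> M"
  shows "smooth_on (snd c ` (U \<inter> fst c)) (field_rep c X)"
proof -
  obtain k b where b: "basis_of (UNIV :: 'e set) k b" using model_basis by blast
  obtain g where g: "\<And>i. i < k \<Longrightarrow> smooth_fun_on M (U \<inter> fst c) (g i)"
    "\<And>x. x \<in> U \<inter> fst c \<Longrightarrow> X x = (\<Sum>i<k. g i x *\<^sub>R coord c x (b i))"
    using smooth_section_onE[OF X frames_tangentI[OF c b]] by blast
  note op = open_image[OF c U]
  have gi: "smooth_on (snd c ` (U \<inter> fst c)) (\<lambda>u. g i (chart_inv c u))" if "i < k" for i
  proof -
    have "smooth_on (snd c ` (U \<inter> fst c \<inter> fst c)) (g i \<circ> chart_inv c)"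
      using g(1)[OF that] c unfolding smooth_fun_on_def by blast
    moreover have "U \<inter> fst c \<inter> fst c = U \<inter> fst c" by blast
    ultimately show ?thesis by (simp add: o_def)
  qed
  have "smooth_on (snd c ` (U \<inter> fst c)) (\<lambda>u. \<Sum>i<k. g i (chart_inv c u) *\<^sub>R b i)"
    using gi by (intro smooth_on_sum smooth_on_scaleR op smooth_on_const) simp
  moreover have "field_rep c X u = (\<Sum>i<k. g i (chart_inv c u) *\<^sub>R b i)" if "u \<in> snd c ` (U \<inter> fst c)" for u
  proof -
    obtain x where x: "x \<in> U \<inter> fst c" "u = snd c x" using \<open>u \<in> _\<close> by blast
    have "X x c = (\<Sum>i<k. g i x *\<^sub>R b i)"
      unfolding g(2)[OF x(1)] sum_fun_apply scaleR_fun_def using c x(1) by (simp add: coord_tvec_self)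
    then show ?thesis using c x by (simp add: field_rep_def)
  qed
  ultimately show ?thesis using smooth_on_cong[OF op, of "field_rep c X"] by simp
qed

text \<open>In another chart the components of a coordinate field are a directional derivative of the
  transition map.\<close>

lemma smooth_coord_field:
  assumes c: "c \<in> M"
  shows "smooth_section_on M TM (fst c) (\<lambda>x. coord c x w)"
proof (rule smooth_vector_fieldI[OF open_chart[OF c] coord_tvec_in_tangent[OF c]])
  fix c' assume c': "c' \<in> M"
  have op: "open (snd c' ` (fst c \<inter> fst c'))" by (rule open_image[OF c' open_chart[OF c]])
  have "smooth_on (snd c' ` (fst c \<inter> fst c'))
      (\<lambda>u. (\<lambda>y. fderiv (transition c c') y w) (transition c' c u))"
  proof (rule smooth_on_compose[OF op _ smooth_on_frechet_derivative[OF smooth_transition[OF c c']]])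
    show "smooth_on (snd c' ` (fst c \<inter> fst c')) (transition c' c)"
      using smooth_transition[OF c' c] by (simp add: Int_commute)
    show "transition c' c ` snd c' ` (fst c \<inter> fst c') \<subseteq> snd c ` (fst c \<inter> fst c')"
      using transition_image[OF c'] by (simp add: Int_commute)
  qed
  moreover have "field_rep c' (\<lambda>x. coord c x w) u = fderiv (transition c c') (transition c' c u) w"
    if "u \<in> snd c' ` (fst c \<inter> fst c')" for u
  proof -
    obtain x where "x \<in> fst c" "x \<in> fst c'" "u = snd c' x" using \<open>u \<in> _\<close> by blast
    then show ?thesis using c' by (simp add: field_rep_chart coord_tvec_chart jac_def transition_chart)
  qed
  ultimately show "smooth_on (snd c' ` (fst c \<inter> fst c')) (field_rep c' (\<lambda>x. coord c x w))"
    using smooth_on_cong[OF op, of "field_rep c' (\<lambda>x. coord c x w)"] by simp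
qed

lemma vector_bundle_tangent: "vector_bundle M TM"
  unfolding vector_bundle_def
proof (intro conjI allI ballI, goal_cases)
  case (1 x)
  then show ?case by (simp add: subspace_tangent)
next
  case 2
  show ?case
  proof (intro equalityI subsetI UNIV_I)
    fix x
    obtain k b where b: "basis_of (UNIV :: 'e set) k b" using model_basis by blast
    show "x \<in> (\<Union>F\<in>frames TM. fst F)"
      by (rule UN_I[OF frames_tangentI[OF chart_at(1)[of x] b]]) (simp add: chart_at(2))
  qed
next
  case (3 F)
  then obtain c k b where c: "c \<in> M" and b: "basis_of UNIV k b"
    and F: "F = (fst c, k, \<lambda>i x. coord c x (b i))" by (rule frames_tangentE)
  show ?case
    unfolding F using open_chart[OF c] basis_of_tangent[OF c _ b] smooth_coord_field[OF c] by simp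
qed


section \<open>One-forms\<close>

lemmas vector_bundle_cotangent = vector_bundle_dual[OF vector_bundle_tangent]

lemma form_rep_chart: "c \<in> M \<Longrightarrow> x \<in> fst c \<Longrightarrow> form_rep M c \<theta> (snd c x) w = \<theta> x (coord c x w)"
  by (simp add: form_rep_def)

lemma smooth_one_formI:
  assumes U: "open U" and \<theta>: "\<And>x. x \<in> U \<Longrightarrow> \<theta> x \<in> fibre TsM x"
    and smooth: "\<And>c w. c \<in> M \<Longrightarrow> smooth_on (snd c ` (U \<inter> fst c)) (\<lambda>u. form_rep M c \<theta> u w)"
  shows "smooth_section_on M TsM U \<theta>"
proof (rule smooth_section_dualI[OF vector_bundle_tangent \<theta>])
  fix V k e i assume "(V, k, e) \<in> frames TM" "i < (k :: nat)"
  then obtain c b where c: "c \<in> M" and V: "V = fst c" "e = (\<lambda>i x. coord c x (b i))"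
    by (auto elim: frames_tangentE)
  have op: "open (U \<inter> fst c)" using U open_chart[OF c] by blast
  have "smooth_fun_on M (U \<inter> fst c) (\<lambda>x. \<theta> x (coord c x (b i)))"
    by (rule smooth_fun_on_chartI[OF c op Int_lower2])
      (use smooth[OF c, of "b i"] in \<open>simp add: form_rep_def[abs_def] o_def\<close>)
  then show "smooth_fun_on M (U \<inter> V) (\<lambda>x. \<theta> x (e i x))" by (simp add: V)
qed

lemma smooth_one_formD:
  assumes U: "open U" and \<theta>: "smooth_section_on M TsM U \<theta>" and c: "c \<in> M"
  shows "smooth_on (snd c ` (U \<inter> fst c)) (\<lambda>u. form_rep M c \<theta> u w)"
proof -
  have op: "open (U \<inter> fst c)" using U open_chart[OF c] by blast
  have "smooth_fun_on M (U \<inter> fst c) (\<lambda>x. \<theta> x (coord c x w))"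
    by (rule smooth_dual_pairing[OF vector_bundle_tangent op smooth_section_on_subset[OF \<theta> Int_lower1]
      smooth_section_on_subset[OF smooth_coord_field[OF c] Int_lower2]])
  then have "smooth_on (snd c ` (U \<inter> fst c \<inter> fst c)) ((\<lambda>x. \<theta> x (coord c x w)) \<circ> chart_inv c)"
    using c unfolding smooth_fun_on_def by blast
  moreover have "U \<inter> fst c \<inter> fst c = U \<inter> fst c" by blast
  ultimately show ?thesis by (simp add: o_def form_rep_def[abs_def])
qed

lemma cotangentD:
  assumes "\<theta> \<in> fibre TsM x"
  shows "linear_on_subspace (T x) \<theta>" "v \<notin> T x \<Longrightarrow> \<theta> v = 0"
  using assms by (simp_all add: fibre_dual)

lemma cotangent_eqI:
  assumes "\<theta> \<in> fibre TsM x" "\<eta> \<in> fibre TsM x"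
    and "\<And>v. v \<in> T x \<Longrightarrow> \<theta> v = \<eta> v"
  shows "\<theta> = \<eta>"
  using cotangentD(2)[OF assms(1)] cotangentD(2)[OF assms(2)] assms(3) by (metis ext)

lemma linear_form_coord:
  assumes \<theta>: "linear_on_subspace (T x) \<theta>" and c: "c \<in> M" "x \<in> fst c"
  shows "linear (\<lambda>w. \<theta> (coord c x w))"
  using coord_tvec_in_tangent[OF c] \<theta>
  by (intro linearI) (simp_all add: linear_add[OF linear_coord_tvec[OF c]]
    linear_scale[OF linear_coord_tvec[OF c]] linear_on_subspace_def)


section \<open>Cartan calculus in charts\<close>

abbreviation vector_fields :: "('m \<Rightarrow> ('m, 'e) tvec) set"
  where "vector_fields \<equiv> sections M TM"

abbreviation one_forms :: "('m \<Rightarrow> ('m, 'e) tvec \<Rightarrow> real) set"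
  where "one_forms \<equiv> sections M TsM"

lemma vector_field_tangent: "X \<in> vector_fields \<Longrightarrow> X x \<in> T x"
  by (simp add: smooth_section_on_def)

lemma one_form_cotangent: "\<theta> \<in> one_forms \<Longrightarrow> \<theta> x \<in> fibre TsM x"
  by (simp add: smooth_section_on_def)

lemma smooth_field_rep: "X \<in> vector_fields \<Longrightarrow> c \<in> M \<Longrightarrow> smooth_on (snd c ` fst c) (field_rep c X)"
  using smooth_vector_fieldD[of UNIV X c] by simp

lemma smooth_form_rep:
  assumes "\<theta> \<in> one_forms" "c \<in> M"
  shows "smooth_form (snd c ` fst c) (form_rep M c \<theta>)"
  unfolding smooth_form_def
proof (intro conjI ballI allI)
  fix u assume "u \<in> snd c ` fst c"
  then obtain x where x: "x \<in> fst c" "u = snd c x" by blast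
  have "form_rep M c \<theta> u = (\<lambda>w. \<theta> x (coord c x w))"
    using x assms(2) by (simp add: form_rep_chart fun_eq_iff)
  then show "linear (form_rep M c \<theta> u)"
    using linear_form_coord[OF cotangentD(1)[OF one_form_cotangent[OF assms(1)]] assms(2) x(1)] by simp
next
  fix w
  show "smooth_on (snd c ` fst c) (\<lambda>u. form_rep M c \<theta> u w)"
    using smooth_one_formD[of UNIV \<theta> c w] assms by simp
qed

lemma field_rep_related:
  assumes X: "X \<in> vector_fields" and c: "c \<in> M" "c' \<in> M" and u: "u \<in> snd c ` (fst c \<inter> fst c')"
  shows "field_rep c' X (transition c c' u) = fderiv (transition c c') u (field_rep c X u)"
proof -
  obtain x where x: "x \<in> fst c" "x \<in> fst c'" "u = snd c x" using u by blast
  then have "X x c' = jac c c' x (X x c)"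
    using vector_field_tangent[OF X, of x] c unfolding tangent_space_iff by blast
  then show ?thesis using x c by (simp add: transition_chart field_rep_chart jac_def)
qed

lemma form_rep_related:
  assumes c: "c \<in> M" "c' \<in> M" and u: "u \<in> snd c ` (fst c \<inter> fst c')"
  shows "form_rep M c \<theta> u w
    = form_rep M c' \<theta> (transition c c' u) (fderiv (transition c c') u w)"
proof -
  obtain x where x: "x \<in> fst c" "x \<in> fst c'" "u = snd c x" using u by blast
  then show ?thesis
    using c coord_tvec_jac[OF c x(1,2), of w] by (simp add: transition_chart form_rep_chart jac_def)
qed

lemma vf_bracket_chart:
  "c \<in> M \<Longrightarrow> x \<in> fst c \<Longrightarrow> vf_bracket M X Y x c = loc_bracket (field_rep c X) (field_rep c Y) (snd c x)"
  by (simp add: vf_bracket_def loc_bracket_def along_def field_rep_def[abs_def])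

lemma transition_into: "c \<in> M \<Longrightarrow> transition c c' ` snd c ` (fst c \<inter> fst c') \<subseteq> snd c' ` fst c'"
  using transition_image[of c c'] by blast

text \<open>For the bracket, the coordinate expressions in the different charts must fit together to a
  tangent vector. The Lie derivative, the exterior derivative and the derivative of a function are
  defined in one arbitrarily chosen chart at each point, and the three lemmas after this one show that
  any other chart gives the same value.\<close>

lemma vf_bracket_section:
  assumes X: "X \<in> vector_fields" and Y: "Y \<in> vector_fields"
  shows "vf_bracket M X Y \<in> vector_fields"
proof -
  have tan: "vf_bracket M X Y x \<in> T x" for x
    unfolding tangent_space_iff
  proof (intro conjI ballI allI impI)
    fix c c' assume c: "c \<in> M" "c' \<in> M" and x: "x \<in> fst c \<and> x \<in> fst c'"
    have u: "snd c x \<in> snd c ` (fst c \<inter> fst c')" using x by blast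
    have sub: "snd c ` (fst c \<inter> fst c') \<subseteq> snd c ` fst c" by blast
    have "loc_bracket (field_rep c' X) (field_rep c' Y) (transition c c' (snd c x))
        = fderiv (transition c c') (snd c x) (loc_bracket (field_rep c X) (field_rep c Y) (snd c x))"
      by (rule loc_bracket_related[OF open_overlap[OF c] u smooth_transition[OF c] transition_into[OF c(1)]
        smooth_on_subset[OF smooth_field_rep[OF X c(1)] sub] smooth_field_rep[OF X c(2)] field_rep_related[OF X c]
        smooth_on_subset[OF smooth_field_rep[OF Y c(1)] sub] smooth_field_rep[OF Y c(2)] field_rep_related[OF Y c]])
    then show "vf_bracket M X Y x c' = jac c c' x (vf_bracket M X Y x c)"
      using c x by (simp add: vf_bracket_chart jac_def transition_chart)
  next
    fix c assume "\<not> (c \<in> M \<and> x \<in> fst c)"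
    then show "vf_bracket M X Y x c = 0" unfolding vf_bracket_def by (simp only: if_False)
  qed
  have "smooth_section_on M TM UNIV (vf_bracket M X Y)"
  proof (rule smooth_vector_fieldI[OF open_UNIV tan])
    fix c assume c: "c \<in> M"
    have "smooth_on (snd c ` fst c) (loc_bracket (field_rep c X) (field_rep c Y))"
      by (rule smooth_on_loc_bracket[OF open_chart_image[OF c] smooth_field_rep[OF X c] smooth_field_rep[OF Y c]])
    moreover have "field_rep c (vf_bracket M X Y) u = loc_bracket (field_rep c X) (field_rep c Y) u" if "u \<in> snd c ` fst c" for u
      using that c by (auto simp: field_rep_chart vf_bracket_chart)
    ultimately show "smooth_on (snd c ` (UNIV \<inter> fst c)) (field_rep c (vf_bracket M X Y))"
      using smooth_on_cong[OF open_chart_image[OF c], of "field_rep c (vf_bracket M X Y)"] by simp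
  qed
  then show ?thesis by simp
qed

lemma lie_deriv_chart:
  assumes X: "X \<in> vector_fields" and \<theta>: "\<theta> \<in> one_forms" and c: "c \<in> M" "x \<in> fst c"
    and v: "v \<in> T x"
  shows "lie_deriv M X \<theta> x v = loc_lie (field_rep c X) (form_rep M c \<theta>) (snd c x) (v c)"
proof -
  define c' where "c' = chart_at M x"
  have c': "c' \<in> M" "x \<in> fst c'" by (simp_all add: c'_def chart_at)
  have u: "snd c x \<in> snd c ` (fst c \<inter> fst c')" using c c' by blast
  have sub: "snd c ` (fst c \<inter> fst c') \<subseteq> snd c ` fst c" by blast
  have vc: "v c' = jac c c' x (v c)" using v c c' unfolding tangent_space_iff by blast
  have "loc_lie (field_rep c X) (form_rep M c \<theta>) (snd c x) (v c)
      = loc_lie (field_rep c' X) (form_rep M c' \<theta>) (transition c c' (snd c x))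
          (fderiv (transition c c') (snd c x) (v c))"
    by (rule loc_lie_related[OF open_overlap[OF c(1) c'(1)] u smooth_transition[OF c(1) c'(1)]
        transition_into[OF c(1)] smooth_form_rep[OF \<theta> c'(1)] form_rep_related[OF c(1) c'(1)]
        smooth_on_subset[OF smooth_field_rep[OF X c(1)] sub] smooth_field_rep[OF X c'(1)] field_rep_related[OF X c(1) c'(1)]])
  also have "\<dots> = loc_lie (field_rep c' X) (form_rep M c' \<theta>) (snd c' x) (v c')"
    using c by (simp add: transition_chart vc jac_def)
  also have "\<dots> = lie_deriv M X \<theta> x v"
    using v c' by (simp add: lie_deriv_def Let_def loc_lie_def field_rep_chart field_rep_def[abs_def] flip: c'_def)
  finally show ?thesis by simp
qed

lemma ext_deriv_chart:
  assumes \<theta>: "\<theta> \<in> one_forms" and c: "c \<in> M" "x \<in> fst c"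
    and v: "v \<in> T x" and w: "w \<in> T x"
  shows "ext_deriv M \<theta> x v w = loc_ext (form_rep M c \<theta>) (snd c x) (v c) (w c)"
proof -
  define c' where "c' = chart_at M x"
  have c': "c' \<in> M" "x \<in> fst c'" by (simp_all add: c'_def chart_at)
  have u: "snd c x \<in> snd c ` (fst c \<inter> fst c')" using c c' by blast
  have vc: "v c' = jac c c' x (v c)" using v c c' unfolding tangent_space_iff by blast
  have wc: "w c' = jac c c' x (w c)" using w c c' unfolding tangent_space_iff by blast
  have "loc_ext (form_rep M c \<theta>) (snd c x) (v c) (w c)
      = loc_ext (form_rep M c' \<theta>) (transition c c' (snd c x))
          (fderiv (transition c c') (snd c x) (v c))
          (fderiv (transition c c') (snd c x) (w c))"
    by (rule loc_ext_related[OF open_overlap[OF c(1) c'(1)] u smooth_transition[OF c(1) c'(1)]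
        transition_into[OF c(1)] smooth_form_rep[OF \<theta> c'(1)] form_rep_related[OF c(1) c'(1)]])
  also have "\<dots> = loc_ext (form_rep M c' \<theta>) (snd c' x) (v c') (w c')"
    using c by (simp add: transition_chart vc wc jac_def)
  also have "\<dots> = ext_deriv M \<theta> x v w"
    by (simp add: ext_deriv_def Let_def loc_ext_def flip: c'_def)
  finally show ?thesis by simp
qed

lemma tvec_apply_chart:
  assumes f: "smooth_fun_on M UNIV f" and c: "c \<in> M" "x \<in> fst c" and v: "v \<in> T x"
  shows "tvec_apply M x v f = fderiv (f \<circ> chart_inv c) (snd c x) (v c)"
proof -
  define c' where "c' = chart_at M x"
  have c': "c' \<in> M" "x \<in> fst c'" by (simp_all add: c'_def chart_at)
  have u: "snd c x \<in> snd c ` (fst c \<inter> fst c')" using c c' by blast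
  have vc: "v c' = jac c c' x (v c)" using v c c' unfolding tangent_space_iff by blast
  have fc': "smooth_on (snd c' ` fst c') (f \<circ> chart_inv c')"
    using f c'(1) unfolding smooth_fun_on_def by simp
  have "fderiv (f \<circ> chart_inv c') (snd c' x) (v c')
      = fderiv (\<lambda>u. (f \<circ> chart_inv c') (transition c c' u)) (snd c x) (v c)"
    using along_related[OF open_overlap[OF c(1) c'(1)] u smooth_transition[OF c(1) c'(1)]
        transition_into[OF c(1)] fc', of "\<lambda>_. v c'" "\<lambda>_. v c"] vc c
    by (simp add: along_def jac_def transition_chart)
  also have "fderiv (\<lambda>u. (f \<circ> chart_inv c') (transition c c' u)) (snd c x)
      = fderiv (f \<circ> chart_inv c) (snd c x)"
  proof (rule frechet_derivative_cong_open[OF open_overlap[OF c(1) c'(1)] u])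
    fix y assume "y \<in> snd c ` (fst c \<inter> fst c')"
    then show "(f \<circ> chart_inv c') (transition c c' y) = (f \<circ> chart_inv c) y"
      using c(1) c'(1) by (auto simp: transition_chart)
  qed
  finally show ?thesis unfolding tvec_apply_def Let_def c'_def[symmetric] .
qed

text \<open>The form component of the Courant-Dorfman bracket.\<close>

definition dorfman :: "('m \<Rightarrow> ('m, 'e) tvec) \<Rightarrow> ('m \<Rightarrow> ('m, 'e) tvec \<Rightarrow> real) \<Rightarrow>
    ('m \<Rightarrow> ('m, 'e) tvec) \<Rightarrow> ('m \<Rightarrow> ('m, 'e) tvec \<Rightarrow> real) \<Rightarrow> 'm \<Rightarrow> ('m, 'e) tvec \<Rightarrow> real"
  where "dorfman X \<theta> Y \<eta> x = lie_deriv M X \<eta> x - contract M Y (ext_deriv M \<theta>) x"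

lemma dorfman_chart:
  assumes "X \<in> vector_fields" "\<theta> \<in> one_forms" "Y \<in> vector_fields" "\<eta> \<in> one_forms"
    and "c \<in> M" "x \<in> fst c" "v \<in> T x"
  shows "dorfman X \<theta> Y \<eta> x v
    = loc_dorfman (field_rep c X) (form_rep M c \<theta>) (field_rep c Y) (form_rep M c \<eta>) (snd c x) (v c)"
  using lie_deriv_chart[OF assms(1,4,5,6,7)] vector_field_tangent[OF assms(3), of x] assms(5-7)
    ext_deriv_chart[OF assms(2,5,6) vector_field_tangent[OF assms(3), of x] assms(7)]
  by (simp add: dorfman_def loc_dorfman_def contract_def fun_diff_def field_rep_chart)

lemma form_rep_dorfman:
  assumes "X \<in> vector_fields" "\<theta> \<in> one_forms" "Y \<in> vector_fields" "\<eta> \<in> one_forms"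
    and c: "c \<in> M" and u: "u \<in> snd c ` fst c"
  shows "form_rep M c (dorfman X \<theta> Y \<eta>) u w
    = loc_dorfman (field_rep c X) (form_rep M c \<theta>) (field_rep c Y) (form_rep M c \<eta>) u w"
proof -
  obtain x where x: "x \<in> fst c" "u = snd c x" using u by blast
  show ?thesis
    using dorfman_chart[OF assms(1-5) x(1) coord_tvec_in_tangent[OF c x(1), of w]] c x
    by (simp add: form_rep_chart coord_tvec_self)
qed

lemma field_rep_vf_bracket:
  "c \<in> M \<Longrightarrow> u \<in> snd c ` fst c \<Longrightarrow> field_rep c (vf_bracket M X Y) u = loc_bracket (field_rep c X) (field_rep c Y) u"
  by (auto simp: field_rep_chart vf_bracket_chart)

lemma dorfman_section:
  assumes X: "X \<in> vector_fields" and \<theta>: "\<theta> \<in> one_forms" and Y: "Y \<in> vector_fields"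
    and \<eta>: "\<eta> \<in> one_forms"
  shows "dorfman X \<theta> Y \<eta> \<in> one_forms"
proof -
  note A = X \<theta> Y \<eta>
  have form: "smooth_form (snd c ` fst c) (loc_dorfman (field_rep c X) (form_rep M c \<theta>) (field_rep c Y) (form_rep M c \<eta>))"
    if "c \<in> M" for c
    by (rule smooth_form_loc_dorfman[OF open_chart_image[OF that] smooth_field_rep[OF X that] smooth_form_rep[OF \<theta> that]
      smooth_field_rep[OF Y that] smooth_form_rep[OF \<eta> that]])
  have cot: "dorfman X \<theta> Y \<eta> x \<in> fibre TsM x" for x
  proof -
    obtain c where c: "c \<in> M" "x \<in> fst c" using chart_cover by blast
    then have lin: "linear (loc_dorfman (field_rep c X) (form_rep M c \<theta>) (field_rep c Y) (form_rep M c \<eta>) (snd c x))"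
      using smooth_formD(1)[OF form[OF c(1)]] by blast
    have "dorfman X \<theta> Y \<eta> x v = 0" if "v \<notin> T x" for v
      using that by (simp add: dorfman_def fun_diff_def lie_deriv_def contract_def)
    moreover have "linear_on_subspace (T x) (dorfman X \<theta> Y \<eta> x)"
      unfolding linear_on_subspace_def
      using dorfman_chart[OF A c] subspace_add[OF subspace_tangent] subspace_scale[OF subspace_tangent]
      by (simp add: linear_add[OF lin] linear_scale[OF lin] plus_fun_def scaleR_fun_def)
    ultimately show ?thesis by (simp add: fibre_dual)
  qed
  have "smooth_section_on M TsM UNIV (dorfman X \<theta> Y \<eta>)"
  proof (rule smooth_one_formI[OF open_UNIV cot])
    fix c w assume c: "c \<in> M"
    have "smooth_on (snd c ` fst c) (\<lambda>u. form_rep M c (dorfman X \<theta> Y \<eta>) u w)"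
      by (subst smooth_on_cong[OF open_chart_image[OF c] form_rep_dorfman[OF A c]])
        (use smooth_formD(2)[OF form[OF c]] in simp_all)
    then show "smooth_on (snd c ` (UNIV \<inter> fst c)) (\<lambda>u. form_rep M c (dorfman X \<theta> Y \<eta>) u w)" by simp
  qed
  then show ?thesis by simp
qed


section \<open>The Lie algebroid structure of the tangent bundle\<close>

lemma vf_bracket_outside: "\<not> (c \<in> M \<and> x \<in> fst c) \<Longrightarrow> vf_bracket M X Y x c = 0"
  unfolding vf_bracket_def by (simp only: if_False)

lemma vf_bracket_eqI:
  assumes "\<And>c. c \<in> M \<Longrightarrow> x \<in> fst c \<Longrightarrow> loc_bracket (field_rep c X) (field_rep c Y) (snd c x) = V c"
    and "\<And>c. \<not> (c \<in> M \<and> x \<in> fst c) \<Longrightarrow> V c = 0"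
  shows "vf_bracket M X Y x = V"
proof
  fix c
  show "vf_bracket M X Y x c = V c"
  proof (cases "c \<in> M \<and> x \<in> fst c")
    case True
    then show ?thesis using assms(1) by (simp add: vf_bracket_chart)
  next
    case False
    then show ?thesis using assms(2)[OF False] vf_bracket_outside[OF False] by simp
  qed
qed

lemma vf_bracket_skew: "vf_bracket M Y X x = - vf_bracket M X Y x"
  by (rule vf_bracket_eqI)
    (simp add: vf_bracket_chart loc_bracket_def, simp add: vf_bracket_outside)

lemma vf_bracket_add_right:
  assumes X: "X \<in> vector_fields" and Y: "Y \<in> vector_fields" and Y': "Y' \<in> vector_fields"
  shows "vf_bracket M X (\<lambda>y. Y y + Y' y) x = vf_bracket M X Y x + vf_bracket M X Y' x"
proof (rule vf_bracket_eqI)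
  fix c assume c: "c \<in> M" "x \<in> fst c"
  show "loc_bracket (field_rep c X) (field_rep c (\<lambda>y. Y y + Y' y)) (snd c x) = (vf_bracket M X Y x + vf_bracket M X Y' x) c"
    using loc_bracket_add_right[OF open_chart_image[OF c(1)] _ smooth_field_rep[OF X c(1)] smooth_field_rep[OF Y c(1)] smooth_field_rep[OF Y' c(1)], of "snd c x"] c
    by (simp add: field_rep_add vf_bracket_chart)
qed (simp add: vf_bracket_outside plus_fun_def)

lemma tvec_apply_along:
  assumes f: "smooth_fun_on M UNIV f" and X: "X \<in> vector_fields" and c: "c \<in> M" "x \<in> fst c"
  shows "tvec_apply M x (X x) f = along (field_rep c X) (f \<circ> chart_inv c) (snd c x)"
  using tvec_apply_chart[OF f c vector_field_tangent[OF X]] c by (simp add: along_def field_rep_chart)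

lemma tvec_apply_const: "tvec_apply M x v (\<lambda>_. r) = 0"
  by (simp add: tvec_apply_def Let_def o_def)

lemma vf_bracket_scaleR_right:
  assumes X: "X \<in> vector_fields" and Y: "Y \<in> vector_fields" and f: "smooth_fun_on M UNIV f"
  shows "vf_bracket M X (\<lambda>y. f y *\<^sub>R Y y) x = f x *\<^sub>R vf_bracket M X Y x + tvec_apply M x (X x) f *\<^sub>R Y x"
proof (rule vf_bracket_eqI)
  fix c assume c: "c \<in> M" "x \<in> fst c"
  have fc: "smooth_on (snd c ` fst c) (f \<circ> chart_inv c)"
    using f c(1) unfolding smooth_fun_on_def by simp
  show "loc_bracket (field_rep c X) (field_rep c (\<lambda>y. f y *\<^sub>R Y y)) (snd c x)
      = (f x *\<^sub>R vf_bracket M X Y x + tvec_apply M x (X x) f *\<^sub>R Y x) c"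
    using loc_bracket_scaleR_right[OF open_chart_image[OF c(1)] _ smooth_field_rep[OF X c(1)] smooth_field_rep[OF Y c(1)] fc, of "snd c x"] c
    by (simp add: field_rep_scaleR scaleR_fun_apply vf_bracket_chart tvec_apply_along[OF f X c] field_rep_chart)
next
  fix c assume c: "\<not> (c \<in> M \<and> x \<in> fst c)"
  then have "Y x c = 0" using vector_field_tangent[OF Y, of x] unfolding tangent_space_iff by blast
  then show "(f x *\<^sub>R vf_bracket M X Y x + tvec_apply M x (X x) f *\<^sub>R Y x) c = 0"
    using vf_bracket_outside[OF c] by (simp add: plus_fun_def scaleR_fun_def)
qed

lemma vf_bracket_scale_right:
  assumes "X \<in> vector_fields" "Y \<in> vector_fields"
  shows "vf_bracket M X (\<lambda>y. r *\<^sub>R Y y) x = r *\<^sub>R vf_bracket M X Y x"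
  using vf_bracket_scaleR_right[OF assms smooth_fun_on_const[of UNIV r], of x] by (simp add: tvec_apply_const)

lemma vf_bracket_add_left:
  assumes "X \<in> vector_fields" "X' \<in> vector_fields" "Y \<in> vector_fields"
  shows "vf_bracket M (\<lambda>y. X y + X' y) Y x = vf_bracket M X Y x + vf_bracket M X' Y x"
  using vf_bracket_add_right[OF assms(3,1,2), of x]
  by (simp add: vf_bracket_skew[of _ Y])

lemma vf_bracket_scale_left:
  assumes "X \<in> vector_fields" "Y \<in> vector_fields"
  shows "vf_bracket M (\<lambda>y. r *\<^sub>R X y) Y x = r *\<^sub>R vf_bracket M X Y x"
  using vf_bracket_scale_right[OF assms(2,1), of r x] by (simp add: vf_bracket_skew[of _ Y])

lemma vf_bracket_jacobi:
  assumes X: "X \<in> vector_fields" and Y: "Y \<in> vector_fields" and Z: "Z \<in> vector_fields"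
  shows "vf_bracket M X (vf_bracket M Y Z) x
    = vf_bracket M (vf_bracket M X Y) Z x + vf_bracket M Y (vf_bracket M X Z) x"
proof (rule vf_bracket_eqI)
  fix c assume c: "c \<in> M" "x \<in> fst c"
  then have u: "snd c x \<in> snd c ` fst c" by blast
  note S = open_chart_image[OF c(1)] u
  have 1: "loc_bracket (field_rep c X) (field_rep c (vf_bracket M Y Z)) (snd c x) = loc_bracket (field_rep c X) (loc_bracket (field_rep c Y) (field_rep c Z)) (snd c x)"
    by (rule loc_bracket_cong[OF S]) (simp_all add: field_rep_vf_bracket[OF c(1)])
  have 2: "loc_bracket (field_rep c (vf_bracket M X Y)) (field_rep c Z) (snd c x) = loc_bracket (loc_bracket (field_rep c X) (field_rep c Y)) (field_rep c Z) (snd c x)"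
    by (rule loc_bracket_cong[OF S]) (simp_all add: field_rep_vf_bracket[OF c(1)])
  have 3: "loc_bracket (field_rep c Y) (field_rep c (vf_bracket M X Z)) (snd c x) = loc_bracket (field_rep c Y) (loc_bracket (field_rep c X) (field_rep c Z)) (snd c x)"
    by (rule loc_bracket_cong[OF S]) (simp_all add: field_rep_vf_bracket[OF c(1)])
  show "loc_bracket (field_rep c X) (field_rep c (vf_bracket M Y Z)) (snd c x)
      = (vf_bracket M (vf_bracket M X Y) Z x + vf_bracket M Y (vf_bracket M X Z) x) c"
    using loc_bracket_jacobi[OF S smooth_field_rep[OF X c(1)] smooth_field_rep[OF Y c(1)] smooth_field_rep[OF Z c(1)]]
    by (simp add: plus_fun_def vf_bracket_chart[OF c] 1 2 3)
qed (simp add: vf_bracket_outside plus_fun_def)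

lemma vb_morphism_tangent_id: "vb_morphism M TM TM (\<lambda>x v. v)"
  by (simp add: vb_morphism_def linear_on_subspace_def)

lemma lie_algebroid_tangent: "lie_algebroid M (tangent_algebroid M)"
proof -
  note simps = plus_fun_def scaleR_fun_def
  have anchored: "anchored_bracket M (tangent_algebroid M)"
    unfolding anchored_bracket_def tangent_algebroid_def algebroid.select_convs
  proof (intro conjI ballI allI impI vector_bundle_tangent vb_morphism_tangent_id vf_bracket_section; (rule ext)?)
    fix X Y assume XY: "X \<in> vector_fields" "Y \<in> vector_fields"
    fix x r
    show "vf_bracket M (r *\<^sub>R X) Y x = (r *\<^sub>R vf_bracket M X Y) x"
      using vf_bracket_scale_left[OF XY, of r x] by (simp add: simps)
    show "vf_bracket M X (r *\<^sub>R Y) x = (r *\<^sub>R vf_bracket M X Y) x"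
      using vf_bracket_scale_right[OF XY, of r x] by (simp add: simps)
    show "vf_bracket M X (\<lambda>x. f x *\<^sub>R Y x) x = f x *\<^sub>R vf_bracket M X Y x + tvec_apply M x (X x) f *\<^sub>R Y x"
      if "smooth_fun_on M UNIV f" for f
      by (rule vf_bracket_scaleR_right[OF XY that])
    fix Z assume Z: "Z \<in> vector_fields"
    show "vf_bracket M (X + Y) Z x = (vf_bracket M X Z + vf_bracket M Y Z) x"
      using vf_bracket_add_left[OF XY Z, of x] by (simp add: simps)
    show "vf_bracket M X (Y + Z) x = (vf_bracket M X Y + vf_bracket M X Z) x"
      using vf_bracket_add_right[OF XY Z, of x] by (simp add: simps)
  qed simp_all
  have skew: "vf_bracket M X Y = - vf_bracket M Y X" for X Y
    by (rule ext) (simp add: vf_bracket_skew[of X Y])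
  have jacobi: "vf_bracket M X (vf_bracket M Y Z) + vf_bracket M Y (vf_bracket M Z X)
      + vf_bracket M Z (vf_bracket M X Y) = 0"
    if XYZ: "X \<in> vector_fields" "Y \<in> vector_fields" "Z \<in> vector_fields" for X Y Z
  proof
    fix x
    have "vf_bracket M Z X = (\<lambda>y. (- 1) *\<^sub>R vf_bracket M X Z y)"
      by (rule ext) (simp add: vf_bracket_skew[of Z X])
    then have "vf_bracket M Y (vf_bracket M Z X) x = - vf_bracket M Y (vf_bracket M X Z) x"
      using vf_bracket_scale_right[OF XYZ(2) vf_bracket_section[OF XYZ(1,3)], of "- 1" x] by simp
    then show "(vf_bracket M X (vf_bracket M Y Z) + vf_bracket M Y (vf_bracket M Z X)
      + vf_bracket M Z (vf_bracket M X Y)) x = 0 x"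
      using vf_bracket_jacobi[OF XYZ, of x] vf_bracket_skew[of Z "vf_bracket M X Y" x]
      by (simp add: plus_fun_def zero_fun_def)
  qed
  show ?thesis
    unfolding lie_algebroid_def tangent_algebroid_def algebroid.select_convs
    by (intro conjI ballI anchored[unfolded tangent_algebroid_def] skew; rule jacobi; assumption)
qed


section \<open>The standard Courant algebroid\<close>

lemma dorfman_outside: "v \<notin> T x \<Longrightarrow> dorfman X \<theta> Y \<eta> x v = 0"
  by (simp add: dorfman_def fun_diff_def lie_deriv_def contract_def)

text \<open>Identities between one-forms are reduced to local ones on tangent vectors; on all other arguments
  both sides are 0 by convention.\<close>

lemma dorfman_eqI:
  assumes "X \<in> vector_fields" "\<theta> \<in> one_forms" "Y \<in> vector_fields" "\<eta> \<in> one_forms"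
    and "\<And>c v. c \<in> M \<Longrightarrow> x \<in> fst c \<Longrightarrow> v \<in> T x \<Longrightarrow>
      loc_dorfman (field_rep c X) (form_rep M c \<theta>) (field_rep c Y) (form_rep M c \<eta>) (snd c x) (v c) = \<omega> v"
    and "\<And>v. v \<notin> T x \<Longrightarrow> \<omega> v = 0"
  shows "dorfman X \<theta> Y \<eta> x = \<omega>"
proof
  fix v
  show "dorfman X \<theta> Y \<eta> x v = \<omega> v"
    using dorfman_chart[OF assms(1-4) chart_at, of v] assms(5)[OF chart_at, of v] assms(6)[of v]
      dorfman_outside[of v x X \<theta> Y \<eta>]
    by (cases "v \<in> T x") simp_all
qed

lemma form_rep_add: "form_rep M c (\<lambda>y. \<theta> y + \<eta> y) = (\<lambda>u w. form_rep M c \<theta> u w + form_rep M c \<eta> u w)"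
  by (simp add: form_rep_def plus_fun_def fun_eq_iff)

lemma form_rep_scaleR: "form_rep M c (\<lambda>y. f y *\<^sub>R \<eta> y) = (\<lambda>u w. (f \<circ> chart_inv c) u * form_rep M c \<eta> u w)"
  by (simp add: form_rep_def scaleR_fun_def fun_eq_iff)

lemma sections_add:
  assumes "vector_bundle M E" "s \<in> sections M E" "t \<in> sections M E"
  shows "(\<lambda>x. s x + t x) \<in> sections M E"
  using smooth_section_on_add[OF assms(1) open_UNIV] assms(2,3) by simp

lemma sections_scaleR:
  assumes "vector_bundle M E" "smooth_fun_on M UNIV f" "s \<in> sections M E"
  shows "(\<lambda>x. f x *\<^sub>R s x) \<in> sections M E"
  using smooth_section_on_scaleR[OF assms(1) open_UNIV assms(2)] assms(3) by simp

lemma dorfman_add_left: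
  assumes X: "X \<in> vector_fields" "X' \<in> vector_fields" and \<theta>: "\<theta> \<in> one_forms" "\<theta>' \<in> one_forms"
    and Y: "Y \<in> vector_fields" and \<eta>: "\<eta> \<in> one_forms"
  shows "dorfman (\<lambda>y. X y + X' y) (\<lambda>y. \<theta> y + \<theta>' y) Y \<eta> x = dorfman X \<theta> Y \<eta> x + dorfman X' \<theta>' Y \<eta> x"
proof (rule dorfman_eqI[OF sections_add[OF vector_bundle_tangent X] sections_add[OF vector_bundle_cotangent \<theta>] Y \<eta>])
  fix c v assume c: "c \<in> M" "x \<in> fst c" and v: "v \<in> T x"
  then have u: "snd c x \<in> snd c ` fst c" by blast
  show "loc_dorfman (field_rep c (\<lambda>y. X y + X' y)) (form_rep M c (\<lambda>y. \<theta> y + \<theta>' y)) (field_rep c Y) (form_rep M c \<eta>) (snd c x) (v c)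
      = (dorfman X \<theta> Y \<eta> x + dorfman X' \<theta>' Y \<eta> x) v"
    unfolding field_rep_add form_rep_add plus_fun_apply dorfman_chart[OF X(1) \<theta>(1) Y \<eta> c v] dorfman_chart[OF X(2) \<theta>(2) Y \<eta> c v]
    by (rule loc_dorfman_add_left[OF open_chart_image[OF c(1)] u smooth_field_rep[OF X(1) c(1)] smooth_field_rep[OF X(2) c(1)]
      smooth_form_rep[OF \<theta>(1) c(1)] smooth_form_rep[OF \<theta>(2) c(1)] smooth_form_rep[OF \<eta> c(1)]])
qed (simp add: plus_fun_def dorfman_outside)

lemma dorfman_add_right:
  assumes X: "X \<in> vector_fields" and \<theta>: "\<theta> \<in> one_forms"
    and Y: "Y \<in> vector_fields" "Y' \<in> vector_fields" and \<eta>: "\<eta> \<in> one_forms" "\<eta>' \<in> one_forms"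
  shows "dorfman X \<theta> (\<lambda>y. Y y + Y' y) (\<lambda>y. \<eta> y + \<eta>' y) x = dorfman X \<theta> Y \<eta> x + dorfman X \<theta> Y' \<eta>' x"
proof (rule dorfman_eqI[OF X \<theta> sections_add[OF vector_bundle_tangent Y] sections_add[OF vector_bundle_cotangent \<eta>]])
  fix c v assume c: "c \<in> M" "x \<in> fst c" and v: "v \<in> T x"
  then have u: "snd c x \<in> snd c ` fst c" by blast
  show "loc_dorfman (field_rep c X) (form_rep M c \<theta>) (field_rep c (\<lambda>y. Y y + Y' y)) (form_rep M c (\<lambda>y. \<eta> y + \<eta>' y)) (snd c x) (v c)
      = (dorfman X \<theta> Y \<eta> x + dorfman X \<theta> Y' \<eta>' x) v"
    unfolding field_rep_add form_rep_add plus_fun_apply dorfman_chart[OF X \<theta> Y(1) \<eta>(1) c v] dorfman_chart[OF X \<theta> Y(2) \<eta>(2) c v]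
    by (rule loc_dorfman_add_right[OF open_chart_image[OF c(1)] u
      smooth_form_rep[OF \<theta> c(1)] smooth_form_rep[OF \<eta>(1) c(1)] smooth_form_rep[OF \<eta>(2) c(1)]])
qed (simp add: plus_fun_def dorfman_outside)

lemma dorfman_scaleR_right:
  assumes X: "X \<in> vector_fields" and \<theta>: "\<theta> \<in> one_forms"
    and Y: "Y \<in> vector_fields" and \<eta>: "\<eta> \<in> one_forms" and f: "smooth_fun_on M UNIV f"
  shows "dorfman X \<theta> (\<lambda>y. f y *\<^sub>R Y y) (\<lambda>y. f y *\<^sub>R \<eta> y) x
    = f x *\<^sub>R dorfman X \<theta> Y \<eta> x + tvec_apply M x (X x) f *\<^sub>R \<eta> x"
proof (rule dorfman_eqI[OF X \<theta> sections_scaleR[OF vector_bundle_tangent f Y] sections_scaleR[OF vector_bundle_cotangent f \<eta>]])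
  fix c v assume c: "c \<in> M" "x \<in> fst c" and v: "v \<in> T x"
  then have u: "snd c x \<in> snd c ` fst c" by blast
  have fc: "smooth_on (snd c ` fst c) (f \<circ> chart_inv c)"
    using f c(1) unfolding smooth_fun_on_def by simp
  have "loc_dorfman (field_rep c X) (form_rep M c \<theta>) (field_rep c (\<lambda>y. f y *\<^sub>R Y y)) (form_rep M c (\<lambda>y. f y *\<^sub>R \<eta> y)) (snd c x) (v c)
      = (f \<circ> chart_inv c) (snd c x) * loc_dorfman (field_rep c X) (form_rep M c \<theta>) (field_rep c Y) (form_rep M c \<eta>) (snd c x) (v c)
        + along (field_rep c X) (f \<circ> chart_inv c) (snd c x) * form_rep M c \<eta> (snd c x) (v c)"
    unfolding field_rep_scaleR form_rep_scaleR
    by (rule loc_dorfman_scale_right[OF open_chart_image[OF c(1)] u smooth_form_rep[OF \<theta> c(1)] smooth_form_rep[OF \<eta> c(1)] fc])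
  then show "loc_dorfman (field_rep c X) (form_rep M c \<theta>) (field_rep c (\<lambda>y. f y *\<^sub>R Y y)) (form_rep M c (\<lambda>y. f y *\<^sub>R \<eta> y)) (snd c x) (v c)
      = (f x *\<^sub>R dorfman X \<theta> Y \<eta> x + tvec_apply M x (X x) f *\<^sub>R \<eta> x) v"
    using c by (simp add: plus_fun_def scaleR_fun_def dorfman_chart[OF X \<theta> Y \<eta> c v] tvec_apply_along[OF f X c]
      form_rep_chart coord_tvec_of_tangent[OF c v])
next
  fix v assume "v \<notin> T x"
  then show "(f x *\<^sub>R dorfman X \<theta> Y \<eta> x + tvec_apply M x (X x) f *\<^sub>R \<eta> x) v = 0"
    using cotangentD(2)[OF one_form_cotangent[OF \<eta>]] by (simp add: plus_fun_def scaleR_fun_def dorfman_outside)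
qed

lemma dorfman_scale_right:
  assumes "X \<in> vector_fields" "\<theta> \<in> one_forms" "Y \<in> vector_fields" "\<eta> \<in> one_forms"
  shows "dorfman X \<theta> (\<lambda>y. r *\<^sub>R Y y) (\<lambda>y. r *\<^sub>R \<eta> y) x = r *\<^sub>R dorfman X \<theta> Y \<eta> x"
  using dorfman_scaleR_right[OF assms smooth_fun_on_const[of UNIV r], of x] by (simp add: tvec_apply_const)

lemma dorfman_scale_left:
  assumes X: "X \<in> vector_fields" and \<theta>: "\<theta> \<in> one_forms" and Y: "Y \<in> vector_fields" and \<eta>: "\<eta> \<in> one_forms"
  shows "dorfman (\<lambda>y. r *\<^sub>R X y) (\<lambda>y. r *\<^sub>R \<theta> y) Y \<eta> x = r *\<^sub>R dorfman X \<theta> Y \<eta> x"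
proof (rule dorfman_eqI[OF sections_scaleR[OF vector_bundle_tangent smooth_fun_on_const X]
    sections_scaleR[OF vector_bundle_cotangent smooth_fun_on_const \<theta>] Y \<eta>])
  fix c v assume c: "c \<in> M" "x \<in> fst c" and v: "v \<in> T x"
  then have u: "snd c x \<in> snd c ` fst c" by blast
  show "loc_dorfman (field_rep c (\<lambda>y. r *\<^sub>R X y)) (form_rep M c (\<lambda>y. r *\<^sub>R \<theta> y)) (field_rep c Y) (form_rep M c \<eta>) (snd c x) (v c)
      = (r *\<^sub>R dorfman X \<theta> Y \<eta> x) v"
    using loc_dorfman_scale_left[OF open_chart_image[OF c(1)] u smooth_field_rep[OF X c(1)]
      smooth_form_rep[OF \<theta> c(1)] smooth_form_rep[OF \<eta> c(1)], of r]
    by (simp add: field_rep_scaleR form_rep_scaleR scaleR_fun_apply dorfman_chart[OF X \<theta> Y \<eta> c v])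
qed (simp add: scaleR_fun_def dorfman_outside)

lemma dorfman_jacobi:
  assumes X: "X \<in> vector_fields" and \<theta>: "\<theta> \<in> one_forms" and Y: "Y \<in> vector_fields" and \<eta>: "\<eta> \<in> one_forms"
    and Z: "Z \<in> vector_fields" and \<zeta>: "\<zeta> \<in> one_forms"
  shows "dorfman X \<theta> (vf_bracket M Y Z) (dorfman Y \<eta> Z \<zeta>) x
    = dorfman (vf_bracket M X Y) (dorfman X \<theta> Y \<eta>) Z \<zeta> x + dorfman Y \<eta> (vf_bracket M X Z) (dorfman X \<theta> Z \<zeta>) x"
proof (rule dorfman_eqI[OF X \<theta> vf_bracket_section[OF Y Z] dorfman_section[OF Y \<eta> Z \<zeta>]])
  fix c v assume c: "c \<in> M" "x \<in> fst c" and v: "v \<in> T x"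
  then have u: "snd c x \<in> snd c ` fst c" by blast
  note S = open_chart_image[OF c(1)] u
  let ?X = "field_rep c X" and ?Y = "field_rep c Y" and ?Z = "field_rep c Z"
  let ?\<theta> = "form_rep M c \<theta>" and ?\<eta> = "form_rep M c \<eta>" and ?\<zeta> = "form_rep M c \<zeta>"
  have 1: "loc_dorfman ?X ?\<theta> (field_rep c (vf_bracket M Y Z)) (form_rep M c (dorfman Y \<eta> Z \<zeta>)) (snd c x) (v c)
      = loc_dorfman ?X ?\<theta> (loc_bracket ?Y ?Z) (loc_dorfman ?Y ?\<eta> ?Z ?\<zeta>) (snd c x) (v c)"
    by (rule loc_dorfman_cong[OF S])
      (simp_all add: field_rep_vf_bracket[OF c(1)] form_rep_dorfman[OF Y \<eta> Z \<zeta> c(1)])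
  have 2: "loc_dorfman (field_rep c (vf_bracket M X Y)) (form_rep M c (dorfman X \<theta> Y \<eta>)) ?Z ?\<zeta> (snd c x) (v c)
      = loc_dorfman (loc_bracket ?X ?Y) (loc_dorfman ?X ?\<theta> ?Y ?\<eta>) ?Z ?\<zeta> (snd c x) (v c)"
    by (rule loc_dorfman_cong[OF S])
      (simp_all add: field_rep_vf_bracket[OF c(1)] form_rep_dorfman[OF X \<theta> Y \<eta> c(1)])
  have 3: "loc_dorfman ?Y ?\<eta> (field_rep c (vf_bracket M X Z)) (form_rep M c (dorfman X \<theta> Z \<zeta>)) (snd c x) (v c)
      = loc_dorfman ?Y ?\<eta> (loc_bracket ?X ?Z) (loc_dorfman ?X ?\<theta> ?Z ?\<zeta>) (snd c x) (v c)"
    by (rule loc_dorfman_cong[OF S])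
      (simp_all add: field_rep_vf_bracket[OF c(1)] form_rep_dorfman[OF X \<theta> Z \<zeta> c(1)])
  show "loc_dorfman ?X ?\<theta> (field_rep c (vf_bracket M Y Z)) (form_rep M c (dorfman Y \<eta> Z \<zeta>)) (snd c x) (v c)
      = (dorfman (vf_bracket M X Y) (dorfman X \<theta> Y \<eta>) Z \<zeta> x + dorfman Y \<eta> (vf_bracket M X Z) (dorfman X \<theta> Z \<zeta>) x) v"
    unfolding plus_fun_def
      dorfman_chart[OF vf_bracket_section[OF X Y] dorfman_section[OF X \<theta> Y \<eta>] Z \<zeta> c v]
      dorfman_chart[OF Y \<eta> vf_bracket_section[OF X Z] dorfman_section[OF X \<theta> Z \<zeta>] c v] 1 2 3
    by (rule loc_dorfman_jacobi[OF S smooth_field_rep[OF X c(1)] smooth_form_rep[OF \<theta> c(1)] smooth_field_rep[OF Y c(1)]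
      smooth_form_rep[OF \<eta> c(1)] smooth_field_rep[OF Z c(1)] smooth_form_rep[OF \<zeta> c(1)]])
qed (simp add: plus_fun_def dorfman_outside)

lemma smooth_pairing_sum:
  assumes U: "open U" and \<eta>: "smooth_section_on M TsM U \<eta>" "smooth_section_on M TsM U \<zeta>"
    and Z: "smooth_section_on M TM U Z" "smooth_section_on M TM U Y"
  shows "smooth_fun_on M U (\<lambda>y. \<eta> y (Z y) + \<zeta> y (Y y))"
  by (intro smooth_fun_on_add[OF U] smooth_dual_pairing[OF vector_bundle_tangent U] \<eta> Z)

lemma tvec_apply_pairing_sum:
  assumes Y: "Y \<in> vector_fields" and \<eta>: "\<eta> \<in> one_forms" and Z: "Z \<in> vector_fields" and \<zeta>: "\<zeta> \<in> one_forms"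
    and c: "c \<in> M" "x \<in> fst c" and v: "v \<in> T x"
  shows "tvec_apply M x v (\<lambda>y. \<eta> y (Z y) + \<zeta> y (Y y))
    = fderiv (\<lambda>u. form_rep M c \<eta> u (field_rep c Z u) + form_rep M c \<zeta> u (field_rep c Y u)) (snd c x) (v c)"
proof -
  have f: "smooth_fun_on M UNIV (\<lambda>y. \<eta> y (Z y) + \<zeta> y (Y y))"
    using smooth_pairing_sum[OF open_UNIV] assms(1-4) by simp
  have rep: "\<omega> y (W y) = form_rep M c \<omega> (snd c y) (field_rep c W (snd c y))" if "W \<in> vector_fields" "y \<in> fst c" for \<omega> W y
    using c(1) that(2) coord_tvec_of_tangent[OF c(1) that(2) vector_field_tangent[OF that(1)]]
    by (simp add: form_rep_chart field_rep_chart)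
  have "fderiv ((\<lambda>y. \<eta> y (Z y) + \<zeta> y (Y y)) \<circ> chart_inv c) (snd c x)
      = fderiv (\<lambda>u. form_rep M c \<eta> u (field_rep c Z u) + form_rep M c \<zeta> u (field_rep c Y u)) (snd c x)"
  proof (rule frechet_derivative_cong_open[OF open_chart_image[OF c(1)]])
    show "snd c x \<in> snd c ` fst c" using c by blast
    fix u assume "u \<in> snd c ` fst c"
    then obtain y where y: "y \<in> fst c" "u = snd c y" by blast
    show "((\<lambda>y. \<eta> y (Z y) + \<zeta> y (Y y)) \<circ> chart_inv c) u = form_rep M c \<eta> u (field_rep c Z u) + form_rep M c \<zeta> u (field_rep c Y u)"
      using rep[OF Z y(1), of \<eta>] rep[OF Y y(1), of \<zeta>] y c(1) by simp
  qed
  then show ?thesis using tvec_apply_chart[OF f c v] by simp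
qed

lemma dorfman_invariant:
  assumes X: "X \<in> vector_fields" and \<theta>: "\<theta> \<in> one_forms" and Y: "Y \<in> vector_fields" and \<eta>: "\<eta> \<in> one_forms"
    and Z: "Z \<in> vector_fields" and \<zeta>: "\<zeta> \<in> one_forms"
  shows "tvec_apply M x (X x) (\<lambda>y. \<eta> y (Z y) + \<zeta> y (Y y))
    = dorfman X \<theta> Y \<eta> x (Z x) + \<zeta> x (vf_bracket M X Y x) + (\<eta> x (vf_bracket M X Z x) + dorfman X \<theta> Z \<zeta> x (Y x))"
proof -
  obtain c where c: "c \<in> M" "x \<in> fst c" using chart_cover by blast
  then have u: "snd c x \<in> snd c ` fst c" by blast
  note T = vector_field_tangent
  have rep: "\<omega> x v = form_rep M c \<omega> (snd c x) (v c)" if "v \<in> T x" for \<omega> v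
    using c coord_tvec_of_tangent[OF c that] by (simp add: form_rep_chart)
  show ?thesis
    using loc_dorfman_invariant[OF open_chart_image[OF c(1)] u smooth_field_rep[OF X c(1)] smooth_form_rep[OF \<theta> c(1)]
      smooth_field_rep[OF Y c(1)] smooth_form_rep[OF \<eta> c(1)] smooth_field_rep[OF Z c(1)] smooth_form_rep[OF \<zeta> c(1)]]
    unfolding tvec_apply_pairing_sum[OF Y \<eta> Z \<zeta> c T[OF X]] dorfman_chart[OF X \<theta> Y \<eta> c T[OF Z]]
      dorfman_chart[OF X \<theta> Z \<zeta> c T[OF Y]] rep[OF T[OF vf_bracket_section[OF X Y]]]
      rep[OF T[OF vf_bracket_section[OF X Z]]] vf_bracket_chart[OF c] along_def field_rep_chart[OF c] .
qed

lemma dorfman_symmetric_part: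
  assumes X: "X \<in> vector_fields" and \<theta>: "\<theta> \<in> one_forms" and Y: "Y \<in> vector_fields" and \<eta>: "\<eta> \<in> one_forms"
    and v: "v \<in> T x"
  shows "dorfman X \<theta> Y \<eta> x v + dorfman Y \<eta> X \<theta> x v = tvec_apply M x v (\<lambda>y. \<theta> y (Y y) + \<eta> y (X y))"
proof -
  obtain c where c: "c \<in> M" "x \<in> fst c" using chart_cover by blast
  then have u: "snd c x \<in> snd c ` fst c" by blast
  show ?thesis
    unfolding tvec_apply_pairing_sum[OF X \<theta> Y \<eta> c v] dorfman_chart[OF X \<theta> Y \<eta> c v] dorfman_chart[OF Y \<eta> X \<theta> c v]
    by (rule loc_dorfman_symmetric_part[OF open_chart_image[OF c(1)] u smooth_field_rep[OF X c(1)] smooth_form_rep[OF \<theta> c(1)]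
      smooth_field_rep[OF Y c(1)] smooth_form_rep[OF \<eta> c(1)]])
qed

abbreviation std_bundle :: "('m, ('m, 'e) tvec \<times> (('m, 'e) tvec \<Rightarrow> real)) vbundle"
  where "std_bundle \<equiv> TM \<oplus>\<^sub>b TsM"

lemmas vector_bundle_std = vector_bundle_direct_sum[OF vector_bundle_tangent vector_bundle_cotangent]

lemma standard_courant_simps:
  "bun (standard_courant M) = std_bundle"
  "anchor (standard_courant M) x p = fst p"
  "bracket (standard_courant M) s t = (\<lambda>x. (vf_bracket M (\<lambda>y. fst (s y)) (\<lambda>y. fst (t y)) x,
    dorfman (\<lambda>y. fst (s y)) (\<lambda>y. snd (s y)) (\<lambda>y. fst (t y)) (\<lambda>y. snd (t y)) x))"
  "pairing (standard_courant M) x p q = snd p (fst q) + snd q (fst p)"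
  by (simp_all add: standard_courant_def dorfman_def)

lemma std_sectionD:
  assumes "s \<in> sections M std_bundle"
  shows "(\<lambda>x. fst (s x)) \<in> vector_fields" "(\<lambda>x. snd (s x)) \<in> one_forms"
  using smooth_section_components[OF vector_bundle_tangent vector_bundle_cotangent open_UNIV] assms by simp_all

lemma std_sectionI:
  assumes "X \<in> vector_fields" "\<theta> \<in> one_forms"
  shows "(\<lambda>x. (X x, \<theta> x)) \<in> sections M std_bundle"
  using smooth_section_pair assms by simp

lemma vb_morphism_fst: "vb_morphism M std_bundle TM (\<lambda>x. fst)"
  unfolding vb_morphism_def
proof (intro conjI allI impI)
  fix U s assume "open U \<and> smooth_section_on M std_bundle U s"
  then show "smooth_section_on M TM U (\<lambda>x. fst (s x))"
    using smooth_section_components(1)[OF vector_bundle_tangent vector_bundle_cotangent] by blast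
qed (auto simp: linear_on_subspace_def)

lemma anchored_bracket_standard: "anchored_bracket M (standard_courant M)"
  unfolding anchored_bracket_def standard_courant_simps
proof ((intro conjI ballI allI impI vector_bundle_std vb_morphism_fst; (rule ext)?), goal_cases)
  case (1 a b)
  then show ?case by (intro std_sectionI vf_bracket_section dorfman_section std_sectionD)
next
  case (2 a b x)
  then show ?case by simp
next
  case (3 a b r x)
  note A = std_sectionD[OF 3(1)] and B = std_sectionD[OF 3(2)]
  show ?case
    using vf_bracket_scale_left[OF A(1) B(1), of r x] dorfman_scale_left[OF A B, of r x]
    by (simp add: scaleR_fun_apply)
next
  case (4 a b r x)
  note A = std_sectionD[OF 4(1)] and B = std_sectionD[OF 4(2)]
  show ?case
    using vf_bracket_scale_right[OF A(1) B(1), of r x] dorfman_scale_right[OF A B, of r x]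
    by (simp add: scaleR_fun_apply)
next
  case (5 a b f x)
  note A = std_sectionD[OF 5(1)] and B = std_sectionD[OF 5(2)]
  show ?case
    using vf_bracket_scaleR_right[OF A(1) B(1) 5(3), of x] dorfman_scaleR_right[OF A B 5(3), of x]
    by (simp add: prod_eq_iff)
next
  case (6 a b c x)
  note A = std_sectionD[OF 6(1)] and B = std_sectionD[OF 6(2)] and C = std_sectionD[OF 6(3)]
  show ?case
    using vf_bracket_add_left[OF A(1) B(1) C(1), of x] dorfman_add_left[OF A(1) B(1) A(2) B(2) C, of x]
    by simp
next
  case (7 a b c x)
  note A = std_sectionD[OF 7(1)] and B = std_sectionD[OF 7(2)] and C = std_sectionD[OF 7(3)]
  show ?case
    using vf_bracket_add_right[OF A(1) B(1) C(1), of x] dorfman_add_right[OF A B(1) C(1) B(2) C(2), of x]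
    by simp
qed

lemma std_pairing_nondegenerate:
  assumes p: "p \<in> fibre std_bundle x"
    and zero: "\<And>q. q \<in> fibre std_bundle x \<Longrightarrow> snd p (fst q) + snd q (fst p) = 0"
  shows "p = 0"
proof -
  have mem: "fst p \<in> T x" "snd p \<in> fibre TsM x" using p by auto
  have z: "0 \<in> fibre TsM x" by (rule subspace_0[OF subspace_dual])
  have "snd p v = 0" if "v \<in> T x" for v
    using zero[of "(v, 0)"] that z by simp
  then have snd0: "snd p = 0" using cotangent_eqI[OF mem(2) z] by simp
  obtain c where c: "c \<in> M" "x \<in> fst c" using chart_cover by blast
  \<comment> \<open>The Euclidean inner product with \<open>fst p\<close> in one chart is a covector that detects \<open>fst p\<close>.\<close>
  define \<eta> where "\<eta> w = (if w \<in> T x then fst p c \<bullet> w c else 0)" for w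
  have "\<eta> \<in> fibre TsM x"
    using subspace_add[OF subspace_tangent] subspace_scale[OF subspace_tangent]
    by (simp add: fibre_dual linear_on_subspace_def \<eta>_def inner_add_right scaleR_fun_apply)
  then have "\<eta> (fst p) = 0"
    using zero[of "(0, \<eta>)"] subspace_0[OF subspace_tangent] by (simp add: snd0)
  then have "fst p c = 0" using mem(1) by (simp add: \<eta>_def)
  then have "fst p = 0"
    using tangent_eqI[OF c mem(1) subspace_0[OF subspace_tangent]] by simp
  with snd0 show ?thesis by (simp add: prod_eq_iff)
qed

lemma courant_algebroid_standard: "courant_algebroid M (standard_courant M)"
  unfolding courant_algebroid_def standard_courant_simps
proof (intro conjI ballI allI impI anchored_bracket_standard, goal_cases)
  case (1 x p)
  then have lin: "linear_on_subspace (T x) (snd p)"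
    using cotangentD(1) by fastforce
  show ?case
    unfolding linear_on_subspace_def
    using lin[unfolded linear_on_subspace_def]
    by (auto simp: scaleR_fun_apply algebra_simps)
next
  case (2 x p q)
  then show ?case by simp
next
  case (3 x p)
  then show ?case using std_pairing_nondegenerate by blast
next
  case (4 U a b)
  then have U: "open U" and a: "smooth_section_on M std_bundle U a" and b: "smooth_section_on M std_bundle U b"
    by blast+
  note comp = smooth_section_components[OF vector_bundle_tangent vector_bundle_cotangent U]
  show ?case by (rule smooth_pairing_sum[OF U comp(2)[OF a] comp(2)[OF b] comp(1)[OF b] comp(1)[OF a]])
next
  case (5 a b c)
  note A = std_sectionD[OF 5(1)] and B = std_sectionD[OF 5(2)] and C = std_sectionD[OF 5(3)]
  show ?case
    by (rule ext) (simp add: vf_bracket_jacobi[OF A(1) B(1) C(1)] dorfman_jacobi[OF A B C])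
next
  case (6 a b c x)
  note A = std_sectionD[OF 6(1)] and B = std_sectionD[OF 6(2)] and C = std_sectionD[OF 6(3)]
  show ?case
    using dorfman_invariant[OF A B C, of x] by simp
next
  case (7 a b x p)
  note A = std_sectionD[OF 7(1)] and B = std_sectionD[OF 7(2)]
  have p: "fst p \<in> T x" "snd p \<in> fibre TsM x" using 7(3) by auto
  have "snd p 0 = 0"
    by (rule linear_on_subspace_zero[OF subspace_tangent cotangentD(1)[OF p(2)]])
  then show ?case
    using dorfman_symmetric_part[OF A B p(1)]
      vf_bracket_skew[of "\<lambda>y. fst (b y)" "\<lambda>y. fst (a y)" x] by simp
qed


section \<open>The tangent bundle as a Dirac structure\<close>

lemma dorfman_zero: "dorfman X (\<lambda>_. 0) Y (\<lambda>_. 0) x = 0"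
  by (rule ext) (simp add: dorfman_def lie_deriv_def contract_def ext_deriv_def form_rep_def Let_def)

text \<open>With the vector fields fixed, the bracket is additive in the pair of forms. This separates the
  contributions of \<open>\<sigma>\<close> and of \<open>\<theta>\<close> to the bracket of two values of \<open>\<Phi>\<close>.\<close>

lemma dorfman_add_forms:
  assumes X: "X \<in> vector_fields" and \<theta>: "\<theta> \<in> one_forms" "\<theta>' \<in> one_forms"
    and Y: "Y \<in> vector_fields" and \<eta>: "\<eta> \<in> one_forms" "\<eta>' \<in> one_forms"
  shows "dorfman X (\<lambda>y. \<theta> y + \<theta>' y) Y (\<lambda>y. \<eta> y + \<eta>' y) x = dorfman X \<theta> Y \<eta> x + dorfman X \<theta>' Y \<eta>' x"
proof (rule dorfman_eqI[OF X sections_add[OF vector_bundle_cotangent \<theta>] Y sections_add[OF vector_bundle_cotangent \<eta>]])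
  fix c v assume c: "c \<in> M" "x \<in> fst c" and v: "v \<in> T x"
  then have u: "snd c x \<in> snd c ` fst c" by blast
  show "loc_dorfman (field_rep c X) (form_rep M c (\<lambda>y. \<theta> y + \<theta>' y)) (field_rep c Y) (form_rep M c (\<lambda>y. \<eta> y + \<eta>' y)) (snd c x) (v c)
      = (dorfman X \<theta> Y \<eta> x + dorfman X \<theta>' Y \<eta>' x) v"
    unfolding form_rep_add plus_fun_apply dorfman_chart[OF X \<theta>(1) Y \<eta>(1) c v] dorfman_chart[OF X \<theta>(2) Y \<eta>(2) c v]
    by (rule loc_dorfman_add_forms[OF u smooth_form_rep[OF \<theta>(1) c(1)] smooth_form_rep[OF \<theta>(2) c(1)]
      smooth_form_rep[OF \<eta>(1) c(1)] smooth_form_rep[OF \<eta>(2) c(1)]])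
qed (simp add: dorfman_outside)

abbreviation TM_in_std :: "'m \<Rightarrow> (('m, 'e) tvec \<times> (('m, 'e) tvec \<Rightarrow> real)) set"
  where "TM_in_std x \<equiv> (\<lambda>v. (v, 0)) ` T x"

text \<open>An element of the orthogonal complement of \<open>TM\<close> has a form component that vanishes on every tangent
  vector, so that \<open>TM\<close> is its own complement. It is closed because the Dorfman bracket of zero forms
  is zero.\<close>

lemma dirac_structure_tangent: "dirac_structure M (standard_courant M) TM_in_std"
  unfolding dirac_structure_def standard_courant_simps
proof (intro conjI)
  have z: "0 \<in> fibre TsM x" for x by (rule subspace_0[OF subspace_dual])
  show "subbundle M std_bundle TM_in_std"
    unfolding subbundle_def
  proof (intro conjI allI)
    fix x
    obtain k b where b: "basis_of (UNIV :: 'e set) k b" using model_basis by blast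
    obtain c where c: "c \<in> M" "x \<in> fst c" using chart_cover by blast
    note basis = basis_of_fst_image[OF basis_of_tangent[OF c(1) _ b]]
    show "subspace (TM_in_std x)" by (rule basis_of_subspace[OF basis[OF c(2)]])
    show "TM_in_std x \<subseteq> fibre std_bundle x" using z by auto
    show "\<exists>U k e. open U \<and> x \<in> U \<and> (\<forall>i<k. smooth_section_on M std_bundle U (e i)) \<and>
        (\<forall>y\<in>U. basis_of (TM_in_std y) k (\<lambda>i. e i y))"
    proof (rule exI[of _ "fst c"], rule exI[of _ k], rule exI[of _ "\<lambda>i y. (coord c y (b i), 0)"], intro conjI allI impI ballI)
      show "smooth_section_on M std_bundle (fst c) (\<lambda>y. (coord c y (b i), 0))" for i
        by (rule smooth_section_pair[OF smooth_coord_field[OF c(1)]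
          smooth_section_on_zero[OF vector_bundle_cotangent open_chart[OF c(1)]]])
    qed (use c open_chart basis in auto)
  qed
  show "\<forall>x. TM_in_std x = {v \<in> fibre std_bundle x.
      \<forall>w\<in>TM_in_std x. snd v (fst w) + snd w (fst v) = 0}"
  proof (intro allI equalityI subsetI)
    fix x and p :: "('m, 'e) tvec \<times> (('m, 'e) tvec \<Rightarrow> real)" assume "p \<in> TM_in_std x"
    then show "p \<in> {v \<in> fibre std_bundle x.
      \<forall>w\<in>TM_in_std x. snd v (fst w) + snd w (fst v) = 0}" using z by auto
  next
    fix x and p :: "('m, 'e) tvec \<times> (('m, 'e) tvec \<Rightarrow> real)" assume p: "p \<in> {v \<in> fibre std_bundle x.
      \<forall>w\<in>TM_in_std x. snd v (fst w) + snd w (fst v) = 0}"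
    then have mem: "fst p \<in> T x" "snd p \<in> fibre TsM x" by auto
    have "snd p v = 0" if "v \<in> T x" for v using p that by auto
    then have "snd p = 0" using cotangent_eqI[OF mem(2) z] by simp
    then have "p = (fst p, 0)" by (simp add: prod_eq_iff)
    then show "p \<in> TM_in_std x" using mem(1) by blast
  qed
  show "\<forall>a\<in>sections M std_bundle. \<forall>b\<in>sections M std_bundle.
      (\<forall>x. a x \<in> TM_in_std x) \<and> (\<forall>x. b x \<in> TM_in_std x) \<longrightarrow>
      (\<forall>x. (vf_bracket M (\<lambda>y. fst (a y)) (\<lambda>y. fst (b y)) x,
        dorfman (\<lambda>y. fst (a y)) (\<lambda>y. snd (a y)) (\<lambda>y. fst (b y)) (\<lambda>y. snd (b y)) x) \<in> TM_in_std x)"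
  proof (intro ballI impI allI)
    fix a b x assume a: "a \<in> sections M std_bundle" and b: "b \<in> sections M std_bundle"
      and L: "(\<forall>x. a x \<in> TM_in_std x) \<and> (\<forall>x. b x \<in> TM_in_std x)"
    have "snd (a y) = 0" for y
    proof -
      have "a y \<in> TM_in_std y" using L by blast
      then show ?thesis by auto
    qed
    moreover have "snd (b y) = 0" for y
    proof -
      have "b y \<in> TM_in_std y" using L by blast
      then show ?thesis by auto
    qed
    ultimately have "dorfman (\<lambda>y. fst (a y)) (\<lambda>y. snd (a y)) (\<lambda>y. fst (b y)) (\<lambda>y. snd (b y)) x = 0"
      by (simp add: dorfman_zero)
    then show "(vf_bracket M (\<lambda>y. fst (a y)) (\<lambda>y. fst (b y)) x,
        dorfman (\<lambda>y. fst (a y)) (\<lambda>y. snd (a y)) (\<lambda>y. fst (b y)) (\<lambda>y. snd (b y)) x) \<in> TM_in_std x"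
      using vector_field_tangent[OF vf_bracket_section[OF std_sectionD(1)[OF a] std_sectionD(1)[OF b]]] by simp
  qed
qed

lemma vb_morphism_tangent_std: "vb_morphism M TM std_bundle (\<lambda>x v. (v, 0))"
  unfolding vb_morphism_def
proof (intro conjI allI impI)
  fix U s assume s: "open U \<and> smooth_section_on M TM U s"
  show "smooth_section_on M std_bundle U (\<lambda>x. (s x, 0))"
    by (rule smooth_section_pair[OF conjunct2[OF s] smooth_section_on_zero[OF vector_bundle_cotangent conjunct1[OF s]]])
qed (use subspace_0[OF subspace_dual] in \<open>auto simp: linear_on_subspace_def\<close>)


section \<open>IM-2-forms and Dirac bialgebroids\<close>

text \<open>The transpose is smooth because its coefficient on a frame element of \<open>A\<close> is the
  pairing of the image one-form with the vector field.\<close>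

lemma vb_morphism_transpose:
  assumes A: "vector_bundle M (bun A)" and \<sigma>: "vb_morphism M (bun A) TsM \<sigma>"
  shows "vb_morphism M TM (TM \<oplus>\<^sub>b dual_bundle (bun A))
    (\<lambda>x v. (v, transpose_form A \<sigma> x v))"
proof -
  have \<sigma>_lin: "linear_on_subspace (fibre (bun A) x) (\<sigma> x)" for x
    using \<sigma> by (simp add: vb_morphism_def)
  have \<sigma>_cot: "\<sigma> x a \<in> fibre TsM x" if "a \<in> fibre (bun A) x" for x a
    using \<sigma> that unfolding vb_morphism_def by blast
  have dual: "transpose_form A \<sigma> x v \<in> fibre (dual_bundle (bun A)) x" for x v
    using \<sigma>_lin[of x] subspace_add[OF fibre_subspace[OF A]] subspace_scale[OF fibre_subspace[OF A]]
    by (simp add: fibre_dual linear_on_subspace_def transpose_form_def scaleR_fun_apply)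
  show ?thesis
    unfolding vb_morphism_def
  proof (intro conjI allI impI)
    fix x
    show "(\<lambda>v. (v, transpose_form A \<sigma> x v)) ` fibre TM x
        \<subseteq> fibre (TM \<oplus>\<^sub>b dual_bundle (bun A)) x"
      using dual by auto
    have "transpose_form A \<sigma> x (v + w) = transpose_form A \<sigma> x v + transpose_form A \<sigma> x w"
      if "v \<in> T x" "w \<in> T x" for v w
      using cotangentD(1)[OF \<sigma>_cot, of _ x] that
      by (simp add: fun_eq_iff transpose_form_def linear_on_subspace_def)
    moreover have "transpose_form A \<sigma> x (r *\<^sub>R v) = r *\<^sub>R transpose_form A \<sigma> x v"
      if "v \<in> T x" for r v
      using cotangentD(1)[OF \<sigma>_cot, of _ x] that
      by (simp add: fun_eq_iff transpose_form_def linear_on_subspace_def scaleR_fun_apply)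
    ultimately show "linear_on_subspace (fibre TM x) (\<lambda>v. (v, transpose_form A \<sigma> x v))"
      by (simp add: linear_on_subspace_def)
  next
    fix U X assume UX: "open U \<and> smooth_section_on M TM U X"
    then have U: "open U" and X: "smooth_section_on M TM U X" by blast+
    have "smooth_section_on M (dual_bundle (bun A)) U (\<lambda>x. transpose_form A \<sigma> x (X x))"
    proof (rule smooth_section_dualI[OF A dual])
      fix V k e i assume e: "(V, k, e) \<in> frames (bun A)" and i: "i < (k :: nat)"
      have op: "open (U \<inter> V)" using U vector_bundle_frame(1)[OF A e] by blast
      have ei: "smooth_section_on M (bun A) (U \<inter> V) (e i)"
        by (rule smooth_section_on_subset[OF vector_bundle_frame(3)[OF A e i]]) blast
      then have "smooth_section_on M TsM (U \<inter> V) (\<lambda>x. \<sigma> x (e i x))"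
        using \<sigma> op unfolding vb_morphism_def by blast
      then have "smooth_fun_on M (U \<inter> V) (\<lambda>x. \<sigma> x (e i x) (X x))"
        by (rule smooth_dual_pairing[OF vector_bundle_tangent op _ smooth_section_on_subset[OF X Int_lower1]])
      then show "smooth_fun_on M (U \<inter> V) (\<lambda>x. transpose_form A \<sigma> x (X x) (e i x))"
        by (rule smooth_fun_on_eq[OF op])
          (use smooth_section_on_fibre[OF ei] in \<open>simp add: transpose_form_def\<close>)
    qed
    then show "smooth_section_on M (TM \<oplus>\<^sub>b dual_bundle (bun A)) U
        (\<lambda>x. (X x, transpose_form A \<sigma> x (X x)))"
      by (rule smooth_section_pair[OF X])
  qed
qed

lemma degenerate_courant_simps:
  "bun (degenerate_courant M A) = bun A \<oplus>\<^sub>b TsM"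
  "anchor (degenerate_courant M A) x p = anchor A x (fst p)"
  "bracket (degenerate_courant M A) s t = (\<lambda>x. (bracket A (\<lambda>y. fst (s y)) (\<lambda>y. fst (t y)) x,
    dorfman (\<lambda>y. anchor A y (fst (s y))) (\<lambda>y. snd (s y)) (\<lambda>y. anchor A y (fst (t y))) (\<lambda>y. snd (t y)) x))"
  "pairing (degenerate_courant M A) x p q = snd q (anchor A x (fst p)) + snd p (anchor A x (fst q))"
  by (simp_all add: degenerate_courant_def dorfman_def)

text \<open>The morphism \<open>\<Phi>\<close>.\<close>

definition im_map :: "('m, 'e, 'v::real_vector) algebroid \<Rightarrow> ('m \<Rightarrow> 'v \<Rightarrow> ('m, 'e) tvec \<Rightarrow> real) \<Rightarrow>
    'm \<Rightarrow> 'v \<times> (('m, 'e) tvec \<Rightarrow> real) \<Rightarrow> ('m, 'e) tvec \<times> (('m, 'e) tvec \<Rightarrow> real)"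
  where "im_map A \<sigma> x \<tau> = (anchor A x (fst \<tau>), \<sigma> x (fst \<tau>) + snd \<tau>)"

lemma sections_morphism:
  assumes "vb_morphism M E F \<phi>" "s \<in> sections M E"
  shows "(\<lambda>x. \<phi> x (s x)) \<in> sections M F"
  using assms open_UNIV unfolding vb_morphism_def by blast

context
  fixes A :: "('m, 'e, 'v::real_vector) algebroid" and \<sigma> :: "'m \<Rightarrow> 'v \<Rightarrow> ('m, 'e) tvec \<Rightarrow> real"
  assumes A: "lie_algebroid M A" and IM: "IM_2_form M A \<sigma>"
begin

lemma algebroid_anchored: "anchored_bracket M A"
  using A by (simp add: lie_algebroid_def)

lemma algebroid_bundle: "vector_bundle M (bun A)"
  using algebroid_anchored by (simp add: anchored_bracket_def)

lemma anchor_morphism: "vb_morphism M (bun A) TM (anchor A)"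
  using algebroid_anchored by (simp add: anchored_bracket_def)

lemma form_morphism: "vb_morphism M (bun A) TsM \<sigma>"
  using IM by (simp add: IM_2_form_def)

lemma anchor_in: "a \<in> fibre (bun A) x \<Longrightarrow> anchor A x a \<in> T x"
  using anchor_morphism unfolding vb_morphism_def by auto

lemma form_in: "a \<in> fibre (bun A) x \<Longrightarrow> \<sigma> x a \<in> fibre TsM x"
  using form_morphism unfolding vb_morphism_def by blast

lemma fibre_linear:
  "linear_on_subspace (fibre (bun A) x) (anchor A x)" "linear_on_subspace (fibre (bun A) x) (\<sigma> x)"
  using anchor_morphism form_morphism by (simp_all add: vb_morphism_def)

lemma vb_morphism_im_map: "vb_morphism M (bun A \<oplus>\<^sub>b TsM) std_bundle (im_map A \<sigma>)"
  unfolding vb_morphism_def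
proof (intro conjI allI impI)
  fix x
  show "im_map A \<sigma> x ` fibre (bun A \<oplus>\<^sub>b TsM) x \<subseteq> fibre std_bundle x"
    using anchor_in subspace_add[OF subspace_dual form_in] by (auto simp: im_map_def)
  show "linear_on_subspace (fibre (bun A \<oplus>\<^sub>b TsM) x) (im_map A \<sigma> x)"
    using fibre_linear[of x] by (auto simp: linear_on_subspace_def im_map_def scaleR_add_right)
next
  fix U s assume s: "open U \<and> smooth_section_on M (bun A \<oplus>\<^sub>b TsM) U s"
  then have U: "open U" by blast
  note comp = smooth_section_components[OF algebroid_bundle vector_bundle_cotangent U conjunct2[OF s]]
  have "smooth_section_on M TM U (\<lambda>x. anchor A x (fst (s x)))"
    "smooth_section_on M TsM U (\<lambda>x. \<sigma> x (fst (s x)))"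
    using anchor_morphism form_morphism U comp(1) unfolding vb_morphism_def by blast+
  then show "smooth_section_on M std_bundle U (\<lambda>x. im_map A \<sigma> x (s x))"
    unfolding im_map_def
    by (intro smooth_section_pair smooth_section_on_add[OF vector_bundle_cotangent U] comp(2))
qed

text \<open>The bracket condition on \<open>\<sigma>\<close> states that \<open>\<sigma>[a, b]\<close> is the form component of the bracket of
  \<open>(\<rho> a, \<sigma> a)\<close> and \<open>(\<rho> b, \<sigma> b)\<close>; the forms \<open>\<theta>\<close> contribute additively.\<close>

lemma im_map_bracket:
  assumes s: "s \<in> sections M (bun A \<oplus>\<^sub>b TsM)" and t: "t \<in> sections M (bun A \<oplus>\<^sub>b TsM)"
  shows "(\<lambda>x. im_map A \<sigma> x (bracket (degenerate_courant M A) s t x))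
    = bracket (standard_courant M) (\<lambda>x. im_map A \<sigma> x (s x)) (\<lambda>x. im_map A \<sigma> x (t x))"
proof -
  define a b where "a = (\<lambda>x. fst (s x))" and "b = (\<lambda>x. fst (t x))"
  note comp = smooth_section_components[OF algebroid_bundle vector_bundle_cotangent open_UNIV]
  have ab: "a \<in> sections M (bun A)" "b \<in> sections M (bun A)"
    and forms: "(\<lambda>x. snd (s x)) \<in> one_forms" "(\<lambda>x. snd (t x)) \<in> one_forms"
    using comp[of s] comp[of t] s t by (simp_all add: a_def b_def)
  note \<rho> = sections_morphism[OF anchor_morphism ab(1)] sections_morphism[OF anchor_morphism ab(2)]
  note \<sigma>s = sections_morphism[OF form_morphism ab(1)] sections_morphism[OF form_morphism ab(2)]
  have "(\<lambda>x. anchor A x (bracket A a b x)) = vf_bracket M (\<lambda>x. anchor A x (a x)) (\<lambda>x. anchor A x (b x))"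
    using algebroid_anchored ab unfolding anchored_bracket_def by blast
  from fun_cong[OF this] have 1: "anchor A x (bracket A a b x)
      = vf_bracket M (\<lambda>x. anchor A x (a x)) (\<lambda>x. anchor A x (b x)) x" for x .
  have "(\<lambda>x. \<sigma> x (bracket A a b x)) =
        lie_deriv M (\<lambda>x. anchor A x (a x)) (\<lambda>x. \<sigma> x (b x)) -
        contract M (\<lambda>x. anchor A x (b x)) (ext_deriv M (\<lambda>x. \<sigma> x (a x)))"
    using IM ab unfolding IM_2_form_def by blast
  from fun_cong[OF this] have 2: "\<sigma> x (bracket A a b x)
      = dorfman (\<lambda>x. anchor A x (a x)) (\<lambda>x. \<sigma> x (a x)) (\<lambda>x. anchor A x (b x)) (\<lambda>x. \<sigma> x (b x)) x" for x
    by (simp add: dorfman_def)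
  note add = dorfman_add_forms[OF \<rho>(1) \<sigma>s(1) forms(1) \<rho>(2) \<sigma>s(2) forms(2)]
  show ?thesis
    unfolding degenerate_courant_simps standard_courant_simps im_map_def fst_conv snd_conv
      1[unfolded a_def b_def] 2[unfolded a_def b_def] add[unfolded a_def b_def] by (rule refl)
qed

lemma im_map_pairing:
  assumes "p \<in> fibre (bun A \<oplus>\<^sub>b TsM) x" "q \<in> fibre (bun A \<oplus>\<^sub>b TsM) x"
  shows "pairing (standard_courant M) x (im_map A \<sigma> x p) (im_map A \<sigma> x q)
    = pairing (degenerate_courant M A) x p q"
proof -
  have "fst p \<in> fibre (bun A) x" "fst q \<in> fibre (bun A) x" using assms by auto
  then have "\<sigma> x (fst q) (anchor A x (fst p)) = - \<sigma> x (fst p) (anchor A x (fst q))"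
    using IM unfolding IM_2_form_def by blast
  then show ?thesis by (simp add: standard_courant_simps degenerate_courant_simps im_map_def)
qed

lemma im_map_surjective:
  "{im_map A \<sigma> x \<tau> + (u, 0) | \<tau> u. \<tau> \<in> fibre (bun A \<oplus>\<^sub>b TsM) x \<and> u \<in> T x}
    = fibre std_bundle x"
proof (intro equalityI subsetI)
  fix p assume "p \<in> {im_map A \<sigma> x \<tau> + (u, 0) | \<tau> u. \<tau> \<in> fibre (bun A \<oplus>\<^sub>b TsM) x \<and> u \<in> T x}"
  then show "p \<in> fibre std_bundle x"
    using subspace_add[OF subspace_dual form_in] subspace_add[OF subspace_tangent anchor_in]
    by (auto simp: im_map_def)
next
  fix p assume p: "p \<in> fibre std_bundle x"
  have zero: "anchor A x 0 = 0" "\<sigma> x 0 = 0"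
    using linear_on_subspace_zero[OF fibre_subspace[OF algebroid_bundle]] fibre_linear by blast+
  have "p = im_map A \<sigma> x (0, snd p) + (fst p, 0)"
    by (simp add: im_map_def zero prod_eq_iff)
  moreover have "(0, snd p) \<in> fibre (bun A \<oplus>\<^sub>b TsM) x" "fst p \<in> T x"
    using p subspace_0[OF fibre_subspace[OF algebroid_bundle]] by auto
  ultimately show "p \<in> {im_map A \<sigma> x \<tau> + (u, 0) | \<tau> u. \<tau> \<in> fibre (bun A \<oplus>\<^sub>b TsM) x \<and> u \<in> T x}"
    by blast
qed

lemma dirac_bialgebroid_IM:
  "dirac_bialgebroid_with_ambient M (standard_courant M) (\<lambda>x v. (v, 0))
    A (tangent_algebroid M) (\<lambda>x v. (v, transpose_form A \<sigma> x v))"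
proof -
  have tangent: "bun (tangent_algebroid M) = TM"
    "anchor (tangent_algebroid M) x v = v" "bracket (tangent_algebroid M) = vf_bracket M" for x v
    by (simp_all add: tangent_algebroid_def)
  have bracket: "(\<lambda>x. (vf_bracket M u v x, 0))
      = bracket (standard_courant M) (\<lambda>x. (u x, 0)) (\<lambda>x. (v x, 0))" for u v
    by (simp add: standard_courant_simps dorfman_zero)
  have pairing: "pairing (standard_courant M) x (u, 0) (im_map A \<sigma> x \<tau>)
      = transpose_form A \<sigma> x u (fst \<tau>) + snd \<tau> u"
    if "\<tau> \<in> fibre (bun A \<oplus>\<^sub>b TsM) x" for x u \<tau>
    using that by (auto simp: standard_courant_simps im_map_def transpose_form_def)
  show ?thesis
    unfolding dirac_bialgebroid_with_ambient_def tangent Let_def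
  proof (intro conjI A lie_algebroid_tangent vb_morphism_transpose[OF algebroid_bundle form_morphism]
      courant_algebroid_standard, goal_cases)
    case 1
    show ?case by (simp add: inj_on_def)
  next
    case 2
    show ?case by simp
  next
    case 3
    show ?case using vb_morphism_tangent_std by (simp add: standard_courant_simps)
  next
    case 4
    show ?case by (simp add: inj_on_def)
  next
    case 5
    show ?case using dirac_structure_tangent by simp
  next
    case 6
    show ?case by (simp add: standard_courant_simps)
  next
    case 7
    show ?case using bracket by blast
  next
    case 8
    show ?case
    proof (rule exI[of _ "im_map A \<sigma>"], intro conjI allI ballI)
      show "vb_morphism M (bun (degenerate_courant M A)) (bun (standard_courant M)) (im_map A \<sigma>)"
        using vb_morphism_im_map by (simp add: standard_courant_simps degenerate_courant_simps)
    qed (use im_map_pairing im_map_bracket im_map_surjective pairing in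
      \<open>simp_all add: standard_courant_simps(1,2) degenerate_courant_simps(1,2) im_map_def\<close>)
  qed
qed

end

end

theorem mainTheorem8:
  fixes M :: "('m::{t2_space, second_countable_topology}, 'e::real_inner) chart set"
    and A :: "('m, 'e, 'v::real_vector) algebroid"
    and \<sigma> :: "'m \<Rightarrow> 'v \<Rightarrow> ('m, 'e) tvec \<Rightarrow> real"
  assumes "smooth_manifold M"
    and "lie_algebroid M A"
    and "IM_2_form M A \<sigma>"
  shows "dirac_bialgebroid_with_ambient M (standard_courant M) (\<lambda>x v. (v, 0))
    A (tangent_algebroid M) (\<lambda>x v. (v, transpose_form A \<sigma> x v))"
proof -
  obtain B\<^sub>0 :: "'e set" where "finite B\<^sub>0" "span B\<^sub>0 = UNIV"
    using assms(1) unfolding smooth_manifold_def by blast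
  then obtain B :: "'e set" where "finite_expansion B"
    using finite_expansion_exists by blast
  then interpret manifold B M
    using assms(1) by (simp add: manifold_def manifold_axioms_def)
  show ?thesis by (rule dirac_bialgebroid_IM[OF assms(2,3)])
qed

end
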